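(* Let $H, S$ be nuclear operators on $L^2=L^2(\mathbb{R})$ with kernels $\boldsymbol{H}\neq\theta_1$ and $\boldsymbol{S}$, for $\lambda\in\mathbb{C}$ put $\boldsymbol{T}_\lambda=\boldsymbol{H}-\lambda\boldsymbol{S}$, and suppose that: $\boldsymbol{S}$ is a $K^0$ kernel of Mercer type; $\boldsymbol{T}_\lambda$ is a $K^0$ kernel of Mercer type for every $\lambda\in\mathbb{C}$; and the positive nuclear operators $A=(H^*H+S^*S)^{1/2}$ and $\widetilde{A}=(HH^*+SS^* )^{1/2}$ are induced by $K^0$ kernels $\boldsymbol{A}$, $\widetilde{\boldsymbol{A}}$, which satisfy $\int\boldsymbol{A}(s,s)\,ds=\operatorname{tr}A<+\infty$ and $\int\widetilde{\boldsymbol{A}}(s,s)\,ds=\operatorname{tr}\widetilde{A}<+\infty$. For $n,p=0,1,2,\dots$ let $$B_n^p[\boldsymbol{T}_\lambda]\begin{pmatrix} s_1&\dots&s_p\\ t_1&\dots&t_p\end{pmatrix}=\frac1{n!}\int\cdots\int \boldsymbol{T}_\lambda\begin{pmatrix} s_1&\dots&s_p&\xi_1&\dots&\xi_n\\ t_1&\dots&t_p&\xi_1&\dots&\xi_n\end{pmatrix}d\xi_1\dots d\xi_n ,$$ where $\boldsymbol{T}_\lambda\begin{pmatrix} x_1&\dots&x_\nu\\ y_1&\dots&y_\nu\end{pmatrix}$ is $\det[\boldsymbol{T}_\lambda(x_i,y_j)]_{i,j=1}^{\nu}$ if $\nu>0$ and $1$ if $\nu=0$. For $p=0,1,2,\dots$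 consider the series $$D_p[\boldsymbol{T}_\lambda]\begin{pmatrix} s_1&\dots&s_p\\ t_1&\dots&t_p\end{pmatrix}:=\sum_{n=0}^\infty B_n^p[\boldsymbol{T}_\lambda]\begin{pmatrix} s_1&\dots&s_p\\ t_1&\dots&t_p\end{pmatrix}.$$ Then: (i) For every compact subset $\mathfrak{K}\subset\mathbb{C}$ the following series converge: $$\sum_{n=0}^\infty \sup_{\lambda\in\mathfrak{K}}\|B_n^p[\boldsymbol{T}_\lambda]\|_{C(\mathbb{R}^{2p},\mathbb{C})}\quad(p\geqslant0),$$ $$\sum_{n=0}^\infty \sup_{\lambda\in\mathfrak{K}}\|B_n^p[\boldsymbol{T}_\lambda]\|_{C(\mathbb{R}^{2p-1},L^2)}\quad(p\geqslant1),$$ $$\sum_{n=0}^\infty \sup_{\lambda\in\mathfrak{K}}\|B_n^p[\boldsymbol{T}_\lambda]\|_{C(\mathbb{R}^{2p-2},L^2(\mathbb{R}^2))}\quad(p\geqslant1),$$ meaning that the sum-function $\lambda\mapsto D_p[\boldsymbol{T}_\lambda]$, viewed as a function from $\mathbb{C}$ to $C(\mathbb{R}^{2p},\mathbb{C})$, to $C(\mathbb{R}^{2p-1},L^2)$, or to $C(\mathbb{R}^{2p-2},L^2(\mathbb{R}^2))$, is an entire function of $\lambda$. (In the second and third cases this holds for each choice of the variable, respectively pair of variables, used as the underlying variable(s) of $L^2$, respectively $L^2(\mathbb{R}^2)$.) (ii) There exist $p\geqslant0$ and $\lambda\in\mathbb{C}$ such that $D_p[\boldsymbol{T}_\lambda]\neq\theta_p$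 in $C(\mathbb{R}^{2p},\mathbb{C})$.
   Context: $L^2=L^2(\mathbb{R})$ is the complex Hilbert space of Lebesgue square-integrable functions with $\langle f,g\rangle=\int f\overline{g}$; integrals without indicated domain are over $\mathbb{R}$ in each variable. For a locally compact space $X$ and a Banach space $B$, $C(X,B)$ is the Banach space of continuous functions $X\to B$ vanishing at infinity (for every $\varepsilon>0$, $\|f(x)\|_B<\varepsilon$ outside some compact set), with norm $\sup_{x\in X}\|f(x)\|_B$; $C(\mathbb{R}^0,B)$ is identified with $B$. $\theta_p$ is the zero element of $C(\mathbb{R}^{2p},\mathbb{C})$. A bounded operator $T$ on $L^2$ is integral with kernel $\boldsymbol{T}$ (is induced by $\boldsymbol{T}$) if $\boldsymbol{T}:\mathbb{R}^2\to\mathbb{C}$ is measurable and, for each $f\in L^2$, $(Tf)(s)=\int\boldsymbol{T}(s,t)f(t)\,dt$ for a.e. $s$. A bounded operator $A$ on $L^2$ is nuclear if $\sum_n|\langle Au_n,u_n\rangle|<+\infty$ for every orthonormal basis $\{u_n\}$ of $L^2$; every nuclear operator is an integral operator with a Hilbert-Schmidt kernel. A function $\boldsymbol{T}\in C(\mathbb{R}^2,\mathbb{C})$ is a $K^0$ kernel if the maps $s\mapsto\overline{\boldsymbol{T}(s,\cdot)}$ and $s\mapsto\boldsymbol{T}(\cdot,s)$ belong to $C(\mathbb{R},L^2)$. For a bounded operator $T$ on $L^2$, $\mathcal{M}^+(T)$ is the set of all positive bounded operators $P$ on $L^2$ (i.e. $\langle Px,x\rangle\geqslant0$ for all $x$)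 that can be written as $P=TB$ or as $P=BT$ with $B$ a bounded operator on $L^2$. A $K^0$ kernel $\boldsymbol{T}$ is of Mercer type if it induces a bounded integral operator $T$ on $L^2$ such that every operator in $\mathcal{M}^+(T)$ is an integral operator induced by a $K^0$ kernel. Viewing $B_n^p[\boldsymbol{T}_\lambda]$ in the three spaces. For fixed $\lambda$ and $n$, $B_n^p[\boldsymbol{T}_\lambda]$ as a function of the $2p$ real variables $s_1,\dots,s_p,t_1,\dots,t_p$ lies in $C(\mathbb{R}^{2p},\mathbb{C})$. For $p\geqslant1$, singling out any one of the $2p$ variables and regarding $B_n^p[\boldsymbol{T}_\lambda]$ as a function of the other $2p-1$ variables, with values functions of the singled-out variable, gives an element of $C(\mathbb{R}^{2p-1},L^2)$. Singling out any pair $(s_i,t_j)$, $1\leqslant i,j\leqslant p$, and regarding $B_n^p[\boldsymbol{T}_\lambda]$ as a function of the other $2p-2$ variables, with values functions of $(s_i,t_j)$, gives an element of $C(\mathbb{R}^{2p-2},L^2(\mathbb{R}^2))$. *)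

theory Defs
  imports
    "HOL-Analysis.Analysis"
    "Jordan_Normal_Form.Determinant"
begin

section \<open>Complex normed spaces\<close>

class complex_normed_vector = real_normed_vector +
  fixes scaleC :: "complex \<Rightarrow> 'a \<Rightarrow> 'a"  (infixr \<open>*\<^sub>C\<close> 75)
  assumes scaleC_add_right: "c *\<^sub>C (x + y) = c *\<^sub>C x + c *\<^sub>C y"
    and scaleC_add_left: "(b + c) *\<^sub>C x = b *\<^sub>C x + c *\<^sub>C x"
    and scaleC_scaleC: "b *\<^sub>C c *\<^sub>C x = (b * c) *\<^sub>C x"
    and scaleC_one: "1 *\<^sub>C x = x"
    and scaleR_eq_scaleC: "r *\<^sub>R x = complex_of_real r *\<^sub>C x"
    and norm_scaleC: "norm (c *\<^sub>C x) = cmod c * norm x"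

instantiation complex :: complex_normed_vector
begin

definition scaleC_complex :: "complex \<Rightarrow> complex \<Rightarrow> complex"
  where "scaleC_complex c x = c * x"

instance
  by standard (auto simp: scaleC_complex_def algebra_simps norm_mult scaleR_conv_of_real)

end

definition bounded_op :: "('a::complex_normed_vector \<Rightarrow> 'b::complex_normed_vector) \<Rightarrow> bool"
  where "bounded_op T \<longleftrightarrow> bounded_linear T \<and> (\<forall>c f. T (c *\<^sub>C f) = c *\<^sub>C T f)"


section \<open>The Hilbert space \<open>L\<^sup>2\<close>\<close>

text \<open>
  Representatives are Borel functions. Every Lebesgue measurable function agrees almost
  everywhere with a Borel one, so this gives the same space of classes.
\<close>

definition square_integrable :: "('a::euclidean_space \<Rightarrow> complex) set"
  where "square_integrable =
    {f. f \<in> borel_measurable lborel \<and> integrable lborel (\<lambda>x. (cmod (f x))\<^sup>2)}"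

lemma square_integrable_zero: "(\<lambda>x. 0) \<in> square_integrable"
  by (simp add: square_integrable_def)

lemma square_integrable_cmult:
  "f \<in> square_integrable \<Longrightarrow> (\<lambda>x. c * f x) \<in> square_integrable"
  by (auto simp: square_integrable_def norm_mult power_mult_distrib)

lemma square_integrable_add:
  assumes f: "f \<in> square_integrable" and g: "g \<in> square_integrable"
  shows "(\<lambda>x. f x + g x) \<in> square_integrable"
proof -
  have [measurable]: "f \<in> borel_measurable lborel" "g \<in> borel_measurable lborel"
    using f g by (auto simp: square_integrable_def)
  have bound: "(cmod (f x + g x))\<^sup>2 \<le> 2 * (cmod (f x))\<^sup>2 + 2 * (cmod (g x))\<^sup>2" for x
  proof -
    have "(cmod (f x + g x))\<^sup>2 \<le> (cmod (f x) + cmod (g x))\<^sup>2"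
      by (intro power_mono norm_triangle_ineq) auto
    also have "\<dots> \<le> 2 * (cmod (f x))\<^sup>2 + 2 * (cmod (g x))\<^sup>2"
      using sum_squares_bound[of "cmod (f x)" "cmod (g x)"] by (simp add: power2_sum)
    finally show ?thesis .
  qed
  have "integrable lborel (\<lambda>x. 2 * (cmod (f x))\<^sup>2 + 2 * (cmod (g x))\<^sup>2)"
    using f g by (auto simp: square_integrable_def)
  then have "integrable lborel (\<lambda>x. (cmod (f x + g x))\<^sup>2)"
    by (rule Bochner_Integration.integrable_bound) (use bound in auto)
  then show ?thesis
    by (simp add: square_integrable_def)
qed

lemma integrable_mult_cnj:
  assumes f: "f \<in> square_integrable" and g: "g \<in> square_integrable"
  shows "integrable lborel (\<lambda>x. f x * cnj (g x))"
proof -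
  have [measurable]: "f \<in> borel_measurable lborel" "g \<in> borel_measurable lborel"
    using f g by (auto simp: square_integrable_def)
  have bound: "cmod (f x * cnj (g x)) \<le> (cmod (f x))\<^sup>2 + (cmod (g x))\<^sup>2" for x
  proof -
    have "2 * cmod (f x) * cmod (g x) \<le> (cmod (f x))\<^sup>2 + (cmod (g x))\<^sup>2"
      by (rule sum_squares_bound)
    moreover have "0 \<le> cmod (f x) * cmod (g x)" by simp
    ultimately show ?thesis
      unfolding norm_mult complex_mod_cnj by linarith
  qed
  have [measurable]: "cnj \<in> borel_measurable borel"
    by (intro borel_measurable_continuous_onI continuous_intros)
  have "integrable lborel (\<lambda>x. (cmod (f x))\<^sup>2 + (cmod (g x))\<^sup>2)"
    using f g by (auto simp: square_integrable_def)
  then show ?thesis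
    by (rule Bochner_Integration.integrable_bound) (use bound in auto)
qed

quotient_type (overloaded) 'a L2 = "'a::euclidean_space \<Rightarrow> complex" / partial:
  "\<lambda>f g. f \<in> square_integrable \<and> g \<in> square_integrable \<and> (AE x in lborel. f x = g x)"
proof (rule part_equivpI)
  show "\<exists>f::'a \<Rightarrow> complex.
      f \<in> square_integrable \<and> f \<in> square_integrable \<and> (AE x in lborel. f x = f x)"
    using square_integrable_zero by auto
qed (auto intro!: sympI transpI elim!: AE_mp)

definition fun_of :: "'a::euclidean_space L2 \<Rightarrow> 'a \<Rightarrow> complex"
  where "fun_of = rep_L2"

text \<open>Only meaningful for \<open>f \<in> square_integrable\<close>.\<close>

definition to_L2 :: "('a::euclidean_space \<Rightarrow> complex) \<Rightarrow> 'a L2"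
  where "to_L2 = abs_L2"

lift_definition cinner :: "'a::euclidean_space L2 \<Rightarrow> 'a L2 \<Rightarrow> complex"
  is "\<lambda>f g. LINT x|lborel. f x * cnj (g x)"
proof -
  fix f f' g g' :: "'a \<Rightarrow> complex"
  assume f: "f \<in> square_integrable \<and> f' \<in> square_integrable \<and> (AE x in lborel. f x = f' x)"
    and g: "g \<in> square_integrable \<and> g' \<in> square_integrable \<and> (AE x in lborel. g x = g' x)"
  show "(LINT x|lborel. f x * cnj (g x)) = (LINT x|lborel. f' x * cnj (g' x))"
  proof (rule integral_cong_AE)
    show "AE x in lborel. f x * cnj (g x) = f' x * cnj (g' x)"
      using f g by (auto elim: AE_mp)
  qed (use f g integrable_mult_cnj borel_measurable_integrable in blast)+
qed

lemma cinner_commute: "cinner f g = cnj (cinner g f)"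
  proof transfer
  fix f g :: "'a \<Rightarrow> complex"
  have "(LINT x|lborel. f x * cnj (g x)) = (LINT x|lborel. cnj (g x * cnj (f x)))"
    by (simp only: complex_cnj_mult complex_cnj_cnj mult.commute)
  then show "(LINT x|lborel. f x * cnj (g x)) = cnj (LINT x|lborel. g x * cnj (f x))"
    by (rule trans[OF _ Bochner_Integration.integral_cnj])
qed

lift_definition norm_square :: "'a::euclidean_space L2 \<Rightarrow> real"
  is "\<lambda>f. LINT x|lborel. (cmod (f x))\<^sup>2"
  by (intro integral_cong_AE) (auto simp: square_integrable_def elim: AE_mp)

lemma cinner_self: "cinner f f = complex_of_real (norm_square f)"
  by transfer (simp only: complex_norm_square [symmetric] of_real_power [symmetric] integral_complex_of_real)

instantiation L2 :: (euclidean_space) real_vector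
begin

lift_definition zero_L2 :: "'a L2" is "\<lambda>x. 0"
  by (simp add: square_integrable_zero)

lift_definition plus_L2 :: "'a L2 \<Rightarrow> 'a L2 \<Rightarrow> 'a L2" is "\<lambda>f g x. f x + g x"
  by (auto simp: square_integrable_add elim: AE_mp)

lift_definition uminus_L2 :: "'a L2 \<Rightarrow> 'a L2" is "\<lambda>f x. - f x"
  using square_integrable_cmult[of _ "-1"] by (auto elim: AE_mp)

lift_definition minus_L2 :: "'a L2 \<Rightarrow> 'a L2 \<Rightarrow> 'a L2" is "\<lambda>f g x. f x - g x"
  using square_integrable_add square_integrable_cmult[of _ "-1"]
  by (fastforce elim: AE_mp)

lift_definition scaleR_L2 :: "real \<Rightarrow> 'a L2 \<Rightarrow> 'a L2" is "\<lambda>r f x. complex_of_real r * f x"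
  by (auto simp: square_integrable_cmult elim: AE_mp)

instance
proof
  fix f g h :: "'a L2" and r :: real
  show "f + g + h = f + (g + h)"
    by transfer (auto simp: algebra_simps intro!: square_integrable_add)
  show "f + g = g + f"
    by transfer (auto simp: algebra_simps intro!: square_integrable_add)
  show "0 + f = f"
    by transfer auto
  show "- f + f = 0"
    by transfer (auto simp: square_integrable_zero)
  show "f - g = f + - g"
    by transfer (use square_integrable_add square_integrable_cmult[of _ "-1"] in fastforce)
  show "r *\<^sub>R (f + g) = r *\<^sub>R f + r *\<^sub>R g"
    by transfer (auto simp: distrib_left distrib_right intro!: square_integrable_add square_integrable_cmult)
  show "(r + s) *\<^sub>R f = r *\<^sub>R f + s *\<^sub>R f" for s
    by transfer (auto simp: distrib_left distrib_right intro!: square_integrable_add square_integrable_cmult)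
  show "r *\<^sub>R s *\<^sub>R f = (r * s) *\<^sub>R f" for s
    by transfer (auto simp: mult.assoc square_integrable_cmult
        square_integrable_cmult[of _ "complex_of_real _ * complex_of_real _", unfolded mult.assoc])
  show "1 *\<^sub>R f = f"
    by transfer auto
qed

end

instantiation L2 :: (euclidean_space) real_inner
begin

definition inner_L2 :: "'a L2 \<Rightarrow> 'a L2 \<Rightarrow> real"
  where "inner_L2 f g = Re (cinner f g)"

definition norm_L2 :: "'a L2 \<Rightarrow> real"
  where "norm_L2 f = sqrt (inner f f)"

definition sgn_L2 :: "'a L2 \<Rightarrow> 'a L2"
  where "sgn_L2 f = f /\<^sub>R norm f"

definition dist_L2 :: "'a L2 \<Rightarrow> 'a L2 \<Rightarrow> real"
  where "dist_L2 f g = norm (f - g)"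

definition uniformity_L2 :: "('a L2 \<times> 'a L2) filter"
  where "uniformity_L2 = (INF e\<in>{0<..}. principal {(f, g). dist f g < e})"

definition open_L2 :: "'a L2 set \<Rightarrow> bool"
  where "open_L2 U \<longleftrightarrow> (\<forall>f\<in>U. eventually (\<lambda>(f', g). f' = f \<longrightarrow> g \<in> U) uniformity)"

instance
proof
  fix f g h :: "'a L2" and r :: real
  show "dist f g = norm (f - g)"
    by (rule dist_L2_def)
  show "sgn f = f /\<^sub>R norm f"
    by (rule sgn_L2_def)
  show "uniformity = (INF e\<in>{0<..}. principal {(f, g :: 'a L2). dist f g < e})"
    by (rule uniformity_L2_def)
  show "open U \<longleftrightarrow> (\<forall>f\<in>U. eventually (\<lambda>(f', g). f' = f \<longrightarrow> g \<in> U) uniformity)"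
    for U :: "'a L2 set"
    by (rule open_L2_def)
  show "norm f = sqrt (inner f f)"
    by (rule norm_L2_def)
  show "inner f g = inner g f"
    unfolding inner_L2_def by (subst cinner_commute) simp
  show "inner (f + g) h = inner f h + inner g h"
    unfolding inner_L2_def
    by transfer (auto simp: distrib_right integrable_mult_cnj)
  show "inner (r *\<^sub>R f) g = r * inner f g"
    unfolding inner_L2_def
    by transfer (auto simp: mult.assoc integrable_mult_cnj)
  show "0 \<le> inner f f"
    unfolding inner_L2_def cinner_self
    by transfer auto
  show "inner f f = 0 \<longleftrightarrow> f = 0"
    unfolding inner_L2_def cinner_self Re_complex_of_real
    by transfer
      (auto simp: square_integrable_def integral_nonneg_eq_0_iff_AE)
qed

end

instantiation L2 :: (euclidean_space) complex_normed_vector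
begin

lift_definition scaleC_L2 :: "complex \<Rightarrow> 'a L2 \<Rightarrow> 'a L2" is "\<lambda>c f x. c * f x"
  by (auto simp: square_integrable_cmult elim: AE_mp)

instance
proof
  fix f g :: "'a L2" and b c :: complex and r :: real
  show "c *\<^sub>C (f + g) = c *\<^sub>C f + c *\<^sub>C g"
    by transfer (auto simp: distrib_left distrib_right intro!: square_integrable_add square_integrable_cmult)
  show "(b + c) *\<^sub>C f = b *\<^sub>C f + c *\<^sub>C f"
    by transfer (auto simp: distrib_left distrib_right intro!: square_integrable_add square_integrable_cmult)
  show "b *\<^sub>C c *\<^sub>C f = (b * c) *\<^sub>C f"
    by transfer (auto simp: mult.assoc square_integrable_cmult
        square_integrable_cmult[of _ "_ * _", unfolded mult.assoc])
  show "1 *\<^sub>C f = f"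
    by transfer auto
  show "r *\<^sub>R f = complex_of_real r *\<^sub>C f"
    by transfer (auto simp: square_integrable_cmult)
  have "inner (c *\<^sub>C f) (c *\<^sub>C f) = (cmod c)\<^sup>2 * inner f f"
    unfolding inner_L2_def cinner_self Re_complex_of_real
    by transfer (simp add: norm_mult power_mult_distrib)
  then show "norm (c *\<^sub>C f) = cmod c * norm f"
    by (simp add: norm_eq_sqrt_inner real_sqrt_mult)
qed

end


section \<open>Operators on \<open>L\<^sup>2\<close>\<close>

type_synonym op_L2 = "real L2 \<Rightarrow> real L2"

definition is_adjoint :: "op_L2 \<Rightarrow> op_L2 \<Rightarrow> bool"
  where "is_adjoint T T' \<longleftrightarrow> bounded_op T' \<and> (\<forall>f g. cinner (T f) g = cinner f (T' g))"

definition positive_op :: "op_L2 \<Rightarrow> bool"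
  where "positive_op P \<longleftrightarrow> bounded_op P \<and> (\<forall>f. cinner (P f) f \<in> \<real>\<^sub>\<ge>\<^sub>0)"

definition is_sqrt_op :: "op_L2 \<Rightarrow> op_L2 \<Rightarrow> bool"
  where "is_sqrt_op A P \<longleftrightarrow> positive_op A \<and> A \<circ> A = P"

definition orthonormal_basis :: "(nat \<Rightarrow> real L2) \<Rightarrow> bool"
  where "orthonormal_basis u \<longleftrightarrow>
    (\<forall>m n. cinner (u m) (u n) = (if m = n then 1 else 0)) \<and>
    closure (module.span scaleC (range u)) = UNIV"

definition nuclear :: "op_L2 \<Rightarrow> bool"
  where "nuclear T \<longleftrightarrow> bounded_op T \<and>
    (\<forall>u. orthonormal_basis u \<longrightarrow> summable (\<lambda>n. cmod (cinner (T (u n)) (u n))))"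

definition has_trace :: "op_L2 \<Rightarrow> complex \<Rightarrow> bool"
  where "has_trace T c \<longleftrightarrow>
    (\<forall>u. orthonormal_basis u \<longrightarrow> (\<lambda>n. cinner (T (u n)) (u n)) sums c)"


section \<open>The spaces \<open>C(X, B)\<close>\<close>

text \<open>
  An element of \<open>C(X, B)\<close> is a function on the carrier of the topology \<open>X\<close>; its values
  elsewhere are irrelevant.
\<close>

definition C0 :: "'x topology \<Rightarrow> ('x \<Rightarrow> 'b::complex_normed_vector) set"
  where "C0 X = {F. continuous_map X euclidean F \<and>
    (\<forall>e>0. \<exists>K. compactin X K \<and> (\<forall>x\<in>topspace X - K. norm (F x) < e))}"

text \<open>
  The supremum norm takes values in \<open>ennreal\<close>, so that no supremum below depends on a
  side condition of boundedness or non-emptiness.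
\<close>

definition C0_norm :: "'x topology \<Rightarrow> ('x \<Rightarrow> 'b::complex_normed_vector) \<Rightarrow> ennreal"
  where "C0_norm X F = (SUP x\<in>topspace X. ennreal (norm (F x)))"

text \<open>
  \<open>F x\<close> is a function representing an \<open>L\<^sup>2\<close> class; it has to be square integrable for every
  point \<open>x\<close> of \<open>X\<close>.
\<close>

definition C0_L2 :: "'x topology \<Rightarrow> ('x \<Rightarrow> 'a::euclidean_space \<Rightarrow> complex) set"
  where "C0_L2 X =
    {F. (\<forall>x\<in>topspace X. F x \<in> square_integrable) \<and> (\<lambda>x. to_L2 (F x)) \<in> C0 X}"

definition entire_C0 :: "'x topology \<Rightarrow> (complex \<Rightarrow> 'x \<Rightarrow> 'b::complex_normed_vector) \<Rightarrow> bool"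
  where "entire_C0 X F \<longleftrightarrow>
    (\<forall>z. F z \<in> C0 X) \<and>
    (\<forall>z. \<exists>F'\<in>C0 X.
      ((\<lambda>w. C0_norm X (\<lambda>x. inverse (w - z) *\<^sub>C (F w x - F z x) - F' x)) \<longlongrightarrow> 0) (at z))"

text \<open>
  The series with terms \<open>b z n \<in> C(X, B)\<close> converges normally on compact sets of parameters
  \<open>z\<close>, and \<open>d\<close> is its sum in \<open>C(X, B)\<close>, which is an entire function of \<open>z\<close>.
\<close>

definition entire_series ::
    "'x topology \<Rightarrow> (complex \<Rightarrow> nat \<Rightarrow> 'x \<Rightarrow> 'b::complex_normed_vector) \<Rightarrow> (complex \<Rightarrow> 'x \<Rightarrow> 'b) \<Rightarrow> bool"
  where "entire_series X b d \<longleftrightarrow>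
    (\<forall>z n. b z n \<in> C0 X) \<and>
    (\<forall>K. compact K \<longrightarrow> (\<Sum>n. SUP z\<in>K. C0_norm X (b z n)) < \<infinity>) \<and>
    (\<forall>z. (\<lambda>N. C0_norm X (\<lambda>x. (\<Sum>n<N. b z n x) - d z x)) \<longlonglongrightarrow> 0) \<and>
    entire_C0 X d"

definition entire_series_L2 ::
    "'x topology \<Rightarrow> (complex \<Rightarrow> nat \<Rightarrow> 'x \<Rightarrow> 'a::euclidean_space \<Rightarrow> complex) \<Rightarrow>
      (complex \<Rightarrow> 'x \<Rightarrow> 'a \<Rightarrow> complex) \<Rightarrow> bool"
  where "entire_series_L2 X b d \<longleftrightarrow>
    (\<forall>z n. b z n \<in> C0_L2 X) \<and> (\<forall>z. d z \<in> C0_L2 X) \<and>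
    entire_series X (\<lambda>z n x. to_L2 (b z n x)) (\<lambda>z x. to_L2 (d z x))"


section \<open>Kernels\<close>

type_synonym kernel = "real \<Rightarrow> real \<Rightarrow> complex"

definition induces :: "kernel \<Rightarrow> op_L2 \<Rightarrow> bool"
  where "induces k T \<longleftrightarrow>
    (\<lambda>(s, t). k s t) \<in> borel_measurable lborel \<and> bounded_op T \<and>
    (\<forall>f. AE s in lborel. integrable lborel (\<lambda>t. k s t * fun_of f t) \<and>
      fun_of (T f) s = (LINT t|lborel. k s t * fun_of f t))"

definition K0_kernel :: "kernel \<Rightarrow> bool"
  where "K0_kernel k \<longleftrightarrow>
    (\<lambda>(s, t). k s t) \<in> C0 euclidean \<and>
    (\<lambda>s t. cnj (k s t)) \<in> C0_L2 euclidean \<and>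
    (\<lambda>s t. k t s) \<in> C0_L2 euclidean"

definition M_plus :: "op_L2 \<Rightarrow> op_L2 set"
  where "M_plus T = {P. positive_op P \<and> (\<exists>B. bounded_op B \<and> (P = T \<circ> B \<or> P = B \<circ> T))}"

definition mercer_type :: "kernel \<Rightarrow> bool"
  where "mercer_type k \<longleftrightarrow> K0_kernel k \<and>
    (\<exists>T. induces k T \<and> (\<forall>P\<in>M_plus T. \<exists>k'. K0_kernel k' \<and> induces k' P))"


section \<open>Fredholm series\<close>

text \<open>
  The variables are indexed by \<open>fredholm_vars p\<close>: coordinate \<open>Inl i\<close> stands for \<open>s\<^sub>i\<^sub>+\<^sub>1\<close> and
  \<open>Inr j\<close> for \<open>t\<^sub>j\<^sub>+\<^sub>1\<close>. For a set \<open>I\<close> of such indices, \<open>\<real>\<^sup>I\<close> is the product space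
  \<open>powertop_real I\<close>, a one-point space if \<open>I = {}\<close>.
\<close>

definition fredholm_vars :: "nat \<Rightarrow> (nat + nat) set"
  where "fredholm_vars p = {..<p} <+> {..<p}"

definition kernel_pencil :: "kernel \<Rightarrow> kernel \<Rightarrow> complex \<Rightarrow> kernel"
  where "kernel_pencil h k z = (\<lambda>s t. h s t - z * k s t)"

definition kernel_det :: "kernel \<Rightarrow> nat \<Rightarrow> (nat \<Rightarrow> real) \<Rightarrow> (nat \<Rightarrow> real) \<Rightarrow> complex"
  where "kernel_det k \<nu> x y = Determinant.det (Matrix.mat \<nu> \<nu> (\<lambda>(i, j). k (x i) (y j)))"

lemma kernel_det_0: "kernel_det k 0 x y = 1"
  by (simp add: kernel_det_def)

definition fredholm_integrand ::
    "kernel \<Rightarrow> nat \<Rightarrow> nat \<Rightarrow> (nat + nat \<Rightarrow> real) \<Rightarrow> (nat \<Rightarrow> real) \<Rightarrow> complex"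
  where "fredholm_integrand k p n x \<xi> = kernel_det k (p + n)
    (\<lambda>i. if i < p then x (Inl i) else \<xi> (i - p))
    (\<lambda>j. if j < p then x (Inr j) else \<xi> (j - p))"

definition fredholm_B :: "kernel \<Rightarrow> nat \<Rightarrow> nat \<Rightarrow> (nat + nat \<Rightarrow> real) \<Rightarrow> complex"
  where "fredholm_B k p n x =
    1 / fact n * (LINT \<xi>|(\<Pi>\<^sub>M i\<in>{..<n}. lborel). fredholm_integrand k p n x \<xi>)"

definition fredholm_D :: "kernel \<Rightarrow> nat \<Rightarrow> (nat + nat \<Rightarrow> real) \<Rightarrow> complex"
  where "fredholm_D k p x = (\<Sum>n. fredholm_B k p n x)"

text \<open>
  The coordinate \<open>v\<close>, respectively the pair of distinct coordinates \<open>(v, w)\<close>, is singled out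
  as the argument of an \<open>L\<^sup>2\<close> function; \<open>y\<close> consists of the remaining coordinates.
\<close>

definition view1 :: "'i \<Rightarrow> (('i \<Rightarrow> real) \<Rightarrow> complex) \<Rightarrow> ('i \<Rightarrow> real) \<Rightarrow> real \<Rightarrow> complex"
  where "view1 v F y = (\<lambda>a. F (y(v := a)))"

definition view2 ::
    "'i \<Rightarrow> 'i \<Rightarrow> (('i \<Rightarrow> real) \<Rightarrow> complex) \<Rightarrow> ('i \<Rightarrow> real) \<Rightarrow> real \<times> real \<Rightarrow> complex"
  where "view2 v w F y = (\<lambda>(a, b). F (y(v := a, w := b)))"

end

theory Submission
  imports
    Defs
    "Jordan_Normal_Form.Schur_Decomposition"
    "HOL-Complex_Analysis.Complex_Analysis"
begin

text \<open>
  The operators \<open>A = (H\<^sup>*H + S\<^sup>*S)\<^sup>1\<^sup>/\<^sup>2\<close> and \<open>A' = (HH\<^sup>* + SS\<^sup>*)\<^sup>1\<^sup>/\<^sup>2\<close> dominate \<open>H\<close>, \<open>S\<close> and their adjoints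
  in norm, so the Heinz inequality gives \<open>|\<langle>Hf, g\<rangle>|\<^sup>2 \<le> \<langle>Af, f\<rangle> \<langle>A'g, g\<rangle>\<close>, and likewise for \<open>S\<close>. Letting
  \<open>f\<close> and \<open>g\<close> concentrate at points turns this into \<open>|h(x, y)| \<le> \<alpha>(x) \<beta>(y)\<close> with \<open>\<alpha>(x)\<^sup>2 = a'(x, x)\<close> and
  \<open>\<beta>(y)\<^sup>2 = a(y, y)\<close>. The trace hypotheses make \<open>\<alpha>\<close> and \<open>\<beta>\<close> square integrable, and both vanish at
  infinity. With Hadamard's inequality, \<open>|B\<^sub>n\<^sup>p|\<close> is at most a constant, summable in \<open>n\<close> locally uniformly
  in the parameter, times the product of the weights \<open>\<alpha>(s\<^sub>i) \<beta>(t\<^sub>i)\<close>. Each of the three views is a bounded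
  linear map on functions dominated by this product, and Cauchy's estimates applied pointwise give
  the derivative of the sum in the dominated norm, hence in each view.

  If all \<open>D\<^sub>p\<close> vanished for a fixed parameter, integrating them along the diagonal \<open>s = t\<close> would give
  \<open>\<Sum>\<^sub>m (m choose p) b\<^sub>m = 0\<close> for all \<open>p\<close>, where \<open>b\<^sub>m = B\<^sub>m\<^sup>0\<close>. The alternating sum over \<open>p\<close> is then both
  \<open>0\<close> and \<open>b\<^sub>0 = 1\<close>.
\<close>


text \<open>Hadamard's inequality for a kernel that is merely bounded gives a constant, whose
  integral over the whole line is infinite. This is why the majorant has to be a product: row and
  column factors leave the determinant, so that each integration variable contributes
  \<open>\<alpha>(\<xi>) \<beta>(\<xi>)\<close>, an integrable function. Forming \<open>A\<close>
  and \<open>A'\<close> from \<open>H\<close> and \<open>S\<close> jointly gives both kernels the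
  same two weights, and the pencil inherits the bound with the factor \<open>1 + |z|\<close>, so
  growth in the parameter is confined to powers of one number. The same product serves all three
  spaces: a variable that stays outside contributes boundedness and decay, a variable that is
  singled out contributes a square integrable factor. Analyticity is therefore proved once, for the
  constant in front of the weights. As for the nonvanishing, integration over the diagonal turns
  free variables into integration variables; the binomial coefficients are what remains of the
  normalizing factorials.\<close>

no_notation Matrix.scalar_prod (infix "\<bullet>" 70)

section \<open>The Heinz inequality\<close>

text \<open>Over real scalars positivity does not force symmetry, so symmetry is a clause of its
  own; \<open>positive_op_imp_psd_op\<close> obtains it from the complex structure.\<close>

definition psd_op :: "('a::real_inner \<Rightarrow> 'a) \<Rightarrow> bool"
  where "psd_op Q \<longleftrightarrow> bounded_linear Q \<and> (\<forall>x y. Q x \<bullet> y = x \<bullet> Q y) \<and> (\<forall>x. 0 \<le> Q x \<bullet> x)"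

lemma psd_op_Cauchy_Schwarz:
  assumes "psd_op Q"
  shows "(Q x \<bullet> y)\<^sup>2 \<le> (Q x \<bullet> x) * (Q y \<bullet> y)"
proof -
  interpret Q: bounded_linear Q using assms by (simp add: psd_op_def)
  have sym: "Q u \<bullet> v = u \<bullet> Q v" and pos: "0 \<le> Q u \<bullet> u" for u v
    using assms by (auto simp: psd_op_def)
  have quad: "0 \<le> Q x \<bullet> x + 2 * t * (Q x \<bullet> y) + t\<^sup>2 * (Q y \<bullet> y)" for t
  proof -
    have "Q (x + t *\<^sub>R y) \<bullet> (x + t *\<^sub>R y) = Q x \<bullet> x + 2 * t * (Q x \<bullet> y) + t\<^sup>2 * (Q y \<bullet> y)"
      using sym[of y x]
      by (simp add: Q.add Q.scaleR inner_add_left inner_add_right power2_eq_square inner_commute algebra_simps)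
    then show ?thesis using pos[of "x + t *\<^sub>R y"] by simp
  qed
  show ?thesis
  proof (cases "Q y \<bullet> y = 0")
    case True
    have "Q x \<bullet> y = 0"
    proof (rule ccontr)
      assume n: "Q x \<bullet> y \<noteq> 0"
      \<comment> \<open>For \<open>Q y \<bullet> y = 0\<close> the quadratic is affine in
        \<open>t\<close>; with a nonzero slope this choice of \<open>t\<close> would make it
        -1.\<close>
      then have "Q x \<bullet> x + 2 * (- (Q x \<bullet> x + 1) / (2 * (Q x \<bullet> y))) * (Q x \<bullet> y) = -1"
        by (simp add: field_simps)
      then show False using quad[of "- (Q x \<bullet> x + 1) / (2 * (Q x \<bullet> y))"] True by simp
    qed
    then show ?thesis using True by simp
  next
    case False
    then have c: "0 < Q y \<bullet> y" using pos[of y] by simp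
    have "0 \<le> Q x \<bullet> x - (Q x \<bullet> y)\<^sup>2 / (Q y \<bullet> y)"
      using quad[of "- (Q x \<bullet> y) / (Q y \<bullet> y)"] c by (simp add: power2_eq_square field_simps)
    then show ?thesis using c by (simp add: field_simps)
  qed
qed

text \<open>
  Since \<open>L\<close> is symmetric for the form \<open>\<langle>Q\<cdot>, \<cdot>\<rangle>\<close>, the numbers \<open>r n = \<langle>Q L\<^sup>n x, x\<rangle>\<close> satisfy
  \<open>(r n)\<^sup>2 \<le> r 0 * r (2 n)\<close>; iterating along powers of two reduces the claim to \<open>r n = O(M\<^sup>n)\<close>.
\<close>

lemma Reid_inequality:
  assumes Q: "psd_op Q" and M: "0 < M" and L: "\<And>x. norm (L x) \<le> M * norm x"
    and sym: "\<And>x y. Q (L x) \<bullet> y = Q x \<bullet> L y"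
  shows "Q (L x) \<bullet> x \<le> M * (Q x \<bullet> x)"
proof (rule ccontr)
  assume contra: "\<not> ?thesis"
  interpret Q: bounded_linear Q using Q by (simp add: psd_op_def)
  define v where "v = Q x \<bullet> x"
  have v0: "0 \<le> v" using Q unfolding psd_op_def v_def by blast
  have CS: "(Q (L x) \<bullet> x)\<^sup>2 \<le> Q (L x) \<bullet> L x * v"
    using psd_op_Cauchy_Schwarz[OF Q, of "L x" x] by (simp add: v_def)
  \<comment> \<open>\<open>v = 0\<close> would force \<open>Q (L x) \<bullet> x = 0\<close> by
    \<open>CS\<close>, and then the claim holds; so \<open>v\<close> may serve as a
    denominator.\<close>
  have v: "0 < v"
  proof (rule ccontr)
    assume "\<not> 0 < v"
    then have "v = 0" using v0 by simp
    then show False using CS contra by (simp add: v_def)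
  qed
  have r1: "0 \<le> Q (L x) \<bullet> x / v"
    using contra v M by (intro divide_nonneg_nonneg) (auto simp: v_def intro: order_trans[of _ "M * v"])
  define r where "r n = (Q ((L ^^ n) x) \<bullet> x)" for n
  have symn: "Q ((L ^^ n) u) \<bullet> w = Q u \<bullet> (L ^^ n) w" for n u w
    by (induction n arbitrary: u w) (simp_all add: sym funpow_swap1)
  have r2: "(r n)\<^sup>2 \<le> v * r (2 * n)" for n
  proof -
    have "Q ((L ^^ n) x) \<bullet> (L ^^ n) x = r (2 * n)"
      unfolding r_def symn[symmetric] by (simp add: mult_2 funpow_add)
    then show ?thesis
      using psd_op_Cauchy_Schwarz[OF Q, of "(L ^^ n) x" x] by (simp add: r_def v_def mult.commute)
  qed
  have "(r 1 / v) ^ (2 ^ j) \<le> r (2 ^ j) / v" for j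
  proof (induction j)
    case (Suc j)
    have "(r 1 / v) ^ (2 ^ Suc j) = ((r 1 / v) ^ (2 ^ j))\<^sup>2"
      by (simp add: power_mult[symmetric] mult.commute)
    also have "\<dots> \<le> (r (2 ^ j) / v)\<^sup>2"
      using Suc r1 by (intro power_mono zero_le_power) (auto simp: r_def)
    also have "\<dots> \<le> r (2 ^ Suc j) / v"
      using r2[of "2 ^ j"] v by (simp add: power2_eq_square field_simps)
    finally show ?case .
  qed simp
  moreover have "r n \<le> (onorm Q * (norm x)\<^sup>2) * M ^ n" for n
  proof -
    have "norm ((L ^^ n) x) \<le> M ^ n * norm x"
    proof (induction n)
      case (Suc n)
      have "norm ((L ^^ Suc n) x) \<le> M * norm ((L ^^ n) x)" using L by simp
      also have "\<dots> \<le> M * (M ^ n * norm x)" using Suc M by simp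
      finally show ?case by (simp add: mult.assoc)
    qed simp
    moreover have "r n \<le> onorm Q * norm ((L ^^ n) x) * norm x"
      unfolding r_def
      by (rule order_trans[OF norm_cauchy_schwarz]) (intro mult_right_mono onorm Q.bounded_linear_axioms, simp)
    moreover have "onorm Q * norm ((L ^^ n) x) * norm x \<le> onorm Q * (M ^ n * norm x) * norm x"
      using calculation(1) by (intro mult_right_mono mult_left_mono onorm_pos_le Q.bounded_linear_axioms) auto
    ultimately show ?thesis by (simp add: power2_eq_square algebra_simps)
  qed
  ultimately have bound: "(r 1 / v) ^ (2 ^ j) \<le> (onorm Q * (norm x)\<^sup>2) * M ^ (2 ^ j) / v" for j
    using v by (meson divide_right_mono less_imp_le order_trans)
  \<comment> \<open>The negated claim says exactly \<open>1 < s\<close>, while the bounds from below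
    and above on \<open>r\<close> at powers of two keep \<open>s ^ (2 ^ j)\<close> bounded in
    \<open>j\<close>.\<close>
  define s where "s = r 1 / v / M"
  have s: "1 < s" using contra v M by (simp add: s_def r_def v_def field_simps)
  have sb: "s ^ (2 ^ j) \<le> onorm Q * (norm x)\<^sup>2 / v" for j
    using bound[of j] v M by (simp add: s_def power_divide field_simps)
  obtain j where "onorm Q * (norm x)\<^sup>2 / v < s ^ j" using real_arch_pow[OF s] by blast
  also have "s ^ j \<le> s ^ (2 ^ j)" using s by (intro power_increasing) (auto simp: less_imp_le)
  finally show False using sb[of j] by simp
qed

text \<open>
  Partial sums of the Neumann series of \<open>(A + e)\<inverse>\<close> avoid the inverse itself, for which the space
  would have to be complete.
\<close>

lemma psd_op_approx_inverse:
  assumes A: "psd_op A" and e: "0 < e"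
  obtains Q q where "\<And>n. psd_op (Q n)" "0 \<le> q" "q < 1"
    "\<And>n x. Q n (A x + e *\<^sub>R x) = A (Q n x) + e *\<^sub>R Q n x"
    "\<And>n x. norm (A (Q n x) + e *\<^sub>R Q n x - x) \<le> q ^ n * norm x"
proof -
  interpret A: bounded_linear A using A by (simp add: psd_op_def)
  have sym: "A u \<bullet> v = u \<bullet> A v" and pos: "0 \<le> A u \<bullet> u" for u v
    using A by (auto simp: psd_op_def)
  define N where "N = onorm A"
  have N0: "0 \<le> N" by (simp add: N_def onorm_pos_le A.bounded_linear_axioms)
  have N: "A u \<bullet> u \<le> N * (norm u)\<^sup>2" for u
  proof -
    have "A u \<bullet> u \<le> norm (A u) * norm u" by (rule norm_cauchy_schwarz)
    also have "\<dots> \<le> (N * norm u) * norm u"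
      unfolding N_def by (intro mult_right_mono onorm A.bounded_linear_axioms) simp
    finally show ?thesis by (simp add: power2_eq_square)
  qed
  \<comment> \<open>The step size of Richardson iteration for \<open>A + e\<close>: as
    \<open>A\<close> lies between 0 and \<open>N\<close>, the operator
    \<open>C = 1 - t (A + e)\<close> lies between 0 and \<open>q = 1 - t e\<close>, so its powers
    decay geometrically.\<close>
  define t where "t = 1 / (N + e)"
  define q where "q = N / (N + e)"
  have t: "0 < t" "t * (N + e) = 1" "1 - t * e = q" using N0 e by (auto simp: t_def q_def field_simps)
  have q: "0 \<le> q" "q < 1" using N0 e by (auto simp: q_def)
  define C where "C x = x - t *\<^sub>R (A x + e *\<^sub>R x)" for x
  have blC: "bounded_linear C"
    unfolding C_def
    by (intro bounded_linear_sub bounded_linear_ident bounded_linear_const_scaleR bounded_linear_add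
        A.bounded_linear_axioms)
  then interpret C: bounded_linear C .
  have symC: "C u \<bullet> v = u \<bullet> C v" for u v
    by (simp add: C_def inner_diff_left inner_diff_right inner_add_left inner_add_right sym)
  have Cxx: "C u \<bullet> u = (norm u)\<^sup>2 - t * (A u \<bullet> u) - t * e * (norm u)\<^sup>2" for u
    by (simp add: C_def inner_diff_left inner_add_left power2_norm_eq_inner algebra_simps)
  have upC: "C u \<bullet> u \<le> q * (norm u)\<^sup>2" for u
  proof -
    have "C u \<bullet> u \<le> (1 - t * e) * (norm u)\<^sup>2"
      unfolding Cxx using t(1) pos[of u] by (simp add: algebra_simps)
    then show ?thesis using t by simp
  qed
  have posC: "0 \<le> C u \<bullet> u" for u
  proof -
    have "t * (A u \<bullet> u) \<le> t * (N * (norm u)\<^sup>2)" using N[of u] t(1) by simp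
    moreover have "(norm u)\<^sup>2 = t * (N + e) * (norm u)\<^sup>2" using t(2) by simp
    ultimately show ?thesis unfolding Cxx by (simp add: algebra_simps)
  qed
  have psdC: "psd_op C" using blC symC posC by (simp add: psd_op_def)
  have nC: "norm (C u) \<le> q * norm u" for u
  proof (cases "C u = 0")
    case False
    \<comment> \<open>Cauchy-Schwarz for the form of \<open>C\<close> at \<open>u\<close> and
      \<open>C u\<close> turns the bound on the quadratic form into a bound on the norm.\<close>
    have "(C u \<bullet> C u)\<^sup>2 \<le> (q * (norm u)\<^sup>2) * (q * (norm (C u))\<^sup>2)"
      by (rule order_trans[OF psd_op_Cauchy_Schwarz[OF psdC, of u "C u"]])
        (intro mult_mono upC posC mult_nonneg_nonneg q zero_le_power2)
    then have "(norm (C u))\<^sup>2 * (norm (C u))\<^sup>2 \<le> (q * norm u)\<^sup>2 * (norm (C u))\<^sup>2"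
      by (simp add: power2_norm_eq_inner[symmetric] power_mult_distrib) (simp add: power2_eq_square mult_ac)
    then have "(norm (C u))\<^sup>2 \<le> (q * norm u)\<^sup>2"
      by (rule mult_right_le_imp_le) (use False in simp)
    then show ?thesis by (rule power2_le_imp_le) (use q in simp)
  qed (use q in auto)
  have blCn: "bounded_linear (C ^^ n)" for n
  proof (induction n)
    case 0
    show ?case using bounded_linear_ident by (simp add: id_def)
  next
    case (Suc n)
    show ?case using bounded_linear_compose[OF blC Suc] by (simp add: comp_def)
  qed
  have linCn: "(C ^^ n) (x - y) = (C ^^ n) x - (C ^^ n) y" "(C ^^ n) (r *\<^sub>R x) = r *\<^sub>R (C ^^ n) x" for n x y r
    using blCn[of n] by (simp_all add: linear_simps)
  have symCn: "(C ^^ n) u \<bullet> v = u \<bullet> (C ^^ n) v" for n u v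
    by (induction n arbitrary: u v) (simp_all add: symC funpow_swap1)
  \<comment> \<open>Even powers are squares of symmetric operators; an odd power is \<open>C\<close>
    between two copies of a symmetric operator.\<close>
  have posCn: "0 \<le> (C ^^ n) u \<bullet> u" for n u
  proof (cases "even n")
    case True
    then obtain m where "n = m + m" by (auto elim!: evenE simp: mult_2)
    then have "(C ^^ n) u \<bullet> u = (C ^^ m) u \<bullet> (C ^^ m) u" by (simp add: funpow_add symCn)
    then show ?thesis by simp
  next
    case False
    then obtain m where "n = m + Suc m" by (auto elim!: oddE simp: mult_2)
    then have "(C ^^ n) u = (C ^^ m) (C ((C ^^ m) u))" by (simp only: funpow_add) simp
    then have "(C ^^ n) u \<bullet> u = C ((C ^^ m) u) \<bullet> (C ^^ m) u" by (simp add: symCn)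
    then show ?thesis using posC by simp
  qed
  have nCn: "norm ((C ^^ n) u) \<le> q ^ n * norm u" for n u
  proof (induction n)
    case (Suc n)
    have "norm ((C ^^ Suc n) u) \<le> q * norm ((C ^^ n) u)" using nC by simp
    also have "\<dots> \<le> q * (q ^ n * norm u)" using Suc q by (intro mult_left_mono)
    finally show ?case by (simp add: mult.assoc)
  qed simp
  define Q where "Q n x = t *\<^sub>R (\<Sum>k<n. (C ^^ k) x)" for n x
  have psdQ: "psd_op (Q n)" for n
    unfolding psd_op_def
  proof (intro conjI allI)
    show "bounded_linear (Q n)"
      unfolding Q_def[abs_def] by (intro bounded_linear_const_scaleR bounded_linear_sum blCn)
    show "Q n x \<bullet> y = x \<bullet> Q n y" for x y
      by (simp add: Q_def inner_sum_left inner_sum_right symCn)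
    show "0 \<le> Q n x \<bullet> x" for x
      using t(1) by (simp add: Q_def inner_sum_left posCn sum_nonneg)
  qed
  have tA: "t *\<^sub>R (A x + e *\<^sub>R x) = x - C x" for x by (simp add: C_def)
  have telescope: "(\<Sum>k<n. (C ^^ k) x - (C ^^ Suc k) x) = x - (C ^^ n) x" for n x
    by (induction n) (simp_all add: algebra_simps)
  have QA: "Q n (A x + e *\<^sub>R x) = x - (C ^^ n) x" for n x
  proof -
    have "Q n (A x + e *\<^sub>R x) = (\<Sum>k<n. (C ^^ k) (t *\<^sub>R (A x + e *\<^sub>R x)))"
      by (simp only: Q_def scaleR_sum_right linCn)
    also have "\<dots> = (\<Sum>k<n. (C ^^ k) x - (C ^^ Suc k) x)"
      by (simp only: tA linCn funpow_Suc_right comp_def)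
    finally show ?thesis using telescope by simp
  qed
  have AQ: "A (Q n x) + e *\<^sub>R Q n x = x - (C ^^ n) x" for n x
  proof -
    have "A (Q n x) + e *\<^sub>R Q n x = (\<Sum>k<n. t *\<^sub>R (A ((C ^^ k) x) + e *\<^sub>R (C ^^ k) x))"
      by (simp add: Q_def A.scaleR A.sum scaleR_sum_right sum.distrib scaleR_add_right mult.commute)
    also have "\<dots> = (\<Sum>k<n. (C ^^ k) x - (C ^^ Suc k) x)" by (simp add: tA)
    finally show ?thesis using telescope by simp
  qed
  show thesis
  proof (rule that[of Q q])
    show "norm (A (Q n x) + e *\<^sub>R Q n x - x) \<le> q ^ n * norm x" for n x
      unfolding AQ using nCn by simp
  qed (use psdQ q QA AQ in auto)
qed

text \<open>
  For approximate inverses \<open>Q\<close> of \<open>A + e\<close> and \<open>P\<close> of \<open>B + e\<close> the operator \<open>L = T' P T Q\<close> is almost a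
  contraction, so the Reid inequality yields \<open>Q T' P T Q \<le> Q\<close> up to a factor tending to \<open>1\<close>.
\<close>

lemma Heinz_inequality_shifted:
  fixes A :: "'a::real_inner \<Rightarrow> 'a" and B :: "'b::real_inner \<Rightarrow> 'b"
  assumes A: "psd_op A" and B: "psd_op B" and T: "bounded_linear T"
    and adj: "\<And>x y. T x \<bullet> y = x \<bullet> T' y"
    and TA: "\<And>x. norm (T x) \<le> norm (A x)" and TB: "\<And>y. norm (T' y) \<le> norm (B y)"
    and e: "0 < e"
  shows "(T x \<bullet> y)\<^sup>2 \<le> (A x \<bullet> x + e * (norm x)\<^sup>2) * (B y \<bullet> y + e * (norm y)\<^sup>2)"
proof -
  \<comment> \<open>The cross term \<open>2 * e * (D u \<bullet> u)\<close> is nonnegative, so the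
    domination of \<open>T\<close> and \<open>T'\<close> passes to the shifted operators.\<close>
  have shift: "norm (D u) \<le> norm (D u + e *\<^sub>R u)" if "psd_op D" for D :: "'c::real_inner \<Rightarrow> 'c" and u
  proof (rule power2_le_imp_le)
    have "0 \<le> 2 * e * (D u \<bullet> u)" using e that unfolding psd_op_def by (intro mult_nonneg_nonneg) auto
    moreover have "0 \<le> e * (e * (u \<bullet> u))" using e by simp
    ultimately show "(norm (D u))\<^sup>2 \<le> (norm (D u + e *\<^sub>R u))\<^sup>2"
      by (simp add: power2_norm_eq_inner inner_add_left inner_add_right inner_commute algebra_simps)
  qed simp
  obtain Q q where Q: "\<And>n. psd_op (Q n)" and q: "0 \<le> q" "q < 1"
    and QA: "\<And>n x. Q n (A x + e *\<^sub>R x) = A (Q n x) + e *\<^sub>R Q n x"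
    and Qn: "\<And>n x. norm (A (Q n x) + e *\<^sub>R Q n x - x) \<le> q ^ n * norm x"
    using psd_op_approx_inverse[OF A e] by metis
  obtain P p where P: "\<And>n. psd_op (P n)" and p: "0 \<le> p" "p < 1"
    and PB: "\<And>n x. P n (B x + e *\<^sub>R x) = B (P n x) + e *\<^sub>R P n x"
    and Pn: "\<And>n x. norm (B (P n x) + e *\<^sub>R P n x - x) \<le> p ^ n * norm x"
    using psd_op_approx_inverse[OF B e] by metis
  have symQ: "Q n u \<bullet> v = u \<bullet> Q n v" and symP: "P n w \<bullet> z = w \<bullet> P n z" for n u v w z
    using Q[of n] P[of n] by (auto simp: psd_op_def)
  define M where "M n = (1 + p ^ n) * (1 + q ^ n)" for n
  \<comment> \<open>For \<open>u = A x + e x\<close> the form \<open>Q n u \<bullet> u\<close> of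
    the Reid inequality becomes \<open>xs n \<bullet> (A x + e x)\<close>. Since \<open>xs n\<close>
    tends to \<open>x\<close>, its limit is the shifted form at \<open>x\<close>.\<close>
  define xs where "xs n = Q n (A x + e *\<^sub>R x)" for n
  define ys where "ys n = P n (B y + e *\<^sub>R y)" for n
  have TQ: "norm (T (Q n u)) \<le> (1 + q ^ n) * norm u" for n u
  proof -
    have "norm (T (Q n u)) \<le> norm (A (Q n u) + e *\<^sub>R Q n u)"
      using TA shift[OF A] order_trans by blast
    also have "\<dots> \<le> norm u + norm (A (Q n u) + e *\<^sub>R Q n u - u)" by (rule norm_triangle_sub)
    also have "\<dots> \<le> norm u + q ^ n * norm u" using Qn by simp
    finally show ?thesis by (simp add: algebra_simps)
  qed
  have TP: "norm (T' (P n u)) \<le> (1 + p ^ n) * norm u" for n u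
  proof -
    have "norm (T' (P n u)) \<le> norm (B (P n u) + e *\<^sub>R P n u)"
      using TB shift[OF B] order_trans by blast
    also have "\<dots> \<le> norm u + norm (B (P n u) + e *\<^sub>R P n u - u)" by (rule norm_triangle_sub)
    also have "\<dots> \<le> norm u + p ^ n * norm u" using Pn by simp
    finally show ?thesis by (simp add: algebra_simps)
  qed
  have Mpos: "0 < M n" for n using p q by (simp add: M_def add_pos_nonneg)
  have step: "(T (xs n) \<bullet> ys n)\<^sup>2 \<le> M n * (xs n \<bullet> (A x + e *\<^sub>R x)) * (ys n \<bullet> (B y + e *\<^sub>R y))" for n
  proof -
    define L where "L u = T' (P n (T (Q n u)))" for u
    have "norm (L u) \<le> M n * norm u" for u
    proof -
      have "norm (L u) \<le> (1 + p ^ n) * norm (T (Q n u))" unfolding L_def by (rule TP)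
      also have "\<dots> \<le> (1 + p ^ n) * ((1 + q ^ n) * norm u)"
        using TQ p by (intro mult_left_mono) auto
      finally show ?thesis by (simp add: M_def mult.assoc)
    qed
    moreover have "Q n (L u) \<bullet> v = Q n u \<bullet> L v" for u v
    proof -
      have "Q n (L u) \<bullet> v = T (Q n v) \<bullet> P n (T (Q n u))"
        by (simp add: L_def symQ adj inner_commute)
      also have "\<dots> = T (Q n u) \<bullet> P n (T (Q n v))" by (metis symP inner_commute)
      finally show ?thesis by (simp add: L_def adj)
    qed
    ultimately have "Q n (L u) \<bullet> u \<le> M n * (Q n u \<bullet> u)" for u
      by (rule Reid_inequality[OF Q Mpos])
    moreover have "Q n (L u) \<bullet> u = P n (T (Q n u)) \<bullet> T (Q n u)" for u
      by (metis L_def symQ adj inner_commute)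
    ultimately have R: "P n (T (xs n)) \<bullet> T (xs n) \<le> M n * (xs n \<bullet> (A x + e *\<^sub>R x))"
      unfolding xs_def by metis
    \<comment> \<open>Moving \<open>P n\<close> to the left factor lets Cauchy-Schwarz for the form
      of \<open>P n\<close> separate \<open>x\<close> from \<open>y\<close>; the first factor is the
      one bounded by \<open>R\<close>.\<close>
    have "(T (xs n) \<bullet> ys n)\<^sup>2 = (P n (T (xs n)) \<bullet> (B y + e *\<^sub>R y))\<^sup>2"
      by (simp add: ys_def symP)
    also have "\<dots> \<le> (P n (T (xs n)) \<bullet> T (xs n)) * (P n (B y + e *\<^sub>R y) \<bullet> (B y + e *\<^sub>R y))"
      by (rule psd_op_Cauchy_Schwarz[OF P])
    also have "\<dots> \<le> M n * (xs n \<bullet> (A x + e *\<^sub>R x)) * (ys n \<bullet> (B y + e *\<^sub>R y))"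
      unfolding ys_def[symmetric] using P[of n]
      by (intro mult_right_mono R) (unfold ys_def psd_op_def, blast)
    finally show ?thesis .
  qed
  have lim: "(\<lambda>n. q ^ n) \<longlonglongrightarrow> 0" "(\<lambda>n. p ^ n) \<longlonglongrightarrow> 0"
    using p q by (auto intro: LIMSEQ_realpow_zero)
  have xs: "xs \<longlonglongrightarrow> x"
    unfolding xs_def QA
    by (rule Lim_transform2[OF tendsto_const], rule Lim_null_comparison[of _ "\<lambda>n. q ^ n * norm x"])
      (use Qn lim in \<open>auto simp: norm_minus_commute intro!: tendsto_mult_left_zero\<close>)
  have ys: "ys \<longlonglongrightarrow> y"
    unfolding ys_def PB
    by (rule Lim_transform2[OF tendsto_const], rule Lim_null_comparison[of _ "\<lambda>n. p ^ n * norm y"])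
      (use Pn lim in \<open>auto simp: norm_minus_commute intro!: tendsto_mult_left_zero\<close>)
  have Ml: "M \<longlonglongrightarrow> (1 + 0) * (1 + 0)"
    unfolding M_def[abs_def] by (intro tendsto_intros lim)
  have "(\<lambda>n. (T (xs n) \<bullet> ys n)\<^sup>2) \<longlonglongrightarrow> (T x \<bullet> y)\<^sup>2"
    by (intro tendsto_intros bounded_linear.tendsto[OF T] xs ys)
  moreover have "(\<lambda>n. M n * (xs n \<bullet> (A x + e *\<^sub>R x)) * (ys n \<bullet> (B y + e *\<^sub>R y)))
      \<longlonglongrightarrow> ((1 + 0) * (1 + 0)) * (x \<bullet> (A x + e *\<^sub>R x)) * (y \<bullet> (B y + e *\<^sub>R y))"
    by (intro tendsto_intros Ml xs ys)
  ultimately have "(T x \<bullet> y)\<^sup>2 \<le> ((1 + 0) * (1 + 0)) * (x \<bullet> (A x + e *\<^sub>R x)) * (y \<bullet> (B y + e *\<^sub>R y))"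
    by (rule LIMSEQ_le) (use step in blast)
  then show ?thesis by (simp add: inner_add_right power2_norm_eq_inner inner_commute)
qed

text \<open>The Heinz-Kato inequality with both exponents 1/2, stated through the quadratic forms of
  \<open>A\<close> and \<open>B\<close> in place of their square roots. The shift
  \<open>e = 1 / (n + 1)\<close> is sent to 0.\<close>

theorem Heinz_inequality:
  fixes A :: "'a::real_inner \<Rightarrow> 'a" and B :: "'b::real_inner \<Rightarrow> 'b"
  assumes "psd_op A" and "psd_op B" and "bounded_linear T"
    and "\<And>x y. T x \<bullet> y = x \<bullet> T' y"
    and "\<And>x. norm (T x) \<le> norm (A x)" and "\<And>y. norm (T' y) \<le> norm (B y)"
  shows "(T x \<bullet> y)\<^sup>2 \<le> (A x \<bullet> x) * (B y \<bullet> y)"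
proof -
  have "(\<lambda>n. (A x \<bullet> x + inverse (real (Suc n)) * (norm x)\<^sup>2) * (B y \<bullet> y + inverse (real (Suc n)) * (norm y)\<^sup>2))
      \<longlonglongrightarrow> (A x \<bullet> x + 0 * (norm x)\<^sup>2) * (B y \<bullet> y + 0 * (norm y)\<^sup>2)"
    by (intro tendsto_intros LIMSEQ_inverse_real_of_nat)
  moreover have "(T x \<bullet> y)\<^sup>2 \<le> (A x \<bullet> x + inverse (real (Suc n)) * (norm x)\<^sup>2)
      * (B y \<bullet> y + inverse (real (Suc n)) * (norm y)\<^sup>2)" for n
    using Heinz_inequality_shifted[OF assms, of "inverse (real (Suc n))"] by simp
  ultimately have "(T x \<bullet> y)\<^sup>2 \<le> (A x \<bullet> x + 0 * (norm x)\<^sup>2) * (B y \<bullet> y + 0 * (norm y)\<^sup>2)"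
    by (intro LIMSEQ_le_const) auto
  then show ?thesis by simp
qed


section \<open>Hadamard's inequality\<close>

lemma sum_diag_mat_mult_commute:
  fixes X Y :: "'a::comm_semiring_0 mat"
  assumes "X \<in> carrier_mat n n" "Y \<in> carrier_mat n n"
  shows "(\<Sum>i<n. (X * Y) $$ (i, i)) = (\<Sum>i<n. (Y * X) $$ (i, i))"
proof -
  have "(\<Sum>i<n. (X * Y) $$ (i, i)) = (\<Sum>i<n. \<Sum>j<n. X $$ (i, j) * Y $$ (j, i))"
    using assms by (auto simp: scalar_prod_def lessThan_atLeast0 intro!: sum.cong)
  also have "\<dots> = (\<Sum>j<n. \<Sum>i<n. Y $$ (j, i) * X $$ (i, j))"
    by (subst sum.swap) (simp add: mult.commute)
  also have "\<dots> = (\<Sum>i<n. (Y * X) $$ (i, i))"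
    using assms by (auto simp: scalar_prod_def lessThan_atLeast0 intro!: sum.cong)
  finally show ?thesis .
qed

lemma det_mat_permutes:
  "Determinant.det (Matrix.mat n n (\<lambda>(i, j). f i j)) =
    (\<Sum>p | p permutes {0..<n}. signof p * (\<Prod>i = 0..<n. f i (p i)))"
proof (subst Determinant.det_def'[of _ n], simp, rule sum.cong[OF refl])
  fix p assume "p \<in> {p. p permutes {0..<n}}"
  then have "p i < n" if "i < n" for i
    using that permutes_in_image[of p "{0..<n}" i] by simp
  then show "signof p * (\<Prod>i = 0..<n. Matrix.mat n n (\<lambda>(i, j). f i j) $$ (i, p i)) = signof p * (\<Prod>i = 0..<n. f i (p i))"
    by (auto intro!: arg_cong[where f = "\<lambda>x. signof p * x"] prod.cong)
qed

text \<open>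
  The eigenvalues \<open>r\<close> of \<open>M M\<^sup>*\<close> are nonnegative with sum at most \<open>n\<^sup>2\<close>, and \<open>r \<le> n exp (r / n - 1)\<close>
  bounds their product.
\<close>

lemma Hadamard_inequality:
  fixes M :: "complex mat"
  assumes M: "M \<in> carrier_mat n n" and le1: "\<And>i j. i < n \<Longrightarrow> j < n \<Longrightarrow> cmod (M $$ (i, j)) \<le> 1"
  shows "(cmod (Determinant.det M))\<^sup>2 \<le> real n ^ n"
proof -
  define M' where "M' = Matrix.mat n n (\<lambda>(i, j). cnj (M $$ (j, i)))"
  define G where "G = M * M'"
  have M': "M' \<in> carrier_mat n n" and G: "G \<in> carrier_mat n n" using M by (auto simp: M'_def G_def)
  have detM': "Determinant.det M' = cnj (Determinant.det M)"
  proof -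
    have "M' = transpose_mat (Matrix.mat n n (\<lambda>(i, j). cnj (M $$ (i, j))))"
      by (rule eq_matI) (auto simp: M'_def)
    then have "Determinant.det M' = Determinant.det (Matrix.mat n n (\<lambda>(i, j). cnj (M $$ (i, j))))"
      by (simp add: Determinant.det_transpose[of _ n])
    also have "\<dots> = cnj (Determinant.det M)"
      by (simp add: det_mat_permutes Determinant.det_def'[OF M] sign_def)
    finally show ?thesis .
  qed
  have Gij: "G $$ (i, j) = (\<Sum>l<n. M $$ (i, l) * cnj (M $$ (j, l)))" if "i < n" "j < n" for i j
    using that M M' by (auto simp: G_def M'_def scalar_prod_def lessThan_atLeast0)
  \<comment> \<open>Schur triangularization reads both invariants off one list: the determinant of
    \<open>G\<close> is the product of \<open>es\<close>, the trace its sum.\<close>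
  obtain es where cp: "char_poly G = (\<Prod>a\<leftarrow>es. [:- a, 1:])" and len: "length es = n"
    using char_poly_factorized[OF G] by blast
  obtain B P Q where schur: "schur_decomposition G es = (B, P, Q)"
    by (cases "schur_decomposition G es") auto
  have sim: "similar_mat_wit G B P Q" and ut: "upper_triangular B" and diag: "diag_mat B = es"
    using schur_decomposition[OF G cp schur] by auto
  have carr: "B \<in> carrier_mat n n" "P \<in> carrier_mat n n" "Q \<in> carrier_mat n n"
    and QP: "Q * P = 1\<^sub>m n" and GPBQ: "G = P * B * Q"
    using similar_mat_witD2[OF G sim] by auto
  have detG: "Determinant.det G = prod_list es"
    using det_similar[of G B] sim ut carr diag det_upper_triangular[of B n]
    by (auto simp: similar_mat_def)
  have "(\<Sum>i<n. G $$ (i, i)) = (\<Sum>i<n. (Q * (P * B)) $$ (i, i))"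
    unfolding GPBQ using carr by (intro sum_diag_mat_mult_commute) auto
  also have "Q * (P * B) = B"
    using carr QP by (simp flip: assoc_mult_mat)
  also have "(\<Sum>i<n. B $$ (i, i)) = sum_list es"
    using carr unfolding diag[symmetric] diag_mat_def
    by (simp add: interv_sum_list_conv_sum_set_nat lessThan_atLeast0)
  finally have trG: "(\<Sum>i<n. G $$ (i, i)) = sum_list es" .
  have ev: "\<exists>r\<ge>0. e = complex_of_real r" if "e \<in> set es" for e
  proof -
    have "poly (char_poly G) e = 0"
      unfolding cp using that by (induction es) auto
    then have "eigenvalue G e" using eigenvalue_root_char_poly[OF G] by simp
    then obtain v where v: "v \<in> carrier_vec n" "v \<noteq> 0\<^sub>v n" and Gv: "G *\<^sub>v v = e \<cdot>\<^sub>v v"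
      using G by (auto simp: eigenvalue_def eigenvector_def)
    have Gvi: "e * v $ i = (\<Sum>j<n. G $$ (i, j) * v $ j)" if "i < n" for i
    proof -
      have "(G *\<^sub>v v) $ i = (\<Sum>j<n. G $$ (i, j) * v $ j)"
        using that G v by (auto simp: scalar_prod_def lessThan_atLeast0)
      then show ?thesis using that v unfolding Gv by simp
    qed
    define N where "N = (\<Sum>i<n. (cmod (v $ i))\<^sup>2)"
    have "N \<noteq> 0"
    proof
      assume "N = 0"
      then have "\<forall>i<n. v $ i = 0" by (simp add: N_def sum_nonneg_eq_0_iff)
      then show False using v by (auto intro: eq_vecI)
    qed
    then have N: "0 < N" by (simp add: N_def sum_nonneg less_le)
    \<comment> \<open>\<open>R\<close> is the squared length of \<open>M'\<close> applied to
      \<open>v\<close>, so the eigenvalue is the Rayleigh quotient \<open>R / N\<close>.\<close>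
    define R where "R = (\<Sum>l<n. (cmod (\<Sum>j<n. cnj (M $$ (j, l)) * v $ j))\<^sup>2)"
    have "e * complex_of_real N = (\<Sum>i<n. e * v $ i * cnj (v $ i))"
      by (simp add: N_def sum_distrib_left mult.assoc flip: complex_norm_square)
    also have "\<dots> = (\<Sum>i<n. \<Sum>j<n. \<Sum>l<n. M $$ (i, l) * cnj (M $$ (j, l)) * v $ j * cnj (v $ i))"
      by (auto simp: Gvi Gij sum_distrib_right intro!: sum.cong)
    also have "\<dots> = (\<Sum>l<n. \<Sum>j<n. \<Sum>i<n. M $$ (i, l) * cnj (M $$ (j, l)) * v $ j * cnj (v $ i))"
      by (subst sum.swap, rule trans[OF sum.cong[OF refl sum.swap]], rule sum.swap)
    also have "\<dots> = (\<Sum>l<n. (\<Sum>j<n. cnj (M $$ (j, l)) * v $ j) * cnj (\<Sum>i<n. cnj (M $$ (i, l)) * v $ i))"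
      by (auto simp: sum_product mult_ac intro!: sum.cong)
    also have "\<dots> = complex_of_real R" by (simp only: R_def of_real_sum complex_norm_square)
    finally have "e = complex_of_real (R / N)" using N by (simp add: field_simps)
    moreover have "0 \<le> R / N" using N by (simp add: R_def sum_nonneg)
    ultimately show ?thesis by blast
  qed
  define rs where "rs = map Re es"
  have es: "es = map complex_of_real rs"
  proof -
    have "map (complex_of_real \<circ> Re) es = es"
      by (rule map_idI) (use ev in fastforce)
    then show ?thesis by (simp add: rs_def)
  qed
  have rs0: "r \<ge> 0" if "r \<in> set rs" for r using that ev unfolding rs_def by fastforce
  have sum_rs: "sum_list rs \<le> real n * real n"
  proof -
    have "complex_of_real (sum_list l) = sum_list (map complex_of_real l)" for l by (induction l) auto
    then have "complex_of_real (sum_list rs) = (\<Sum>i<n. G $$ (i, i))" by (simp add: es trG)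
    moreover have "(\<Sum>i<n. G $$ (i, i)) = complex_of_real (\<Sum>i<n. \<Sum>l<n. (cmod (M $$ (i, l)))\<^sup>2)"
      unfolding of_real_sum complex_norm_square by (simp add: Gij)
    ultimately have "complex_of_real (sum_list rs) = complex_of_real (\<Sum>i<n. \<Sum>l<n. (cmod (M $$ (i, l)))\<^sup>2)"
      by (rule trans)
    then have "sum_list rs = (\<Sum>i<n. \<Sum>l<n. (cmod (M $$ (i, l)))\<^sup>2)"
      unfolding of_real_eq_iff .
    also have "\<dots> \<le> (\<Sum>i<n. \<Sum>l<n. 1)"
      by (intro sum_mono) (use le1 in \<open>auto simp: power_le_one\<close>)
    finally show ?thesis by simp
  qed
  show ?thesis
  proof (cases "n = 0")
    case True
    then show ?thesis using M by (simp add: det_dim_zero)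
  next
    case False
    have "(cmod (Determinant.det M))\<^sup>2 = Re (Determinant.det G)"
      using M M' by (simp add: G_def det_mult detM' flip: complex_norm_square)
    also have "\<dots> = prod_list rs"
    proof -
      have "prod_list (map complex_of_real l) = complex_of_real (prod_list l)" for l by (induction l) auto
      then show ?thesis by (simp add: detG es)
    qed
    also have "\<dots> \<le> real n ^ length rs * exp (sum_list rs / n - length rs)"
      using rs0
    proof (induction rs)
      case (Cons r rs)
      \<comment> \<open>The tangent of the exponential at 0 takes the place of the inequality
        between arithmetic and geometric means.\<close>
      have "r / n \<le> exp (r / n - 1)" using exp_ge_add_one_self[of "r / n - 1"] by simp
      then have "r \<le> n * exp (r / n - 1)" using False by (simp add: divide_le_eq mult.commute)
      then have "r * prod_list rs \<le> (n * exp (r / n - 1)) * (real n ^ length rs * exp (sum_list rs / n - length rs))"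
        using Cons.prems by (intro mult_mono Cons.IH prod_list_nonneg) auto
      also have "\<dots> = real n ^ length (r # rs) * exp ((r / n - 1) + (sum_list rs / n - length rs))"
        by (simp only: exp_add length_Cons power_Suc mult_ac)
      also have "(r / n - 1) + (sum_list rs / n - length rs) = sum_list (r # rs) / n - length (r # rs)"
        by (simp add: add_divide_distrib)
      finally show ?case by simp
    qed simp
    also have "\<dots> \<le> real n ^ n * 1"
    proof -
      have "sum_list rs / n \<le> n" using sum_rs False by (simp add: divide_le_eq)
      then show ?thesis using len by (intro mult_mono) (auto simp: rs_def)
    qed
    finally show ?thesis by simp
  qed
qed

text \<open>Each Leibniz term uses every row and every column once, so the weights come out of the
  determinant and Hadamard's inequality applies to the normalized entries. Where a weight vanishes
  the entry vanishes too, and division by zero, which yields 0, keeps the factorization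
  true.\<close>

lemma det_le_prod_weights:
  fixes m :: "nat \<Rightarrow> nat \<Rightarrow> complex" and a b :: "nat \<Rightarrow> real"
  assumes le: "\<And>i j. i < n \<Longrightarrow> j < n \<Longrightarrow> cmod (m i j) \<le> a i * b j"
    and a: "\<And>i. i < n \<Longrightarrow> 0 \<le> a i" and b: "\<And>i. i < n \<Longrightarrow> 0 \<le> b i"
  shows "cmod (Determinant.det (Matrix.mat n n (\<lambda>(i, j). m i j))) \<le> sqrt (real n ^ n) * (\<Prod>i<n. a i * b i)"
proof -
  define u where "u i j = m i j / complex_of_real (a i * b j)" for i j
  have m: "m i j = complex_of_real (a i) * complex_of_real (b j) * u i j" if "i < n" "j < n" for i j
    using le[OF that] by (auto simp: u_def)
  have u1: "cmod (u i j) \<le> 1" if "i < n" "j < n" for i j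
    using le[OF that] a[OF that(1)] b[OF that(2)]
    by (cases "a i * b j = 0") (auto simp: u_def norm_divide norm_mult divide_le_eq_1 less_le)
  let ?U = "Matrix.mat n n (\<lambda>(i, j). u i j)"
  have "Determinant.det (Matrix.mat n n (\<lambda>(i, j). m i j)) = (\<Prod>i<n. complex_of_real (a i * b i)) * Determinant.det ?U"
  proof -
    have "(\<Prod>i = 0..<n. m i (p i)) = (\<Prod>i<n. complex_of_real (a i * b i)) * (\<Prod>i = 0..<n. u i (p i))"
      if p: "p permutes {0..<n}" for p
    proof -
      have "(\<Prod>i = 0..<n. m i (p i)) = (\<Prod>i = 0..<n. complex_of_real (a i) * complex_of_real (b (p i)) * u i (p i))"
        using permutes_in_image[OF p] by (intro prod.cong refl m) auto
      also have "\<dots> = (\<Prod>i = 0..<n. complex_of_real (a i)) * (\<Prod>i = 0..<n. complex_of_real (b (p i))) * (\<Prod>i = 0..<n. u i (p i))"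
        by (simp add: prod.distrib)
      also have "(\<Prod>i = 0..<n. complex_of_real (b (p i))) = (\<Prod>i = 0..<n. complex_of_real (b i))"
        using prod.permute[OF p, of "\<lambda>i. complex_of_real (b i)"] by (simp add: comp_def)
      finally show ?thesis by (simp add: prod.distrib lessThan_atLeast0)
    qed
    moreover have "Determinant.det (Matrix.mat n n (\<lambda>(i, j). m i j)) = (\<Sum>p | p permutes {0..<n}. signof p * (\<Prod>i = 0..<n. m i (p i)))"
      by (rule det_mat_permutes)
    moreover have "Determinant.det ?U = (\<Sum>p | p permutes {0..<n}. signof p * (\<Prod>i = 0..<n. u i (p i)))"
      by (rule det_mat_permutes)
    ultimately show ?thesis
      by (simp add: sum_distrib_left mult.left_commute)
  qed
  then have "cmod (Determinant.det (Matrix.mat n n (\<lambda>(i, j). m i j))) = (\<Prod>i<n. a i * b i) * cmod (Determinant.det ?U)"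
    using a b by (simp add: norm_mult prod_norm[symmetric])
  moreover have "cmod (Determinant.det ?U) \<le> sqrt (real n ^ n)"
    by (rule real_le_rsqrt, rule Hadamard_inequality) (use u1 in auto)
  moreover have "0 \<le> (\<Prod>i<n. a i * b i)"
    using a b by (intro prod_nonneg) auto
  ultimately show ?thesis by (simp only: mult.commute[of _ "\<Prod>i<n. a i * b i"] mult_left_mono)
qed


section \<open>Pointwise bounds for kernels\<close>

lemma fun_of_square_integrable: "fun_of f \<in> square_integrable"
  unfolding fun_of_def using Quotient_rep_reflp[OF Quotient_L2] by blast

lemma fun_of_to_L2: "f \<in> square_integrable \<Longrightarrow> AE x in lborel. fun_of (to_L2 f) x = f x"
  unfolding fun_of_def to_L2_def using Quotient_rep_abs[OF Quotient_L2, of f] by simp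

lemma fun_of_measurable [measurable]: "fun_of f \<in> borel_measurable borel"
  using fun_of_square_integrable[of f] by (simp add: square_integrable_def)

lemma cnj_measurable [measurable]: "cnj \<in> borel_measurable borel"
  by (intro borel_measurable_continuous_onI continuous_intros)

lemma cinner_eq: "cinner f g = (LINT x|lborel. fun_of f x * cnj (fun_of g x))"
  unfolding fun_of_def by (rule cinner.rep_eq)

lemma cinner_add_left: "cinner (f + g) h = cinner f h + cinner g h"
  by transfer (auto simp: distrib_right integrable_mult_cnj)

lemma cinner_scaleC_left: "cinner (c *\<^sub>C f) g = c * cinner f g"
  by transfer (auto simp: mult.assoc integrable_mult_cnj)

lemma cinner_add_right: "cinner h (f + g) = cinner h f + cinner h g"
  by (metis cinner_commute cinner_add_left complex_cnj_add)

lemma cinner_scaleC_right: "cinner f (c *\<^sub>C g) = cnj c * cinner f g"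
  by (metis cinner_commute cinner_scaleC_left complex_cnj_mult)

text \<open>Polarization: reality of the form at \<open>f + \<i> g\<close> equates the real parts of
  \<open>cinner (A f) g\<close> and \<open>cinner (A g) f\<close>, which is symmetry for the real
  inner product.\<close>

lemma positive_op_imp_psd_op:
  assumes "positive_op A"
  shows "psd_op A"
proof -
  have bl: "bounded_linear A" and sc: "A (c *\<^sub>C f) = c *\<^sub>C A f" for c f
    using assms by (auto simp: positive_op_def bounded_op_def)
  have pos: "Im (cinner (A f) f) = 0" "0 \<le> Re (cinner (A f) f)" for f
    using assms by (auto simp: positive_op_def complex_nonneg_Reals_iff)
  interpret A: bounded_linear A by (rule bl)
  have "A f \<bullet> g = f \<bullet> A g" for f g
  proof -
    have "Im (cinner (A (f + \<i> *\<^sub>C g)) (f + \<i> *\<^sub>C g)) = 0" by (rule pos)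
    then have "Re (cinner (A f) g) = Re (cinner (A g) f)"
      by (simp add: A.add sc cinner_add_left cinner_add_right cinner_scaleC_left cinner_scaleC_right pos)
    then show ?thesis by (simp add: inner_L2_def inner_commute) (metis inner_L2_def inner_commute)
  qed
  then show ?thesis using bl pos by (simp add: psd_op_def inner_L2_def)
qed

text \<open>The real inner product sees only the real part of \<open>cinner\<close>. Multiplying
  \<open>f\<close> by the unimodular \<open>u\<close> turns \<open>cinner (T f) g\<close> into its
  modulus and leaves the form of \<open>A\<close> unchanged.\<close>

lemma mixed_Schwarz:
  fixes T T' A A' :: op_L2
  assumes T: "bounded_op T" and adj: "is_adjoint T T'"
    and A: "positive_op A" and A': "positive_op A'"
    and TA: "\<And>f. norm (T f) \<le> norm (A f)" and TA': "\<And>f. norm (T' f) \<le> norm (A' f)"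
  shows "(cmod (cinner (T f) g))\<^sup>2 \<le> Re (cinner (A f) f) * Re (cinner (A' g) g)"
proof -
  have *: "(T f \<bullet> g)\<^sup>2 \<le> (A f \<bullet> f) * (A' g \<bullet> g)" for f g
    by (rule Heinz_inequality[of _ _ _ T'])
      (use assms in \<open>auto simp: positive_op_imp_psd_op bounded_op_def is_adjoint_def inner_L2_def\<close>)
  define c where "c = cinner (T f) g"
  define u where "u = (if c = 0 then 1 else cnj c / cmod c)"
  have "cnj c * c = complex_of_real (cmod c) * complex_of_real (cmod c)"
    by (metis complex_norm_square mult.commute of_real_mult power2_eq_square)
  then have u: "u * cnj u = 1" "u * c = cmod c"
    by (auto simp: u_def divide_simps mult.commute)
  have "T (u *\<^sub>C f) = u *\<^sub>C T f" "A (u *\<^sub>C f) = u *\<^sub>C A f"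
    using T A by (auto simp: bounded_op_def positive_op_def)
  moreover have "cinner (u *\<^sub>C A f) (u *\<^sub>C f) = cinner (A f) f"
    using u(1) by (simp add: cinner_scaleC_left cinner_scaleC_right mult.assoc[symmetric] mult.commute[of u])
  ultimately have "T (u *\<^sub>C f) \<bullet> g = cmod c" "A (u *\<^sub>C f) \<bullet> (u *\<^sub>C f) = Re (cinner (A f) f)"
    using u(2) by (simp_all add: inner_L2_def cinner_scaleC_left c_def)
  then show ?thesis using *[of "u *\<^sub>C f" g] by (simp add: c_def inner_L2_def)
qed

text \<open>As \<open>A\<close> squared is \<open>P' P + Q' Q\<close>, the square of
  \<open>norm (A f)\<close> is the sum of the squares of \<open>norm (P f)\<close> and
  \<open>norm (Q f)\<close>. Applied to \<open>H\<close> and \<open>S\<close>, and to their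
  adjoints.\<close>

lemma norm_is_sqrt_op:
  assumes "is_sqrt_op A (\<lambda>f. P' (P f) + Q' (Q f))"
    and "\<And>f g. cinner (P f) g = cinner f (P' g)" and "\<And>f g. cinner (Q f) g = cinner f (Q' g)"
  shows "norm (P f) \<le> norm (A f)" "norm (Q f) \<le> norm (A f)"
proof -
  have A: "psd_op A" and AA: "A (A f) = P' (P f) + Q' (Q f)"
    using assms(1) positive_op_imp_psd_op by (auto simp: is_sqrt_op_def fun_eq_iff)
  have "(norm (A f))\<^sup>2 = f \<bullet> A (A f)"
    using A unfolding psd_op_def power2_norm_eq_inner by metis
  also have "\<dots> = (norm (P f))\<^sup>2 + (norm (Q f))\<^sup>2"
    by (simp add: AA inner_add_right power2_norm_eq_inner) (simp add: inner_L2_def assms)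
  finally have eq: "(norm (A f))\<^sup>2 = (norm (P f))\<^sup>2 + (norm (Q f))\<^sup>2" .
  show "norm (P f) \<le> norm (A f)" "norm (Q f) \<le> norm (A f)"
    by (rule power2_le_imp_le, simp add: eq, simp)+
qed

text \<open>Serves both variables of a kernel in turn. The bound is asked only almost everywhere
  because in the outer variable the integrand is a representative of an \<open>L2\<close> class,
  fixed up to null sets.\<close>

lemma LINT_average_dist_le:
  fixes F :: "real \<Rightarrow> complex"
  assumes [measurable]: "F \<in> borel_measurable borel" and e: "0 < e"
    and F: "AE t in lborel. t \<in> {y..y + e} \<longrightarrow> cmod (F t - c) \<le> d"
  shows "cmod ((LINT t|lborel. F t * complex_of_real (indicator {y..y + e} t / e)) - c) \<le> d"
proof -
  define w :: "real \<Rightarrow> real" where "w t = indicator {y..y + e} t / e" for t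
  have w [measurable]: "w \<in> borel_measurable borel"
    unfolding w_def[abs_def] by measurable
  have w0: "0 \<le> w t" for t
    using e by (auto simp: w_def)
  have int_w: "integrable lborel w"
    unfolding w_def[abs_def] using e by (intro integrable_divide integrable_real_indicator) auto
  have LINT_w: "(LINT t|lborel. w t) = 1"
  proof -
    have "(LINT t|lborel. w t) = (LINT t|lborel. indicator {y..y + e} t) / e"
      unfolding w_def by (rule integral_divide_zero)
    also have "\<dots> = 1" using e by simp
    finally show ?thesis .
  qed
  have bound: "AE t in lborel. cmod ((F t - c) * complex_of_real (w t)) \<le> d * w t"
    using F
  proof eventually_elim
    case (elim t)
    show ?case
    proof (cases "t \<in> {y..y + e}")
      case True
      then have "cmod (F t - c) * w t \<le> d * w t" using elim w0 by (intro mult_right_mono) auto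
      then show ?thesis using w0[of t] by (simp add: norm_mult)
    qed (simp add: w_def)
  qed
  have int_d: "integrable lborel (\<lambda>t. d * w t)" using int_w by simp
  have int_diff: "integrable lborel (\<lambda>t. (F t - c) * complex_of_real (w t))"
    by (rule Bochner_Integration.integrable_bound[OF int_d]) (use bound in \<open>auto elim!: eventually_mono\<close>)
  have int_c: "integrable lborel (\<lambda>t. c * complex_of_real (w t))"
    using int_w by simp
  have "(LINT t|lborel. F t * complex_of_real (w t)) =
      (LINT t|lborel. (F t - c) * complex_of_real (w t) + c * complex_of_real (w t))"
    by (simp add: algebra_simps)
  also have "\<dots> = (LINT t|lborel. (F t - c) * complex_of_real (w t)) + c"
    using int_diff int_c by (simp add: LINT_w)
  finally have "cmod ((LINT t|lborel. F t * complex_of_real (w t)) - c) =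
      cmod (LINT t|lborel. (F t - c) * complex_of_real (w t))" by simp
  also have "\<dots> \<le> (LINT t|lborel. cmod ((F t - c) * complex_of_real (w t)))"
    by (rule integral_norm_bound)
  also have "\<dots> \<le> (LINT t|lborel. d * w t)"
    by (rule integral_mono_AE) (use int_diff int_d bound in auto)
  also have "\<dots> = d" by (simp add: LINT_w)
  finally show ?thesis by (simp add: w_def)
qed

text \<open>An approximate identity to the right of \<open>x\<close>: the mass is 1, but the
  \<open>L2\<close> norm is the square root of \<open>n + 1\<close>, so limits rest on continuity of
  the kernel and not on convergence in \<open>L2\<close>.\<close>

definition bump :: "real \<Rightarrow> nat \<Rightarrow> real L2"
  where "bump x n = to_L2 (\<lambda>s. complex_of_real (indicator {x..x + inverse (Suc n)} s / inverse (Suc n)))"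

lemma fun_of_bump:
  "AE s in lborel. fun_of (bump x n) s = complex_of_real (indicator {x..x + inverse (Suc n)} s / inverse (Suc n))"
proof -
  have "(cmod (complex_of_real (indicator {x..x + inverse (Suc n)} s / inverse (Suc n))))\<^sup>2 =
      (real (Suc n))\<^sup>2 * indicat_real {x..x + inverse (Suc n)} s" for s
    unfolding norm_of_real power2_abs by (auto simp: indicator_def divide_inverse)
  then show ?thesis
    unfolding bump_def
    by (intro fun_of_to_L2)
      (simp only: square_integrable_def mem_Collect_eq, simp add: integrable_real_indicator)
qed

text \<open>The pairing is the average of \<open>K\<close> over a square of side
  \<open>1 / (n + 1)\<close> with corner \<open>(x, y)\<close>. An operator integrates over the
  second variable of its kernel, hence \<open>bump y n\<close> is the argument and
  \<open>bump x n\<close> the test function.\<close>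

lemma cinner_bump_tendsto_kernel:
  assumes K: "induces K T" and cont: "continuous_on UNIV (\<lambda>(s, t). K s t)"
  shows "(\<lambda>n. cinner (T (bump y n)) (bump x n)) \<longlonglongrightarrow> K x y"
proof (rule LIMSEQ_I)
  fix r :: real assume r: "0 < r"
  have "\<exists>d>0. \<forall>p. dist p (x, y) < d \<longrightarrow> dist (case p of (s, t) \<Rightarrow> K s t) (K x y) < r / 2"
    using cont[unfolded continuous_on_iff, rule_format, of "(x, y)" "r / 2"] r by auto
  then obtain d where d: "0 < d" and dK: "\<And>s t. dist (s, t) (x, y) < d \<Longrightarrow> cmod (K s t - K x y) < r / 2"
    by (auto simp: dist_norm)
  obtain N where N: "2 * inverse (real (Suc N)) < d"
    using reals_Archimedean[of "d / 2"] d by (auto simp: mult.commute)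
  have "cmod (cinner (T (bump y n)) (bump x n) - K x y) \<le> r / 2" if n: "N \<le> n" for n
  proof -
    let ?e = "inverse (real (Suc n))"
    have e: "0 < ?e" "2 * ?e < d"
    proof -
      have "?e \<le> inverse (real (Suc N))" using n by (intro le_imp_inverse_le) auto
      then show "2 * ?e < d" using N by linarith
    qed simp
    have box: "cmod (K s t - K x y) \<le> r / 2" if "s \<in> {x..x + ?e}" "t \<in> {y..y + ?e}" for s t
    proof -
      have "dist (s, t) (x, y) \<le> dist s x + dist t y"
        unfolding dist_prod_def by (simp add: sqrt_sum_squares_le_sum)
      also have "\<dots> < d" using that e by (simp add: dist_real_def)
      finally show ?thesis using dK by (simp add: less_imp_le)
    qed
    have Tf: "AE s in lborel. fun_of (T (bump y n)) s = (LINT t|lborel. K s t * fun_of (bump y n) t)"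
      using K by (auto simp: induces_def)
    have "AE s in lborel. s \<in> {x..x + ?e} \<longrightarrow> cmod (fun_of (T (bump y n)) s - K x y) \<le> r / 2"
      using Tf
    proof eventually_elim
      case (elim s)
      show ?case
      proof
        assume s: "s \<in> {x..x + ?e}"
        have Km [measurable]: "K s \<in> borel_measurable borel"
          using continuous_on_compose2[OF cont, of UNIV "\<lambda>t. (s, t)"]
          by (intro borel_measurable_continuous_onI) (simp add: continuous_on_Pair)
        have "(LINT t|lborel. K s t * fun_of (bump y n) t) =
            (LINT t|lborel. K s t * complex_of_real (indicator {y..y + ?e} t / ?e))"
        proof (rule integral_cong_AE)
          show "AE t in lborel. K s t * fun_of (bump y n) t =
              K s t * complex_of_real (indicator {y..y + ?e} t / ?e)"
            using fun_of_bump[of y n] by eventually_elim simp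
        qed measurable
        then show "cmod (fun_of (T (bump y n)) s - K x y) \<le> r / 2"
          unfolding elim using LINT_average_dist_le[of "K s" ?e y "K x y" "r / 2"] e box[OF s] by simp
      qed
    qed
    then have "cmod ((LINT s|lborel. fun_of (T (bump y n)) s * complex_of_real (indicator {x..x + ?e} s / ?e)) - K x y) \<le> r / 2"
      by (intro LINT_average_dist_le) (use e in auto)
    moreover have "cinner (T (bump y n)) (bump x n) =
        (LINT s|lborel. fun_of (T (bump y n)) s * complex_of_real (indicator {x..x + ?e} s / ?e))"
      unfolding cinner_eq
    proof (rule integral_cong_AE)
      show "AE s in lborel. fun_of (T (bump y n)) s * cnj (fun_of (bump x n) s) =
          fun_of (T (bump y n)) s * complex_of_real (indicator {x..x + ?e} s / ?e)"
        using fun_of_bump[of x n] by eventually_elim simp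
    qed measurable
    ultimately show ?thesis by (simp only:)
  qed
  moreover have "r / 2 < r" using r by simp
  ultimately show "\<exists>no. \<forall>n\<ge>no. norm (cinner (T (bump y n)) (bump x n) - K x y) < r"
    by (meson le_less_trans)
qed

lemma kernel_diagonal_nonneg:
  assumes "positive_op A" and "induces a A" and "continuous_on UNIV (\<lambda>(s, t). a s t)"
  shows "0 \<le> Re (a s s)"
proof (rule LIMSEQ_le_const)
  show "(\<lambda>n. Re (cinner (A (bump s n)) (bump s n))) \<longlonglongrightarrow> Re (a s s)"
    by (intro tendsto_Re cinner_bump_tendsto_kernel assms)
  show "\<exists>N. \<forall>n\<ge>N. 0 \<le> Re (cinner (A (bump s n)) (bump s n))"
    using assms(1) by (simp add: positive_op_def complex_nonneg_Reals_iff)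
qed

lemma kernel_mixed_Schwarz:
  assumes "bounded_op T" and "is_adjoint T T'" and "positive_op A" and "positive_op A'"
    and "\<And>f. norm (T f) \<le> norm (A f)" and "\<And>f. norm (T' f) \<le> norm (A' f)"
    and "induces K T" and "continuous_on UNIV (\<lambda>(s, t). K s t)"
    and "induces a A" and "continuous_on UNIV (\<lambda>(s, t). a s t)"
    and "induces a' A'" and "continuous_on UNIV (\<lambda>(s, t). a' s t)"
  shows "cmod (K x y) \<le> sqrt (Re (a' x x)) * sqrt (Re (a y y))"
proof -
  have "(cmod (K x y))\<^sup>2 \<le> Re (a y y) * Re (a' x x)"
  proof (rule LIMSEQ_le)
    show "(\<lambda>n. (cmod (cinner (T (bump y n)) (bump x n)))\<^sup>2) \<longlonglongrightarrow> (cmod (K x y))\<^sup>2"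
      by (intro tendsto_intros cinner_bump_tendsto_kernel assms)
    show "(\<lambda>n. Re (cinner (A (bump y n)) (bump y n)) * Re (cinner (A' (bump x n)) (bump x n)))
        \<longlonglongrightarrow> Re (a y y) * Re (a' x x)"
      by (intro tendsto_intros cinner_bump_tendsto_kernel assms)
  qed (intro exI allI impI mixed_Schwarz[OF assms(1-6)])
  then have "cmod (K x y) \<le> sqrt (Re (a y y) * Re (a' x x))" by (rule real_le_rsqrt)
  then show ?thesis by (simp only: real_sqrt_mult mult.commute)
qed


section \<open>Functions dominated by products of decaying weights\<close>

text \<open>Unit circles around points at distance at most 1 from \<open>z\<close> stay in the disk
  of radius \<open>R + 2\<close>, so the second derivative is at most \<open>2 * B\<close> there,
  and Taylor's formula gives the error. The constants are explicit so that \<open>B\<close> may vary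
  with a further variable of \<open>f\<close>, as a multiple of a weight or as an integrable
  function.\<close>

lemma Cauchy_difference_quotient:
  assumes f: "f holomorphic_on UNIV" and B: "\<And>u. cmod u \<le> R + 2 \<Longrightarrow> cmod (f u) \<le> B"
    and z: "cmod z \<le> R"
  shows "cmod (deriv f z) \<le> B"
    and "w \<noteq> z \<Longrightarrow> cmod (w - z) \<le> 1 \<Longrightarrow>
      cmod (inverse (w - z) * (f w - f z) - deriv f z) \<le> 2 * B * cmod (w - z)"
proof -
  have hol: "f holomorphic_on S" for S using f by (rule holomorphic_on_subset) simp
  have C: "cmod ((deriv ^^ n) f u) \<le> fact n * B" if "cmod (u - z) \<le> 1" for n u
  proof -
    have "cmod ((deriv ^^ n) f u) \<le> fact n * B / 1 ^ n"
    proof (rule Cauchy_inequality[OF hol holomorphic_on_imp_continuous_on[OF hol]])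
      fix v assume v: "cmod (u - v) = 1"
      have "v = z + (u - z) - (u - v)" by simp
      then have "cmod v \<le> cmod z + cmod (u - z) + cmod (u - v)"
        by (metis norm_triangle_ineq norm_triangle_ineq4 add_right_mono order_trans)
      then show "cmod (f v) \<le> B" using v that z by (intro B) simp
    qed simp
    then show ?thesis by simp
  qed
  show "cmod (deriv f z) \<le> B" using C[of z 1] by simp
  assume w: "w \<noteq> z" "cmod (w - z) \<le> 1"
  have "cmod ((deriv ^^ 0) f w - (\<Sum>i\<le>1. (deriv ^^ i) f z * (w - z) ^ i / fact i))
      \<le> (2 * B) * cmod (w - z) ^ Suc 1 / fact 1"
  proof (rule complex_Taylor[of "cball z 1"])
    show "((deriv ^^ i) f has_field_derivative (deriv ^^ Suc i) f x) (at x within cball z 1)" for i x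
      using holomorphic_derivI[OF holomorphic_higher_deriv[OF f open_UNIV, of i] open_UNIV, of x]
      by (auto intro: has_field_derivative_at_within)
    show "cmod ((deriv ^^ Suc 1) f x) \<le> 2 * B" if "x \<in> cball z 1" for x
      using C[of x 2] that by (simp add: dist_norm norm_minus_commute numeral_2_eq_2)
  qed (use w in \<open>auto simp: dist_norm norm_minus_commute\<close>)
  then have *: "cmod (f w - f z - deriv f z * (w - z)) \<le> 2 * B * (cmod (w - z))\<^sup>2"
    by (simp add: algebra_simps power2_eq_square)
  have "inverse (w - z) * (f w - f z) - deriv f z = (f w - f z - deriv f z * (w - z)) / (w - z)"
    using w by (simp add: field_simps)
  then have "cmod (inverse (w - z) * (f w - f z) - deriv f z) = cmod (f w - f z - deriv f z * (w - z)) / cmod (w - z)"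
    by (simp add: norm_divide)
  also have "\<dots> \<le> 2 * B * (cmod (w - z))\<^sup>2 / cmod (w - z)"
    by (intro divide_right_mono *) simp
  also have "\<dots> = 2 * B * cmod (w - z)" using w by (simp add: power2_eq_square)
  finally show "cmod (inverse (w - z) * (f w - f z) - deriv f z) \<le> 2 * B * cmod (w - z)" .
qed

lemma continuous_on_UNIV_sequentiallyI:
  fixes f :: "'a::{first_countable_topology, t2_space} \<Rightarrow> 'b::topological_space"
  assumes "\<And>u a. u \<longlonglongrightarrow> a \<Longrightarrow> (\<lambda>n. f (u n)) \<longlonglongrightarrow> f a"
  shows "continuous_on UNIV f"
  unfolding continuous_on_eq_continuous_within
  using assms by (intro ballI continuous_within_sequentiallyI) auto

lemma to_L2_add:
  "f \<in> square_integrable \<Longrightarrow> g \<in> square_integrable \<Longrightarrow> to_L2 (\<lambda>x. f x + g x) = to_L2 f + to_L2 g"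
  by (simp add: to_L2_def plus_L2.abs_eq)

lemma to_L2_diff:
  "f \<in> square_integrable \<Longrightarrow> g \<in> square_integrable \<Longrightarrow> to_L2 (\<lambda>x. f x - g x) = to_L2 f - to_L2 g"
  by (simp add: to_L2_def minus_L2.abs_eq)

lemma to_L2_scaleC: "f \<in> square_integrable \<Longrightarrow> to_L2 (\<lambda>x. c * f x) = c *\<^sub>C to_L2 f"
  by (simp add: to_L2_def scaleC_L2.abs_eq)

lemma norm_to_L2: "f \<in> square_integrable \<Longrightarrow> norm (to_L2 f) = sqrt (LINT x|lborel. (cmod (f x))\<^sup>2)"
  by (simp add: to_L2_def norm_L2_def inner_L2_def cinner_self norm_square.abs_eq)

lemma continuous_map_powertop_real:
  fixes G :: "('i::countable \<Rightarrow> real) \<Rightarrow> 'b::topological_space"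
  assumes "continuous_on UNIV G"
  shows "continuous_map (powertop_real J) euclidean G"
proof -
  have "continuous_map (powertop_real J) (powertop_real UNIV) (\<lambda>x. x)"
    unfolding continuous_map_componentwise_UNIV
  proof
    fix k
    show "continuous_map (powertop_real J) euclideanreal (\<lambda>x. x k)"
    proof (cases "k \<in> J")
      case False
      \<comment> \<open>Points of the carrier are extensional: a coordinate outside \<open>J\<close>
        is constantly \<open>undefined\<close>, which makes the inclusion into the full product
        continuous.\<close>
      have "continuous_map (powertop_real J) euclideanreal (\<lambda>x. undefined)" by simp
      moreover have "undefined = x k" if "x \<in> topspace (powertop_real J)" for x
        using that False by (simp add: PiE_def extensional_def)
      ultimately show ?thesis by (rule continuous_map_eq)
    qed (rule continuous_map_product_projection)
  qed
  then have "continuous_map (powertop_real J) euclidean (\<lambda>x::'i \<Rightarrow> real. x)"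
    by (simp add: euclidean_product_topology)
  from continuous_map_compose[OF this, of euclidean G] assms show ?thesis
    by (simp add: comp_def)
qed

text \<open>
  Functions of the Fredholm variables are taken on the whole space of functions on the index
  type, which is first countable; restricting to \<open>powertop_real I\<close> costs nothing.
\<close>

locale decaying_weights =
  fixes I :: "'i::countable set" and \<omega> :: "'i \<Rightarrow> real \<Rightarrow> real"
  assumes finite_I: "finite I"
    and weight_cont: "\<And>u. continuous_on UNIV (\<omega> u)"
    and weight_nonneg: "\<And>u t. 0 \<le> \<omega> u t"
    and weight_decay: "\<And>u. (\<omega> u \<longlongrightarrow> 0) at_infinity"
    and weight_L2: "\<And>u. integrable lborel (\<lambda>t. (\<omega> u t)\<^sup>2)"
begin

definition weight :: "'i set \<Rightarrow> ('i \<Rightarrow> real) \<Rightarrow> real"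
  where "weight J x = (\<Prod>u\<in>J. \<omega> u (x u))"

text \<open>Norm at most \<open>C\<close> in a weighted supremum norm, expressed without dividing by
  a weight that may vanish.\<close>

definition dominated :: "(('i \<Rightarrow> real) \<Rightarrow> complex) \<Rightarrow> real \<Rightarrow> bool"
  where "dominated F C \<longleftrightarrow> continuous_on UNIV F \<and> 0 \<le> C \<and> (\<forall>x. cmod (F x) \<le> C * weight I x)"

lemma weight_ge_0: "0 \<le> weight J x"
  by (simp add: weight_def prod_nonneg weight_nonneg)

lemma weights_bounded:
  obtains M where "1 \<le> M" "\<And>u t. u \<in> I \<Longrightarrow> \<omega> u t \<le> M"
proof -
  have "\<exists>m. \<forall>t. \<omega> u t \<le> m" for u
  proof -
    obtain R where R: "\<And>t. R \<le> \<bar>t\<bar> \<Longrightarrow> \<omega> u t < 1"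
      using weight_decay[of u, unfolded tendsto_iff, rule_format, of 1] weight_nonneg[of u]
      by (auto simp: eventually_at_infinity dist_real_def)
    have "bounded (\<omega> u ` {-\<bar>R\<bar>..\<bar>R\<bar>})"
      by (intro compact_imp_bounded compact_continuous_image continuous_on_subset[OF weight_cont]) auto
    then obtain m where "\<forall>x\<in>\<omega> u ` {-\<bar>R\<bar>..\<bar>R\<bar>}. norm x \<le> m"
      unfolding bounded_iff by blast
    then have m: "\<And>t. t \<in> {-\<bar>R\<bar>..\<bar>R\<bar>} \<Longrightarrow> \<bar>\<omega> u t\<bar> \<le> m"
      by simp
    have "\<omega> u t \<le> max m 1" for t
    proof (cases "R \<le> \<bar>t\<bar>")
      case False
      then have "t \<in> {-\<bar>R\<bar>..\<bar>R\<bar>}" by auto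
      then show ?thesis using m[of t] by auto
    qed (use R[of t] in auto)
    then show ?thesis by blast
  qed
  then obtain m where m: "\<And>u t. \<omega> u t \<le> m u" by metis
  show thesis
  proof (rule that[of "1 + (\<Sum>u\<in>I. m u)"])
    have m0: "0 \<le> m u" for u using weight_nonneg[of u 0] m[of u 0] by linarith
    then show "1 \<le> 1 + (\<Sum>u\<in>I. m u)" by (simp add: sum_nonneg)
    fix u t assume "u \<in> I"
    then have "m u \<le> (\<Sum>u\<in>I. m u)" using finite_I m0 by (intro member_le_sum) auto
    then show "\<omega> u t \<le> 1 + (\<Sum>u\<in>I. m u)" using m[of u t] by linarith
  qed
qed

text \<open>At least 1, so that \<open>bound ^ card I\<close> bounds the weight product over every
  subset of \<open>I\<close>, as the views with fewer outer variables require.\<close>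

definition bound :: real
  where "bound = (SOME M. 1 \<le> M \<and> (\<forall>u\<in>I. \<forall>t. \<omega> u t \<le> M))"

lemma bound: "1 \<le> bound" "u \<in> I \<Longrightarrow> \<omega> u t \<le> bound"
proof -
  have "\<exists>M. 1 \<le> M \<and> (\<forall>u\<in>I. \<forall>t. \<omega> u t \<le> M)" by (rule weights_bounded) blast
  then have "1 \<le> bound \<and> (\<forall>u\<in>I. \<forall>t. \<omega> u t \<le> bound)" unfolding bound_def by (rule someI_ex)
  then show "1 \<le> bound" "u \<in> I \<Longrightarrow> \<omega> u t \<le> bound" by auto
qed

lemma weight_le: "J \<subseteq> I \<Longrightarrow> weight J x \<le> bound ^ card I"
proof -
  assume J: "J \<subseteq> I"
  have "weight J x \<le> (\<Prod>u\<in>J. bound)"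
    unfolding weight_def using J bound by (intro prod_mono) (auto simp: weight_nonneg)
  also have "\<dots> \<le> bound ^ card I"
    using J bound finite_I by (simp add: power_increasing card_mono)
  finally show ?thesis .
qed

text \<open>Outside the cube some coordinate lies in the tail of its weight, which makes one factor
  small while the product of the others stays below \<open>bound ^ card I\<close>. For empty
  \<open>J\<close> the product is a point, and the cube contains it.\<close>

lemma weighted_in_C0:
  fixes G :: "('i \<Rightarrow> real) \<Rightarrow> 'b::complex_normed_vector"
  assumes G: "continuous_on UNIV G" and le: "\<And>x. norm (G x) \<le> C * weight J x"
    and J: "J \<subseteq> I" and C: "0 \<le> C"
  shows "G \<in> C0 (powertop_real J)" "C0_norm (powertop_real J) G \<le> ennreal (C * bound ^ card I)"
proof -
  show "C0_norm (powertop_real J) G \<le> ennreal (C * bound ^ card I)"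
    unfolding C0_norm_def
  proof (rule SUP_least, rule ennreal_leI)
    fix x
    have "C * weight J x \<le> C * bound ^ card I" by (intro mult_left_mono weight_le J C)
    then show "norm (G x) \<le> C * bound ^ card I" using le[of x] by linarith
  qed
  have "\<exists>K. compactin (powertop_real J) K \<and> (\<forall>x\<in>topspace (powertop_real J) - K. norm (G x) < e)"
    if e: "0 < e" for e
  proof -
    define b where "b = bound ^ card I"
    have b: "1 \<le> b" using bound by (simp add: b_def one_le_power)
    \<comment> \<open>The summand 1 keeps the denominator positive for \<open>C = 0\<close> and the
      final estimate strict.\<close>
    define e' where "e' = e / (C * b + 1)"
    have pos: "0 < C * b + 1" using C b by (intro add_nonneg_pos) auto
    have e': "0 < e'" using e pos by (simp add: e'_def)
    have "\<forall>u\<in>J. \<forall>\<^sub>F t in at_infinity. \<omega> u t < e'"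
      using weight_decay e' order_tendstoD(2) by blast
    then have "\<forall>\<^sub>F t in at_infinity. \<forall>u\<in>J. \<omega> u t < e'"
      using finite_subset[OF J finite_I] by (simp add: eventually_ball_finite)
    then obtain R where R: "\<And>t u. R \<le> \<bar>t\<bar> \<Longrightarrow> u \<in> J \<Longrightarrow> \<omega> u t < e'"
      by (auto simp: eventually_at_infinity)
    let ?K = "PiE J (\<lambda>_. {-R..R})"
    have "compactin (powertop_real J) ?K" by (simp add: compactin_PiE)
    moreover have "norm (G x) < e" if x: "x \<in> topspace (powertop_real J) - ?K" for x
    proof -
      obtain u where u: "u \<in> J" "x u \<notin> {-R..R}" using x by (auto simp: PiE_iff)
      then have xu: "\<omega> u (x u) < e'" by (intro R) auto
      have "weight J x = \<omega> u (x u) * weight (J - {u}) x"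
        unfolding weight_def using u finite_subset[OF J finite_I] by (intro prod.remove) auto
      also have "\<dots> \<le> e' * b"
        unfolding b_def using xu e' J weight_ge_0 by (intro mult_mono weight_le) auto
      finally have "C * weight J x \<le> C * (e' * b)" using C by (intro mult_left_mono)
      also have "\<dots> = e' * (C * b)" by simp
      also have "\<dots> < e' * (C * b + 1)" using e' by (intro mult_strict_left_mono) auto
      also have "\<dots> = e" using pos by (simp add: e'_def)
      finally show ?thesis using le[of x] by linarith
    qed
    ultimately show ?thesis by blast
  qed
  then show "G \<in> C0 (powertop_real J)"
    using continuous_map_powertop_real[OF G] by (simp add: C0_def)
qed

lemma dominated_add: "dominated F C \<Longrightarrow> dominated G D \<Longrightarrow> dominated (\<lambda>x. F x + G x) (C + D)"
  unfolding dominated_def distrib_right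
  by (auto intro!: continuous_intros order_trans[OF norm_triangle_ineq] add_mono)

lemma dominated_cmult: "dominated F C \<Longrightarrow> dominated (\<lambda>x. c * F x) (cmod c * C)"
  unfolding dominated_def
  by (auto intro!: continuous_intros mult_left_mono simp: norm_mult mult.assoc)

text \<open>\<open>\<sigma> y a\<close> writes \<open>a\<close> into the singled-out coordinates of
  \<open>y\<close>. The weight then factors: \<open>g\<close> carries the \<open>L2\<close> norm and
  the remaining coordinates keep their decay. Continuity in \<open>y\<close> is dominated
  convergence with a multiple of the square of \<open>g\<close>.\<close>

lemma L2_view:
  fixes \<sigma> :: "('i \<Rightarrow> real) \<Rightarrow> 'a::euclidean_space \<Rightarrow> ('i \<Rightarrow> real)"
  assumes F: "dominated F C"
    and \<sigma>1: "\<And>a. continuous_on UNIV (\<lambda>y. \<sigma> y a)" and \<sigma>2: "\<And>y. continuous_on UNIV (\<sigma> y)"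
    and W: "\<And>y a. weight I (\<sigma> y a) = weight J y * g a" and J: "J \<subseteq> I"
    and g: "g \<in> borel_measurable borel" "\<And>a. 0 \<le> g a" "integrable lborel (\<lambda>a. (g a)\<^sup>2)"
  shows "(\<lambda>a. F (\<sigma> y a)) \<in> square_integrable" (is "?SI y")
    and "norm (to_L2 (\<lambda>a. F (\<sigma> y a))) \<le> (C * sqrt (LINT a|lborel. (g a)\<^sup>2)) * weight J y"
    and "continuous_on UNIV (\<lambda>y. to_L2 (\<lambda>a. F (\<sigma> y a)))"
proof -
  have contF: "continuous_on UNIV F" and C: "0 \<le> C" and le: "cmod (F (\<sigma> y a)) \<le> C * weight J y * g a" for y a
    using F W by (auto simp: dominated_def mult.assoc) (metis W)
  note [measurable] = g(1)
  have meas [measurable]: "(\<lambda>a. F (\<sigma> y a)) \<in> borel_measurable borel" for y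
    by (intro borel_measurable_continuous_onI continuous_on_compose2[OF contF \<sigma>2]) auto
  have le2: "(cmod (F (\<sigma> y a)))\<^sup>2 \<le> (C * weight J y)\<^sup>2 * (g a)\<^sup>2" for y a
    using le[of y a] by (simp flip: power_mult_distrib add: power_mono)
  have SI: "?SI y" for y
    unfolding square_integrable_def mem_Collect_eq
  proof
    show "integrable lborel (\<lambda>a. (cmod (F (\<sigma> y a)))\<^sup>2)"
      by (rule Bochner_Integration.integrable_bound[of _ "\<lambda>a. (C * weight J y)\<^sup>2 * (g a)\<^sup>2"])
        (use g(3) le2 in auto)
  qed simp
  then show "?SI y" .
  show "norm (to_L2 (\<lambda>a. F (\<sigma> y a))) \<le> (C * sqrt (LINT a|lborel. (g a)\<^sup>2)) * weight J y"
  proof -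
    have "(LINT a|lborel. (cmod (F (\<sigma> y a)))\<^sup>2) \<le> (LINT a|lborel. (C * weight J y)\<^sup>2 * (g a)\<^sup>2)"
      by (rule integral_mono) (use SI[of y] g(3) le2 in \<open>auto simp: square_integrable_def\<close>)
    then have "norm (to_L2 (\<lambda>a. F (\<sigma> y a))) \<le> sqrt ((C * weight J y)\<^sup>2 * (LINT a|lborel. (g a)\<^sup>2))"
      unfolding norm_to_L2[OF SI] by simp
    also have "\<dots> = (C * sqrt (LINT a|lborel. (g a)\<^sup>2)) * weight J y"
      using C weight_ge_0 by (simp add: real_sqrt_mult)
    finally show ?thesis .
  qed
  show "continuous_on UNIV (\<lambda>y. to_L2 (\<lambda>a. F (\<sigma> y a)))"
  proof (rule continuous_on_UNIV_sequentiallyI)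
    fix u :: "nat \<Rightarrow> 'i \<Rightarrow> real" and y assume u: "u \<longlonglongrightarrow> y"
    let ?b = "2 * C * bound ^ card I"
    have "(\<lambda>n. LINT a|lborel. (cmod (F (\<sigma> (u n) a) - F (\<sigma> y a)))\<^sup>2) \<longlonglongrightarrow> (LINT (a::'a)|lborel. (0::real))"
    proof (rule integral_dominated_convergence[where w = "\<lambda>a::'a. ?b\<^sup>2 * (g a)\<^sup>2"])
      show "integrable lborel (\<lambda>a. ?b\<^sup>2 * (g a)\<^sup>2)" using g(3) by simp
      show "AE a in lborel. (\<lambda>n. (cmod (F (\<sigma> (u n) a) - F (\<sigma> y a)))\<^sup>2) \<longlonglongrightarrow> 0"
      proof (rule AE_I2)
        fix a
        have "(\<lambda>n. F (\<sigma> (u n) a)) \<longlonglongrightarrow> F (\<sigma> y a)"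
          by (intro continuous_on_tendsto_compose[OF continuous_on_compose2[OF contF \<sigma>1] u]) auto
        then have "(\<lambda>n. (cmod (F (\<sigma> (u n) a) - F (\<sigma> y a)))\<^sup>2) \<longlonglongrightarrow> (cmod (F (\<sigma> y a) - F (\<sigma> y a)))\<^sup>2"
          by (intro tendsto_intros)
        then show "(\<lambda>n. (cmod (F (\<sigma> (u n) a) - F (\<sigma> y a)))\<^sup>2) \<longlonglongrightarrow> 0" by simp
      qed
      show "AE a in lborel. norm ((cmod (F (\<sigma> (u n) a) - F (\<sigma> y a)))\<^sup>2) \<le> ?b\<^sup>2 * (g a)\<^sup>2" for n
      proof (rule AE_I2)
        fix a
        have "cmod (F (\<sigma> y a)) \<le> C * bound ^ card I * g a" for y
          using le[of y a] mult_right_mono[OF mult_left_mono[OF weight_le[OF J, of y] C] g(2)[of a]]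
          by linarith
        from this[of "u n"] this[of y] have "cmod (F (\<sigma> (u n) a) - F (\<sigma> y a)) \<le> ?b * g a"
          using norm_triangle_ineq4[of "F (\<sigma> (u n) a)" "F (\<sigma> y a)"] by simp
        then show "norm ((cmod (F (\<sigma> (u n) a) - F (\<sigma> y a)))\<^sup>2) \<le> ?b\<^sup>2 * (g a)\<^sup>2"
          by (simp flip: power_mult_distrib add: power_mono)
      qed
    qed measurable
    then have "(\<lambda>n. sqrt (LINT a|lborel. (cmod (F (\<sigma> (u n) a) - F (\<sigma> y a)))\<^sup>2)) \<longlonglongrightarrow> sqrt 0"
      by (intro tendsto_intros) simp
    moreover have "sqrt (LINT a|lborel. (cmod (F (\<sigma> v a) - F (\<sigma> y a)))\<^sup>2) =
        norm (to_L2 (\<lambda>a. F (\<sigma> v a)) - to_L2 (\<lambda>a. F (\<sigma> y a)))" for v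
    proof -
      have "(\<lambda>a. F (\<sigma> v a) - F (\<sigma> y a)) \<in> square_integrable"
        using square_integrable_add[OF SI[of v] square_integrable_cmult[OF SI[of y], of "-1"]] by simp
      then show ?thesis by (simp only: norm_to_L2 flip: to_L2_diff[OF SI SI])
    qed
    ultimately have "(\<lambda>n. norm (to_L2 (\<lambda>a. F (\<sigma> (u n) a)) - to_L2 (\<lambda>a. F (\<sigma> y a)))) \<longlonglongrightarrow> 0"
      by (simp only: real_sqrt_zero)
    then show "(\<lambda>n. to_L2 (\<lambda>a. F (\<sigma> (u n) a))) \<longlonglongrightarrow> to_L2 (\<lambda>a. F (\<sigma> y a))"
      by (rule LIM_zero_cancel[OF tendsto_norm_zero_cancel])
  qed
qed

end


section \<open>Entire series of dominated functions\<close>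

lemma scaleC_zero_left: "0 *\<^sub>C (x::'a::complex_normed_vector) = 0"
  using norm_scaleC[of 0 x] by simp

lemma scaleC_minus1_left: "(-1) *\<^sub>C (x::'a::complex_normed_vector) = - x"
  using scaleR_eq_scaleC[of "-1" x] by simp

context decaying_weights
begin

lemma dominated_diff: "dominated F C \<Longrightarrow> dominated G D \<Longrightarrow> dominated (\<lambda>x. F x - G x) (C + D)"
  using dominated_add[of F C "\<lambda>x. -1 * G x" D] dominated_cmult[of G D "-1"] by simp

lemma dominated_le:
  assumes "dominated F C" shows "cmod (F x) \<le> C * bound ^ card I"
proof -
  have "cmod (F x) \<le> C * weight I x" "0 \<le> C" using assms by (auto simp: dominated_def)
  moreover have "C * weight I x \<le> C * bound ^ card I"
    using calculation(2) weight_le[of I x] by (intro mult_left_mono) auto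
  ultimately show ?thesis by linarith
qed

text \<open>\<open>\<beta> n R\<close> bounds the n-th term on the disk of radius \<open>R\<close>;
  disks suffice because every compact parameter set lies in one.\<close>

context
  fixes b :: "complex \<Rightarrow> nat \<Rightarrow> ('i \<Rightarrow> real) \<Rightarrow> complex" and \<beta> :: "nat \<Rightarrow> real \<Rightarrow> real"
  assumes b: "\<And>z n R. cmod z \<le> R \<Longrightarrow> dominated (b z n) (\<beta> n R)"
    and \<beta>: "\<And>R. 0 \<le> R \<Longrightarrow> summable (\<lambda>n. \<beta> n R)"
    and hol: "\<And>n x. (\<lambda>z. b z n x) holomorphic_on UNIV"
begin

abbreviation (input) d :: "complex \<Rightarrow> ('i \<Rightarrow> real) \<Rightarrow> complex"
  where "d z x \<equiv> (\<Sum>n. b z n x)"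

lemma \<beta>_nonneg: "0 \<le> R \<Longrightarrow> 0 \<le> \<beta> n R"
  using b[of 0 R n] by (simp add: dominated_def)

lemma b_le: "cmod z \<le> R \<Longrightarrow> cmod (b z n x) \<le> \<beta> n R * weight I x"
  using b by (simp add: dominated_def)

lemma summable_b: "summable (\<lambda>n. b z n x)"
proof (rule summable_comparison_test')
  show "summable (\<lambda>n. \<beta> n (cmod z) * weight I x)" by (intro summable_mult2 \<beta>) simp
  show "norm (b z n x) \<le> \<beta> n (cmod z) * weight I x" for n by (rule b_le) simp
qed

lemma dominated_partial_sum: "dominated (\<lambda>x. \<Sum>n<N. b z n x) (\<Sum>n<N. \<beta> n (cmod z))"
proof (induction N)
  case 0
  show ?case by (simp add: dominated_def weight_ge_0)
next
  case (Suc N)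
  show ?case using dominated_add[OF Suc b[OF order_refl, of z N]] by simp
qed

text \<open>Tails cover two needs: \<open>N = 0\<close> is the bound for the sum itself, growing
  \<open>N\<close> its convergence in the dominated norm.\<close>

lemma dominated_tail:
  assumes R: "cmod z \<le> R"
  shows "dominated (\<lambda>x. d z x - (\<Sum>n<N. b z n x)) (\<Sum>n. \<beta> (n + N) R)"
  unfolding dominated_def
proof (intro conjI allI)
  have R0: "0 \<le> R" using R norm_ge_zero order_trans by blast
  have sum: "summable (\<lambda>n. \<beta> (n + N) R)" by (rule summable_ignore_initial_segment[OF \<beta>[OF R0]])
  have "uniform_limit UNIV (\<lambda>m x. \<Sum>n<m. b z n x) (d z) sequentially"
  proof (rule Weierstrass_m_test)
    show "norm (b z n x) \<le> \<beta> n R * bound ^ card I" for n x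
      by (rule dominated_le[OF b[OF R]])
    show "summable (\<lambda>n. \<beta> n R * bound ^ card I)" by (intro summable_mult2 \<beta> R0)
  qed
  moreover have "continuous_on UNIV (\<lambda>x. \<Sum>n<m. b z n x)" for m
    using dominated_partial_sum by (simp add: dominated_def)
  ultimately have "continuous_on UNIV (d z)"
    by (intro uniform_limit_theorem[of _ "\<lambda>m x. \<Sum>n<m. b z n x" sequentially]) auto
  then show "continuous_on UNIV (\<lambda>x. d z x - (\<Sum>n<N. b z n x))"
    using dominated_partial_sum[where z = z and N = N] by (intro continuous_on_diff) (auto simp: dominated_def)
  show "0 \<le> (\<Sum>n. \<beta> (n + N) R)" using sum \<beta>_nonneg[OF R0] by (intro suminf_nonneg)
  show "cmod (d z x - (\<Sum>n<N. b z n x)) \<le> (\<Sum>n. \<beta> (n + N) R) * weight I x" for x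
  proof -
    have "d z x - (\<Sum>n<N. b z n x) = (\<Sum>n. b z (n + N) x)"
      by (rule suminf_minus_initial_segment[symmetric, OF summable_b])
    also have "cmod \<dots> \<le> (\<Sum>n. \<beta> (n + N) R * weight I x)"
      by (rule norm_suminf_le) (use b_le[OF R] sum in \<open>auto intro: summable_mult2\<close>)
    also have "\<dots> = (\<Sum>n. \<beta> (n + N) R) * weight I x" by (rule suminf_mult2[symmetric, OF sum])
    finally show ?thesis .
  qed
qed

lemma dominated_series: "cmod z \<le> R \<Longrightarrow> dominated (d z) (\<Sum>n. \<beta> n R)"
  using dominated_tail[of z R 0] by simp

lemma holomorphic_series: "(\<lambda>z. d z x) holomorphic_on UNIV"
proof (rule holomorphic_uniform_sequence[OF open_UNIV])
  show "(\<lambda>z. \<Sum>n<N. b z n x) holomorphic_on UNIV" for N by (intro holomorphic_intros hol)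
  show "\<exists>e>0. cball z e \<subseteq> UNIV \<and> uniform_limit (cball z e) (\<lambda>N z. \<Sum>n<N. b z n x) (\<lambda>z. d z x) sequentially"
    for z
  proof (intro exI[of _ 1] conjI)
    show "uniform_limit (cball z 1) (\<lambda>N z. \<Sum>n<N. b z n x) (\<lambda>z. d z x) sequentially"
    proof (rule Weierstrass_m_test)
      show "norm (b u n x) \<le> \<beta> n (cmod z + 1) * weight I x" if "u \<in> cball z 1" for n u
        using that norm_triangle_ineq2[of u z]
        by (intro b_le) (simp add: dist_norm norm_minus_commute)
      show "summable (\<lambda>n. \<beta> n (cmod z + 1) * weight I x)" by (intro summable_mult2 \<beta>) simp
    qed
  qed auto
qed

text \<open>At each \<open>x\<close> Cauchy's estimates hold with a bound proportional to
  \<open>weight I x\<close>, which is a bound in the dominated norm. Continuity of the derivative in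
  \<open>x\<close> comes from difference quotients along \<open>z + 1 / (m + 1)\<close>, which
  converge uniformly in \<open>x\<close>.\<close>

lemma series_difference_quotient:
  fixes z :: complex
  defines "B \<equiv> (\<Sum>n. \<beta> n (cmod z + 2))"
  shows "w \<noteq> z \<Longrightarrow> cmod (w - z) \<le> 1 \<Longrightarrow>
      dominated (\<lambda>x. inverse (w - z) * (d w x - d z x) - deriv (\<lambda>z. d z x) z) (2 * B * cmod (w - z))"
    and "dominated (\<lambda>x. deriv (\<lambda>z. d z x) z) B"
proof -
  have B0: "0 \<le> B" and "\<And>u. cmod u \<le> cmod z + 2 \<Longrightarrow> dominated (d u) B"
    using dominated_series[of 0 "cmod z + 2"] dominated_series by (auto simp: B_def dominated_def)
  then have dB: "cmod u \<le> cmod z + 2 \<Longrightarrow> cmod (d u x) \<le> B * weight I x" for u x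
    by (auto simp: dominated_def)
  have quot: "cmod (inverse (w - z) * (d w x - d z x) - deriv (\<lambda>z. d z x) z) \<le> 2 * B * cmod (w - z) * weight I x"
    if "w \<noteq> z" "cmod (w - z) \<le> 1" for w x
    using Cauchy_difference_quotient(2)[OF holomorphic_series dB order_refl that] by (simp add: mult_ac)
  have contd: "continuous_on UNIV (d w)" for w
    using dominated_series[OF order_refl] by (simp add: dominated_def)
  have cont: "continuous_on UNIV (\<lambda>x. deriv (\<lambda>z. d z x) z)"
  proof (rule uniform_limit_theorem)
    let ?w = "\<lambda>m. z + complex_of_real (inverse (real (Suc m)))"
    let ?q = "\<lambda>m x. inverse (?w m - z) * (d (?w m) x - d z x)"
    show "\<forall>\<^sub>F m in sequentially. continuous_on UNIV (?q m)"
      by (intro always_eventually allI continuous_intros contd)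
    show "uniform_limit UNIV ?q (\<lambda>x. deriv (\<lambda>z. d z x) z) sequentially"
    proof (rule uniform_limitI)
      fix e :: real assume e: "0 < e"
      let ?K = "2 * B * bound ^ card I"
      have "(\<lambda>m. ?K * inverse (real (Suc m))) \<longlonglongrightarrow> ?K * 0"
        by (intro tendsto_intros LIMSEQ_inverse_real_of_nat)
      then have "\<forall>\<^sub>F m in sequentially. ?K * inverse (real (Suc m)) < e"
        using e by (intro order_tendstoD(2)) auto
      then show "\<forall>\<^sub>F m in sequentially. \<forall>x\<in>UNIV. dist (?q m x) (deriv (\<lambda>z. d z x) z) < e"
      proof eventually_elim
        case (elim m)
        show ?case
        proof
          fix x
          have nm: "cmod (?w m - z) = inverse (real (Suc m))"
            by (simp only: add_diff_cancel_left' norm_of_real) simp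
          have "inverse (real (Suc m)) \<le> 1" by (simp add: inverse_le_1_iff)
          then have "cmod (?q m x - deriv (\<lambda>z. d z x) z) \<le> 2 * B * inverse (real (Suc m)) * weight I x"
            using quot[of "?w m" x, unfolded nm] by (auto simp del: of_nat_Suc of_real_inverse)
          also have "\<dots> \<le> 2 * B * inverse (real (Suc m)) * bound ^ card I"
            using B0 by (intro mult_left_mono weight_le) auto
          also have "\<dots> < e" using elim by (simp add: mult_ac)
          finally show "dist (?q m x) (deriv (\<lambda>z. d z x) z) < e" by (simp only: dist_norm)
        qed
      qed
    qed
  qed simp
  show "dominated (\<lambda>x. deriv (\<lambda>z. d z x) z) B"
    unfolding dominated_def
    using B0 cont Cauchy_difference_quotient(1)[OF holomorphic_series dB order_refl] by auto
  show "dominated (\<lambda>x. inverse (w - z) * (d w x - d z x) - deriv (\<lambda>z. d z x) z) (2 * B * cmod (w - z))"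
    if "w \<noteq> z" "cmod (w - z) \<le> 1"
    unfolding dominated_def using B0 quot[OF that]
    by (auto intro!: continuous_on_diff continuous_on_mult continuous_on_const contd cont)
qed

text \<open>\<open>V\<close> is a bounded linear map with constant \<open>K\<close> from dominated
  functions to the target space, and carries over normal convergence, sum and derivative. Linearity
  is asked on dominated arguments only, since \<open>to_L2\<close> is meaningful only on square
  integrable functions.\<close>

lemma entire_series_view:
  fixes V :: "(('i \<Rightarrow> real) \<Rightarrow> complex) \<Rightarrow> 'x \<Rightarrow> 'b::complex_normed_vector"
  assumes V_C0: "\<And>F C. dominated F C \<Longrightarrow> V F \<in> C0 X"
    and V_norm: "\<And>F C. dominated F C \<Longrightarrow> C0_norm X (V F) \<le> ennreal (C * K)"
    and V_add: "\<And>F G C D y. dominated F C \<Longrightarrow> dominated G D \<Longrightarrow> V (\<lambda>x. F x + G x) y = V F y + V G y"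
    and V_cmult: "\<And>F C c y. dominated F C \<Longrightarrow> V (\<lambda>x. c * F x) y = c *\<^sub>C V F y"
    and K: "0 \<le> K"
  shows "entire_series X (\<lambda>z n. V (b z n)) (\<lambda>z. V (d z))"
proof -
  have V_diff: "V (\<lambda>x. F x - G x) y = V F y - V G y" if "dominated F C" "dominated G D" for F G C D y
    using V_add[OF that(1) dominated_cmult[OF that(2), of "-1"]] V_cmult[OF that(2), of "-1"]
    by (simp add: scaleC_minus1_left)
  have V_sum: "V (\<lambda>x. \<Sum>n<N. b z n x) y = (\<Sum>n<N. V (b z n) y)" for z N y
  proof (induction N)
    case 0
    have "dominated (\<lambda>x. 0) 0" by (simp add: dominated_def)
    from V_cmult[OF this, of 0 y] show ?case by (simp add: scaleC_zero_left)
  next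
    case (Suc N)
    show ?case
      using V_add[OF dominated_partial_sum[where N = N and z = z] b[OF order_refl, of z N], of y] Suc by simp
  qed
  have "(\<Sum>n. SUP z\<in>Z. C0_norm X (V (b z n))) < \<infinity>" if "compact Z" for Z
  proof -
    obtain R where "\<forall>z\<in>Z. cmod z \<le> R" using compact_imp_bounded[OF \<open>compact Z\<close>] unfolding bounded_iff by blast
    \<comment> \<open>For empty \<open>Z\<close> the bound \<open>R\<close> may be negative, whereas
      summability of the majorants is given for nonnegative radii.\<close>
    then have R: "\<And>z. z \<in> Z \<Longrightarrow> cmod z \<le> max R 0" by auto
    have "(\<Sum>n. SUP z\<in>Z. C0_norm X (V (b z n))) \<le> (\<Sum>n. ennreal (\<beta> n (max R 0) * K))"
      by (intro suminf_le summableI SUP_least V_norm b R)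
    also have "\<dots> = ennreal (\<Sum>n. \<beta> n (max R 0) * K)"
      by (intro suminf_ennreal2 mult_nonneg_nonneg \<beta>_nonneg K summable_mult2 \<beta>) auto
    also have "\<dots> < \<infinity>" by simp
    finally show ?thesis .
  qed
  moreover have "(\<lambda>N. C0_norm X (\<lambda>y. (\<Sum>n<N. V (b z n) y) - V (d z) y)) \<longlonglongrightarrow> 0" for z
  proof -
    let ?t = "\<lambda>N. \<Sum>n. \<beta> (n + N) (cmod z)"
    have "?t = (\<lambda>N. (\<Sum>n. \<beta> n (cmod z)) - (\<Sum>n<N. \<beta> n (cmod z)))"
      by (intro ext suminf_minus_initial_segment \<beta>) simp
    moreover have "\<dots> \<longlonglongrightarrow> (\<Sum>n. \<beta> n (cmod z)) - (\<Sum>n. \<beta> n (cmod z))"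
      by (intro tendsto_intros summable_LIMSEQ \<beta>) simp
    ultimately have "(\<lambda>N. ?t N * K) \<longlonglongrightarrow> 0 * K" by (intro tendsto_mult_right) simp
    then have lim: "(\<lambda>N. ennreal (?t N * K)) \<longlonglongrightarrow> 0"
      using tendsto_ennrealI by fastforce
    have "C0_norm X (\<lambda>y. (\<Sum>n<N. V (b z n) y) - V (d z) y) \<le> ennreal (?t N * K)" for N
    proof -
      have "dominated (\<lambda>x. (\<Sum>n<N. b z n x) - d z x) (?t N)"
        using dominated_cmult[OF dominated_tail[OF order_refl, of z N], of "-1"] by simp
      moreover have "V (\<lambda>x. (\<Sum>n<N. b z n x) - d z x) = (\<lambda>y. (\<Sum>n<N. V (b z n) y) - V (d z) y)"
        by (rule ext) (simp only: V_diff[OF dominated_partial_sum dominated_series[OF order_refl]] V_sum)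
      ultimately show ?thesis using V_norm by metis
    qed
    then show ?thesis by (intro tendsto_sandwich[OF _ _ tendsto_const lim]) auto
  qed
  moreover have "entire_C0 X (\<lambda>z. V (d z))"
    unfolding entire_C0_def
  proof (intro conjI allI)
    show "V (d z) \<in> C0 X" for z by (rule V_C0[OF dominated_series[OF order_refl]])
    fix z
    define d' where "d' x = deriv (\<lambda>z. d z x) z" for x
    define B where "B = (\<Sum>n. \<beta> n (cmod z + 2))"
    note quot = series_difference_quotient[where z = z, folded d'_def B_def]
    have "((\<lambda>w. C0_norm X (\<lambda>y. inverse (w - z) *\<^sub>C (V (d w) y - V (d z) y) - V d' y)) \<longlongrightarrow> 0) (at z)"
    proof (rule tendsto_sandwich[OF _ _ tendsto_const])
      have "((\<lambda>w. 2 * B * cmod (w - z) * K) \<longlongrightarrow> 2 * B * cmod (z - z) * K) (at z)"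
        by (intro tendsto_intros)
      then show "((\<lambda>w. ennreal (2 * B * cmod (w - z) * K)) \<longlongrightarrow> 0) (at z)"
        using tendsto_ennrealI by fastforce
      have "\<forall>\<^sub>F w in at z. w \<noteq> z \<and> cmod (w - z) \<le> 1"
        unfolding eventually_at by (rule exI[of _ 1]) (simp add: dist_norm)
      then show "\<forall>\<^sub>F w in at z. C0_norm X (\<lambda>y. inverse (w - z) *\<^sub>C (V (d w) y - V (d z) y) - V d' y)
          \<le> ennreal (2 * B * cmod (w - z) * K)"
      proof eventually_elim
        case (elim w)
        have dd: "dominated (\<lambda>x. d w x - d z x) ((\<Sum>n. \<beta> n (cmod w)) + (\<Sum>n. \<beta> n (cmod z)))"
          by (intro dominated_diff dominated_series order_refl)
        have "V (\<lambda>x. inverse (w - z) * (d w x - d z x) - d' x) y =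
            inverse (w - z) *\<^sub>C (V (d w) y - V (d z) y) - V d' y" for y
          unfolding V_diff[OF dominated_cmult[OF dd] quot(2)] V_cmult[OF dd]
          by (simp only: V_diff[OF dominated_series[OF order_refl] dominated_series[OF order_refl]])
        then have "V (\<lambda>x. inverse (w - z) * (d w x - d z x) - d' x) =
            (\<lambda>y. inverse (w - z) *\<^sub>C (V (d w) y - V (d z) y) - V d' y)"
          by (rule ext)
        moreover have "C0_norm X (V (\<lambda>x. inverse (w - z) * (d w x - d z x) - d' x)) \<le> ennreal (2 * B * cmod (w - z) * K)"
          by (rule V_norm[OF quot(1)]) (use elim in auto)
        ultimately show ?case by (simp only:)
      qed
    qed simp
    then show "\<exists>F'\<in>C0 X. ((\<lambda>w. C0_norm X (\<lambda>y. inverse (w - z) *\<^sub>C (V (d w) y - V (d z) y) - F' y)) \<longlongrightarrow> 0) (at z)"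
      using V_C0[OF quot(2)] by blast
  qed
  ultimately show ?thesis
    unfolding entire_series_def using V_C0[OF b[OF order_refl]] by blast
qed

lemma entire_series_weighted: "entire_series (powertop_real I) b d"
  by (rule entire_series_view[where V = "\<lambda>F. F" and K = "bound ^ card I"])
    (use bound(1) in \<open>auto simp: dominated_def scaleC_complex_def intro!: weighted_in_C0\<close>)

lemma entire_series_L2_view:
  fixes \<sigma> :: "('i \<Rightarrow> real) \<Rightarrow> 'a::euclidean_space \<Rightarrow> ('i \<Rightarrow> real)"
  assumes \<sigma>: "\<And>a. continuous_on UNIV (\<lambda>y. \<sigma> y a)" "\<And>y. continuous_on UNIV (\<sigma> y)"
    and W: "\<And>y a. weight I (\<sigma> y a) = weight J y * g a" and J: "J \<subseteq> I"
    and g: "g \<in> borel_measurable borel" "\<And>a. 0 \<le> g a" "integrable lborel (\<lambda>a. (g a)\<^sup>2)"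
  shows "entire_series_L2 (powertop_real J) (\<lambda>z n y a. b z n (\<sigma> y a)) (\<lambda>z y a. d z (\<sigma> y a))"
proof -
  note view = L2_view[OF _ \<sigma> W J g]
  define V where "V F y = to_L2 (\<lambda>a. F (\<sigma> y a))" for F :: "('i \<Rightarrow> real) \<Rightarrow> complex" and y
  have G: "0 \<le> sqrt (LINT a|lborel. (g a)\<^sup>2)" by simp
  have V_C0: "V F \<in> C0 (powertop_real J)"
      "C0_norm (powertop_real J) (V F) \<le> ennreal (C * (sqrt (LINT a|lborel. (g a)\<^sup>2) * bound ^ card I))"
    if "dominated F C" for F C
  proof -
    have C: "0 \<le> C" using that by (simp add: dominated_def)
    note * = weighted_in_C0[OF _ _ J mult_nonneg_nonneg[OF C G], of "V F"]
    show "V F \<in> C0 (powertop_real J)"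
      using view(2,3)[OF that] unfolding V_def by (intro *(1)[unfolded V_def]) auto
    show "C0_norm (powertop_real J) (V F) \<le> ennreal (C * (sqrt (LINT a|lborel. (g a)\<^sup>2) * bound ^ card I))"
      using view(2,3)[OF that] unfolding V_def mult.assoc[symmetric] by (intro *(2)[unfolded V_def]) auto
  qed
  have "entire_series (powertop_real J) (\<lambda>z n. V (b z n)) (\<lambda>z. V (d z))"
  proof (rule entire_series_view[OF V_C0])
    show "V (\<lambda>x. F x + G x) y = V F y + V G y" if "dominated F C" "dominated G D" for F G C D y
      unfolding V_def using view(1)[OF that(1)] view(1)[OF that(2)] by (rule to_L2_add)
    show "V (\<lambda>x. c * F x) y = c *\<^sub>C V F y" if "dominated F C" for F C c y
      unfolding V_def using view(1)[OF that] by (rule to_L2_scaleC)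
    show "0 \<le> sqrt (LINT a|lborel. (g a)\<^sup>2) * bound ^ card I"
      using bound(1) by simp
  qed assumption+
  moreover have "(\<lambda>y a. F (\<sigma> y a)) \<in> C0_L2 (powertop_real J)" if "dominated F C" for F C
    using view(1)[OF that] V_C0(1)[OF that] by (simp add: C0_L2_def V_def[abs_def])
  ultimately show ?thesis
    unfolding entire_series_L2_def V_def[abs_def]
    using b[OF order_refl] dominated_series[OF order_refl] by blast
qed

section \<open>Views with one or two singled-out variables\<close>

lemma continuous_on_fun_upd:
  "continuous_on UNIV y \<Longrightarrow> continuous_on UNIV a \<Longrightarrow> continuous_on UNIV (\<lambda>t. (y t)(v := a t))"
  for y :: "'t::topological_space \<Rightarrow> 'i \<Rightarrow> real"
proof (rule continuous_on_coordinatewise_then_product)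
  fix i assume "continuous_on UNIV y" "continuous_on UNIV a"
  then show "continuous_on UNIV (\<lambda>t. ((y t)(v := a t)) i)"
    using continuous_on_product_then_coordinatewise[of UNIV y i] by (cases "i = v") auto
qed

lemma weight_fun_upd:
  assumes "v \<in> J" "J \<subseteq> I"
  shows "weight J (y(v := a)) = weight (J - {v}) y * \<omega> v a"
proof -
  have "weight J (y(v := a)) = \<omega> v a * weight (J - {v}) (y(v := a))"
    unfolding weight_def using assms finite_subset[OF _ finite_I] by (subst prod.remove[of _ v]) auto
  moreover have "weight (J - {v}) (y(v := a)) = weight (J - {v}) y"
    unfolding weight_def by (intro prod.cong) auto
  ultimately show ?thesis by (simp only: mult.commute)
qed

lemma weight_measurable [measurable]: "\<omega> u \<in> borel_measurable borel"
  by (rule borel_measurable_continuous_onI[OF weight_cont])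

lemma entire_series_view1:
  assumes "v \<in> I"
  shows "entire_series_L2 (powertop_real (I - {v})) (\<lambda>z n. view1 v (b z n)) (\<lambda>z. view1 v (d z))"
  unfolding view1_def
proof (rule entire_series_L2_view[where \<sigma> = "\<lambda>y a. y(v := a)" and g = "\<omega> v"])
  show "continuous_on UNIV (\<lambda>y :: 'i \<Rightarrow> real. y(v := a))" for a
    by (intro continuous_on_fun_upd continuous_on_id continuous_on_const)
  show "continuous_on UNIV (\<lambda>a. y(v := a))" for y :: "'i \<Rightarrow> real"
    by (intro continuous_on_fun_upd continuous_on_id continuous_on_const)
qed (use assms in \<open>auto intro: weight_fun_upd weight_nonneg weight_L2\<close>)

lemma entire_series_view2:
  assumes v: "v \<in> I" and w: "w \<in> I" and "v \<noteq> w"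
  shows "entire_series_L2 (powertop_real (I - {v, w})) (\<lambda>z n. view2 v w (b z n)) (\<lambda>z. view2 v w (d z))"
proof -
  define g where "g p = \<omega> v (fst p) * \<omega> w (snd p)" for p
  have "integrable (lborel \<Otimes>\<^sub>M lborel) (\<lambda>p. (g p)\<^sup>2)"
  proof (rule lborel_pair.Fubini_integrable)
    show "(\<lambda>p. (g p)\<^sup>2) \<in> borel_measurable (lborel \<Otimes>\<^sub>M lborel)" unfolding g_def by measurable
    show "AE x in lborel. integrable lborel (\<lambda>y. (g (x, y))\<^sup>2)"
      using weight_L2[of w] by (simp add: g_def power_mult_distrib)
    have "(LBINT y. norm ((g (x, y))\<^sup>2)) = (\<omega> v x)\<^sup>2 * (LBINT y. (\<omega> w y)\<^sup>2)" for x
      by (simp add: g_def power_mult_distrib)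
    then show "integrable lborel (\<lambda>x. LBINT y. norm ((g (x, y))\<^sup>2))"
      using weight_L2[of v] by simp
  qed
  then have g2: "integrable lborel (\<lambda>p. (g p)\<^sup>2)" by (simp add: lborel_prod)
  have "entire_series_L2 (powertop_real (I - {v, w})) (\<lambda>z n y p. b z n (y(v := fst p, w := snd p)))
      (\<lambda>z y p. d z (y(v := fst p, w := snd p)))"
  proof (rule entire_series_L2_view[where \<sigma> = "\<lambda>y p. y(v := fst p, w := snd p)" and g = g])
    have eq: "I - {w} - {v} = I - {v, w}" by auto
    show "weight I (y(v := fst p, w := snd p)) = weight (I - {v, w}) y * g p" for y p
      using assms by (simp add: weight_fun_upd g_def eq mult.assoc)
    show "g \<in> borel_measurable borel" unfolding g_def[abs_def] borel_prod[symmetric] by measurable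
    show "continuous_on UNIV (\<lambda>y :: 'i \<Rightarrow> real. y(v := fst p, w := snd p))" for p :: "real \<times> real"
      by (intro continuous_on_fun_upd continuous_on_id continuous_on_const)
    show "continuous_on UNIV (\<lambda>p. y(v := fst p, w := snd p))" for y :: "'i \<Rightarrow> real"
      by (intro continuous_on_fun_upd continuous_on_fst continuous_on_snd continuous_on_id continuous_on_const)
  qed (use g2 weight_nonneg in \<open>auto simp: g_def\<close>)
  moreover have "view2 v w F = (\<lambda>y p. F (y(v := fst p, w := snd p)))" for F :: "('i \<Rightarrow> real) \<Rightarrow> complex"
    by (simp add: view2_def fun_eq_iff)
  ultimately show ?thesis by (simp only:)
qed

end

end


section \<open>Integrals of Fredholm determinants\<close>

lemma integrable_norm_boundI:
  fixes f :: "'a \<Rightarrow> 'b::{banach, second_countable_topology}" and g :: "'a \<Rightarrow> real"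
  assumes "integrable M g" "f \<in> borel_measurable M" "\<And>x. norm (f x) \<le> g x"
  shows "integrable M f"
  by (rule Bochner_Integration.integrable_bound[OF assms(1,2)])
    (rule AE_I2, rule order_trans[OF assms(3)], simp)

text \<open>An integrable majorant on the disk of radius \<open>|z| + 2\<close> controls the
  difference quotients through Cauchy's estimates, so that integral and derivative may be exchanged
  with an error linear in \<open>|w - z|\<close>.\<close>

lemma holomorphic_on_LINT:
  fixes f :: "complex \<Rightarrow> 'a \<Rightarrow> complex"
  assumes hol: "\<And>\<xi>. (\<lambda>z. f z \<xi>) holomorphic_on UNIV"
    and [measurable]: "\<And>z. f z \<in> borel_measurable M"
    and bound: "\<And>R. \<exists>g. integrable M g \<and> (\<forall>z \<xi>. cmod z \<le> R \<longrightarrow> cmod (f z \<xi>) \<le> g \<xi>)"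
  shows "(\<lambda>z. LINT \<xi>|M. f z \<xi>) holomorphic_on UNIV"
proof -
  have int: "integrable M (f z)" for z
  proof -
    obtain g where "integrable M g" "f z \<in> borel_measurable M" "\<And>\<xi>. cmod (f z \<xi>) \<le> g \<xi>" using bound[of "cmod z"] by auto
    then show ?thesis by (rule integrable_norm_boundI)
  qed
  have "((\<lambda>z. LINT \<xi>|M. f z \<xi>) has_field_derivative (LINT \<xi>|M. deriv (\<lambda>z. f z \<xi>) z)) (at z)" for z
  proof -
    obtain g where g: "integrable M g" and fg: "\<And>u \<xi>. cmod u \<le> cmod z + 2 \<Longrightarrow> cmod (f u \<xi>) \<le> g \<xi>"
      using bound[of "cmod z + 2"] by auto
    note quot = Cauchy_difference_quotient[OF hol fg order_refl]
    have [measurable]: "(\<lambda>\<xi>. deriv (\<lambda>z. f z \<xi>) z) \<in> borel_measurable M"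
    proof (rule borel_measurable_LIMSEQ_metric)
      let ?w = "\<lambda>m. z + complex_of_real (inverse (real (Suc m)))"
      show "(\<lambda>\<xi>. (f (?w m) \<xi> - f z \<xi>) / (?w m - z)) \<in> borel_measurable M" for m
        by measurable
      show "(\<lambda>m. (f (?w m) \<xi> - f z \<xi>) / (?w m - z)) \<longlonglongrightarrow> deriv (\<lambda>z. f z \<xi>) z" for \<xi>
      proof -
        have "((\<lambda>w. (f w \<xi> - f z \<xi>) / (w - z)) \<longlongrightarrow> deriv (\<lambda>z. f z \<xi>) z) (at z)"
          using holomorphic_derivI[OF hol open_UNIV UNIV_I] unfolding has_field_derivative_iff .
        moreover have "filterlim ?w (at z) sequentially"
        proof (rule filterlim_atI)
          have "?w \<longlonglongrightarrow> z + of_real 0"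
            by (intro tendsto_intros LIMSEQ_inverse_real_of_nat)
          then show "?w \<longlonglongrightarrow> z" by simp
          show "\<forall>\<^sub>F m in sequentially. ?w m \<noteq> z" by (auto simp del: of_nat_Suc of_real_inverse)
        qed
        ultimately show ?thesis by (rule filterlim_compose)
      qed
    qed
    have intd: "integrable M (\<lambda>\<xi>. deriv (\<lambda>z. f z \<xi>) z)"
      by (rule integrable_norm_boundI[OF g]) (use quot(1) in auto)
    let ?I = "\<lambda>w. LINT \<xi>|M. f w \<xi>" and ?D = "LINT \<xi>|M. deriv (\<lambda>z. f z \<xi>) z"
    have "((\<lambda>w. (?I w - ?I z) / (w - z) - ?D) \<longlongrightarrow> 0) (at z)"
    proof (rule Lim_null_comparison)
      have "\<forall>\<^sub>F w in at z. w \<noteq> z \<and> cmod (w - z) \<le> 1"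
        unfolding eventually_at by (rule exI[of _ 1]) (simp add: dist_norm)
      then show "\<forall>\<^sub>F w in at z. norm ((?I w - ?I z) / (w - z) - ?D) \<le> 2 * cmod (w - z) * (LINT \<xi>|M. g \<xi>)"
      proof eventually_elim
        case (elim w)
        have "(?I w - ?I z) / (w - z) - ?D =
            (LINT \<xi>|M. inverse (w - z) * (f w \<xi> - f z \<xi>) - deriv (\<lambda>z. f z \<xi>) z)"
          using int intd by (simp add: divide_inverse mult.commute)
        also have "norm \<dots> \<le> (LINT \<xi>|M. norm (inverse (w - z) * (f w \<xi> - f z \<xi>) - deriv (\<lambda>z. f z \<xi>) z))"
          by (rule integral_norm_bound)
        also have "\<dots> \<le> (LINT \<xi>|M. 2 * cmod (w - z) * g \<xi>)"
        proof (rule integral_mono)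
          show "integrable M (\<lambda>\<xi>. norm (inverse (w - z) * (f w \<xi> - f z \<xi>) - deriv (\<lambda>z. f z \<xi>) z))"
            using int intd by simp
          show "norm (inverse (w - z) * (f w \<xi> - f z \<xi>) - deriv (\<lambda>z. f z \<xi>) z) \<le> 2 * cmod (w - z) * g \<xi>" for \<xi>
          proof -
            have "cmod (inverse (w - z) * (f w \<xi> - f z \<xi>) - deriv (\<lambda>z. f z \<xi>) z) \<le> 2 * g \<xi> * cmod (w - z)"
              by (rule quot(2)) (use elim in auto)
            then show ?thesis by (simp add: mult_ac)
          qed
        qed (use g in simp)
        also have "\<dots> = 2 * cmod (w - z) * (LINT \<xi>|M. g \<xi>)" by simp
        finally show ?case .
      qed
      have "((\<lambda>w. 2 * cmod (w - z) * (LINT \<xi>|M. g \<xi>)) \<longlongrightarrow> 2 * cmod (z - z) * (LINT \<xi>|M. g \<xi>)) (at z)"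
        by (intro tendsto_intros)
      then show "((\<lambda>w. 2 * cmod (w - z) * (LINT \<xi>|M. g \<xi>)) \<longlongrightarrow> 0) (at z)" by simp
    qed
    then show ?thesis unfolding has_field_derivative_iff by (rule LIM_zero_cancel)
  qed
  then show ?thesis by (auto simp: holomorphic_on_open)
qed

lemma power_div_fact_le_exp: "0 \<le> x \<Longrightarrow> x ^ n / fact n \<le> exp (x::real)"
proof -
  assume x: "0 \<le> x"
  have "(\<Sum>i\<in>{n}. x ^ i /\<^sub>R fact i) \<le> (\<Sum>i. x ^ i /\<^sub>R fact i)"
    by (rule sum_le_suminf[OF summable_exp_generic]) (use x in auto)
  then show ?thesis by (simp add: exp_def divide_inverse mult.commute)
qed

text \<open>
  The Hadamard factor \<open>m\<^sup>m\<^sup>/\<^sup>2\<close> with \<open>m = p + n\<close> is at most \<open>\<surd>(e\<^sup>m m!)\<close>, which is beaten by \<open>n!\<close>.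
\<close>

lemma summable_Hadamard_bound:
  fixes c g :: real
  assumes c: "0 \<le> c" and g: "0 \<le> g"
  shows "summable (\<lambda>n. sqrt (real (p + n) ^ (p + n)) * c ^ (p + n) * g ^ n / fact n)"
proof -
  \<comment> \<open>\<open>1 + g\<close> replaces \<open>g ^ n\<close> by an m-th power, and the
    factor 2 pays for \<open>fact m \<le> 2 ^ m * (fact p * fact n)\<close>.\<close>
  define K where "K = 2 * (c * (1 + g))"
  have K: "0 \<le> K" using c g by (simp add: K_def)
  \<comment> \<open>The square of the main term is at most
    \<open>(exp 1 * K\<^sup>2) ^ m / fact m\<close>; the 4 under the exponential buys
    \<open>(1 / 4) ^ m\<close>, whose root is the geometric factor.\<close>
  define E where "E = sqrt (exp (4 * exp 1 * K\<^sup>2))"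
  have le: "sqrt (real m ^ m) * c ^ m * g ^ n / fact n \<le> fact p * E * (1 / 2) ^ m" if m: "m = p + n" for m n
  proof -
    have choose: "fact m \<le> 2 ^ m * (fact p * fact n :: real)"
    proof -
      have "real (m choose p) \<le> real (2 ^ m)" using binomial_le_pow2 of_nat_le_iff by blast
      then have "real (m choose p) * (fact p * fact n) \<le> 2 ^ m * (fact p * fact n)"
        by (intro mult_right_mono) auto
      moreover have "real (m choose p) * (fact p * fact n) = fact m"
        using binomial_fact[of p m, where 'a = real] m by simp
      ultimately show ?thesis by simp
    qed
    have mm: "real m ^ m \<le> exp 1 ^ m * fact m"
      using power_div_fact_le_exp[of "real m" m]
      by (simp add: divide_le_eq exp_of_nat_mult[symmetric, where x = 1, simplified])
    have sq: "sqrt (real m ^ m) * K ^ m / fact m \<le> E * (1 / 2) ^ m"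
    proof (rule power2_le_imp_le)
      have "(sqrt (real m ^ m) * K ^ m / fact m)\<^sup>2 = real m ^ m * (K\<^sup>2) ^ m / (fact m)\<^sup>2"
        by (simp add: power_mult_distrib power_divide power_even_eq[symmetric] power_mult[symmetric] mult.commute)
      also have "\<dots> \<le> (exp 1 ^ m * fact m) * (K\<^sup>2) ^ m / (fact m)\<^sup>2"
        by (intro divide_right_mono mult_right_mono mm) auto
      also have "\<dots> = ((4 * exp 1 * K\<^sup>2) ^ m / fact m) * ((1 / 2) ^ m)\<^sup>2"
      proof -
        have "(4::real) ^ m * ((1 / 2) ^ m)\<^sup>2 = 1"
          by (simp add: power_mult[symmetric] power_even_eq mult.commute power_mult_distrib[symmetric]
              power2_eq_square flip: power_mult_distrib)
        then have "((4 * exp 1 * K\<^sup>2) ^ m / fact m) * ((1 / 2) ^ m)\<^sup>2 = (exp 1 * K\<^sup>2) ^ m / fact m"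
          by (simp add: power_mult_distrib mult.commute mult.left_commute)
        then show ?thesis by (simp add: power_mult_distrib power2_eq_square[of "fact m"])
      qed
      also have "\<dots> \<le> exp (4 * exp 1 * K\<^sup>2) * ((1 / 2) ^ m)\<^sup>2"
        by (intro mult_right_mono power_div_fact_le_exp) auto
      also have "\<dots> = (E * (1 / 2) ^ m)\<^sup>2" by (simp add: E_def power_mult_distrib)
      finally show "(sqrt (real m ^ m) * K ^ m / fact m)\<^sup>2 \<le> (E * (1 / 2) ^ m)\<^sup>2" .
      show "0 \<le> E * (1 / 2) ^ m" by (simp add: E_def)
    qed
    have "g ^ n \<le> (1 + g) ^ n" using g by (intro power_mono) auto
    also have "\<dots> \<le> (1 + g) ^ m" using g m by (intro power_increasing) auto
    finally have "sqrt (real m ^ m) * c ^ m * g ^ n / fact n \<le> sqrt (real m ^ m) * c ^ m * (1 + g) ^ m / fact n"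
      using c by (intro divide_right_mono mult_left_mono) auto
    also have "\<dots> \<le> sqrt (real m ^ m) * c ^ m * (1 + g) ^ m * (2 ^ m * fact p / fact m)"
    proof -
      have "1 / fact n \<le> 2 ^ m * fact p / (fact m :: real)"
        using choose by (simp add: divide_simps mult.commute mult.left_commute)
      then have "sqrt (real m ^ m) * c ^ m * (1 + g) ^ m * (1 / fact n) \<le>
          sqrt (real m ^ m) * c ^ m * (1 + g) ^ m * (2 ^ m * fact p / fact m)"
        using c g by (intro mult_left_mono) auto
      then show ?thesis by simp
    qed
    also have "\<dots> = fact p * (sqrt (real m ^ m) * K ^ m / fact m)"
    proof -
      have "K ^ m = 2 ^ m * (c ^ m * (1 + g) ^ m)" by (simp only: K_def power_mult_distrib)
      then show ?thesis by (simp add: mult_ac)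
    qed
    also have "\<dots> \<le> fact p * (E * (1 / 2) ^ m)" by (intro mult_left_mono sq) simp
    finally show ?thesis by (simp add: mult.assoc)
  qed
  have half: "summable (\<lambda>n. fact p * E * (1 / 2) ^ p * (1 / 2) ^ n :: real)"
    by (intro summable_mult summable_geometric) simp
  have eq: "fact p * E * (1 / 2) ^ (p + n) = fact p * E * (1 / 2) ^ p * (1 / 2) ^ n" for n
    by (simp add: power_add)
  show ?thesis
  proof (rule summable_comparison_test'[OF half, of 0])
    fix n
    have "0 \<le> sqrt (real (p + n) ^ (p + n)) * c ^ (p + n) * g ^ n / fact n" using c g by simp
    then show "norm (sqrt (real (p + n) ^ (p + n)) * c ^ (p + n) * g ^ n / fact n) \<le> fact p * E * (1 / 2) ^ p * (1 / 2) ^ n"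
      using le[OF refl, of n] unfolding eq by (simp only: real_norm_def abs_of_nonneg)
  qed
qed

section \<open>Determinants as functions of their arguments\<close>

lemma kernel_det_permutes:
  "kernel_det k \<nu> x y = (\<Sum>\<pi> | \<pi> permutes {0..<\<nu>}. signof \<pi> * (\<Prod>i = 0..<\<nu>. k (x i) (y (\<pi> i))))"
  unfolding kernel_det_def by (rule det_mat_permutes)

lemma kernel_det_cong:
  assumes "\<And>i. i < \<nu> \<Longrightarrow> x i = x' i" "\<And>i. i < \<nu> \<Longrightarrow> y i = y' i"
  shows "kernel_det k \<nu> x y = kernel_det k \<nu> x' y'"
  unfolding kernel_det_def using assms by (intro arg_cong[where f = Determinant.det] eq_matI) auto

lemma prod_lessThan_add: "(\<Prod>i<p + n. f i) = (\<Prod>i<p. f i) * (\<Prod>i<n. f (p + i))" for p n :: nat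
  by (induction n) (simp_all add: mult.assoc)

lemma measurable_kernel_det:
  assumes k: "continuous_on UNIV (\<lambda>(s, t). k s t)"
    and xy: "\<And>i. i < \<nu> \<Longrightarrow> (\<lambda>m. x m i) \<in> borel_measurable M" "\<And>i. i < \<nu> \<Longrightarrow> (\<lambda>m. y m i) \<in> borel_measurable M"
  shows "(\<lambda>m. kernel_det k \<nu> (x m) (y m)) \<in> borel_measurable M"
  unfolding kernel_det_permutes
proof (intro borel_measurable_sum borel_measurable_times borel_measurable_const borel_measurable_prod)
  fix \<pi> i assume \<pi>: "\<pi> \<in> {\<pi>. \<pi> permutes {0..<\<nu>}}" and i: "i \<in> {0..<\<nu>}"
  then have "\<pi> i < \<nu>" using permutes_in_image[of \<pi> "{0..<\<nu>}" i] by simp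
  then have "(\<lambda>m. (x m i, y m (\<pi> i))) \<in> M \<rightarrow>\<^sub>M borel \<Otimes>\<^sub>M borel" using i by (intro measurable_Pair xy) auto
  from measurable_compose[OF this[unfolded borel_prod] borel_measurable_continuous_onI[OF k]]
  show "(\<lambda>m. k (x m i) (y m (\<pi> i))) \<in> borel_measurable M" by simp
qed

lemma tendsto_kernel_det:
  assumes k: "continuous_on UNIV (\<lambda>(s, t). k s t)"
    and x: "\<And>i. i < \<nu> \<Longrightarrow> (\<lambda>m. x m i) \<longlonglongrightarrow> x' i" and y: "\<And>i. i < \<nu> \<Longrightarrow> (\<lambda>m. y m i) \<longlonglongrightarrow> y' i"
  shows "(\<lambda>m. kernel_det k \<nu> (x m) (y m)) \<longlonglongrightarrow> kernel_det k \<nu> x' y'"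
  unfolding kernel_det_permutes
proof (intro tendsto_sum tendsto_mult tendsto_const tendsto_prod)
  fix \<pi> i assume \<pi>: "\<pi> \<in> {\<pi>. \<pi> permutes {0..<\<nu>}}" and i: "i \<in> {0..<\<nu>}"
  then have "\<pi> i < \<nu>" using permutes_in_image[of \<pi> "{0..<\<nu>}" i] by simp
  then have "(\<lambda>m. (x m i, y m (\<pi> i))) \<longlonglongrightarrow> (x' i, y' (\<pi> i))"
    using i x y by (intro tendsto_Pair) auto
  from continuous_on_tendsto_compose[OF k this]
  show "(\<lambda>m. k (x m i) (y m (\<pi> i))) \<longlonglongrightarrow> k (x' i) (y' (\<pi> i))" by simp
qed

text \<open>\<open>fredholm_integrand\<close> numbers its integration variables from 0, but as
  coordinates of a (p + n)-fold integral they start at \<open>p\<close>. Product measures are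
  determined by their values on boxes.\<close>

lemma distr_PiM_shift:
  fixes p n :: nat
  shows "distr (PiM {..<n} (\<lambda>_. lborel)) (PiM {p..<p + n} (\<lambda>_. lborel)) (\<lambda>\<xi>. \<lambda>i\<in>{p..<p + n}. \<xi> (i - p))
    = PiM {p..<p + n} (\<lambda>_. lborel :: real measure)" (is "distr ?A ?B ?f = ?B")
proof -
  interpret product_sigma_finite "\<lambda>_. lborel :: real measure" by standard
  have f [measurable]: "?f \<in> measurable ?A ?B"
    by (rule measurable_restrict) (auto intro!: measurable_component_singleton)
  show ?thesis
  proof (rule PiM_eqI)
    fix A :: "nat \<Rightarrow> real set" assume A: "\<And>i. i \<in> {p..<p + n} \<Longrightarrow> A i \<in> sets lborel"
    then have mA: "PiE {p..<p + n} A \<in> sets ?B" by (intro sets_PiM_I_finite) auto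
    have "?f -` PiE {p..<p + n} A \<inter> space ?A = PiE {..<n} (\<lambda>i. A (p + i))"
    proof (intro equalityI subsetI)
      fix \<xi> assume \<xi>: "\<xi> \<in> ?f -` PiE {p..<p + n} A \<inter> space ?A"
      have "\<xi> i \<in> A (p + i)" if "i < n" for i
        using \<xi> that by (auto simp: PiE_iff dest!: bspec[of _ _ "p + i"])
      then show "\<xi> \<in> PiE {..<n} (\<lambda>i. A (p + i))" using \<xi> by (auto simp: space_PiM PiE_iff)
    next
      fix \<xi> assume \<xi>: "\<xi> \<in> PiE {..<n} (\<lambda>i. A (p + i))"
      have "\<xi> (i - p) \<in> A i" if "i \<in> {p..<p + n}" for i
        using PiE_mem[OF \<xi>, of "i - p"] that by auto
      then show "\<xi> \<in> ?f -` PiE {p..<p + n} A \<inter> space ?A" using \<xi> by (auto simp: space_PiM PiE_iff)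
    qed
    then have "emeasure (distr ?A ?B ?f) (PiE {p..<p + n} A) = emeasure ?A (PiE {..<n} (\<lambda>i. A (p + i)))"
      using mA by (simp add: emeasure_distr)
    also have "\<dots> = (\<Prod>i<n. emeasure lborel (A (p + i)))"
      using A by (intro emeasure_PiM) auto
    also have "\<dots> = (\<Prod>i = p..<p + n. emeasure lborel (A i))"
      by (rule prod.reindex_bij_witness[of _ "\<lambda>i. i - p" "\<lambda>i. p + i"]) auto
    finally show "emeasure (distr ?A ?B ?f) (PiE {p..<p + n} A) = (\<Prod>i = p..<p + n. emeasure lborel (A i))" .
  qed auto
qed

text \<open>Fubini for the first \<open>p\<close> coordinates. By \<open>cong\<close> the function
  reads only its first \<open>p + n\<close> coordinates, which makes gluing by \<open>merge\<close>
  interchangeable with the case distinction of \<open>fredholm_integrand\<close>.\<close>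

lemma LINT_PiM_split:
  fixes f :: "(nat \<Rightarrow> real) \<Rightarrow> complex"
  assumes f: "integrable (PiM {..<p + n} (\<lambda>_. lborel)) f"
    and cong: "\<And>x y. (\<And>i. i < p + n \<Longrightarrow> x i = y i) \<Longrightarrow> f x = f y"
  shows "(LINT \<zeta>|PiM {..<p + n} (\<lambda>_. lborel). f \<zeta>) =
    (LINT s|PiM {..<p} (\<lambda>_. lborel). LINT \<xi>|PiM {..<n} (\<lambda>_. lborel). f (\<lambda>i. if i < p then s i else \<xi> (i - p)))"
proof -
  interpret product_sigma_finite "\<lambda>_. lborel :: real measure" by standard
  let ?I = "{..<p}" and ?J = "{p..<p + n}"
  have IJ: "?I \<union> ?J = {..<p + n}" by auto
  have f': "integrable (PiM (?I \<union> ?J) (\<lambda>_. lborel)) f" using f by (simp add: IJ)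
  have [measurable]: "f \<in> borel_measurable (PiM (?I \<union> ?J) (\<lambda>_. lborel))" using f' by simp
  have "(LINT \<zeta>|PiM {..<p + n} (\<lambda>_. lborel). f \<zeta>) =
      (LINT s|PiM ?I (\<lambda>_. lborel). LINT \<eta>|PiM ?J (\<lambda>_. lborel). f (merge ?I ?J (s, \<eta>)))"
    using product_integral_fold[OF _ _ _ f'] by (simp add: IJ ivl_disj_int)
  also have "\<dots> = (LINT s|PiM ?I (\<lambda>_. lborel). LINT \<xi>|PiM {..<n} (\<lambda>_. lborel). f (\<lambda>i. if i < p then s i else \<xi> (i - p)))"
  proof (rule Bochner_Integration.integral_cong[OF refl])
    fix s :: "nat \<Rightarrow> real" assume s: "s \<in> space (PiM ?I (\<lambda>_. lborel))"
    have "(LINT \<eta>|PiM ?J (\<lambda>_. lborel). f (merge ?I ?J (s, \<eta>))) =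
        (LINT \<xi>|PiM {..<n} (\<lambda>_. lborel). f (merge ?I ?J (s, \<lambda>i\<in>?J. \<xi> (i - p))))"
    proof (subst distr_PiM_shift[symmetric], rule integral_distr)
      show "(\<lambda>\<xi>. \<lambda>i\<in>?J. \<xi> (i - p)) \<in> PiM {..<n} (\<lambda>_. lborel) \<rightarrow>\<^sub>M PiM ?J (\<lambda>_. lborel)"
        by (rule measurable_restrict) (auto intro!: measurable_component_singleton)
      show "(\<lambda>\<eta>. f (merge ?I ?J (s, \<eta>))) \<in> borel_measurable (PiM ?J (\<lambda>_. lborel))"
        using s by measurable
    qed
    also have "\<dots> = (LINT \<xi>|PiM {..<n} (\<lambda>_. lborel). f (\<lambda>i. if i < p then s i else \<xi> (i - p)))"
      by (intro Bochner_Integration.integral_cong refl cong) (auto simp: merge_def)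
    finally show "(LINT \<eta>|PiM ?J (\<lambda>_. lborel). f (merge ?I ?J (s, \<eta>))) =
        (LINT \<xi>|PiM {..<n} (\<lambda>_. lborel). f (\<lambda>i. if i < p then s i else \<xi> (i - p)))" .
  qed
  finally show ?thesis .
qed

text \<open>
  The sum is \<open>f\<^sup>(\<^sup>p\<^sup>)(1) / p!\<close> for \<open>f(w) = \<Sum>\<^sub>m b\<^sub>m w\<^sup>m\<close>; the proof expands \<open>f\<close> around \<open>1\<close> and evaluates at \<open>0\<close>.
\<close>

lemma suminf_choose_nonzero:
  fixes b :: "nat \<Rightarrow> complex"
  assumes summ: "summable (\<lambda>m. cmod (b m) * 2 ^ m)" and b0: "b 0 \<noteq> 0"
  shows "\<exists>p. (\<Sum>m. of_nat (m choose p) * b m) \<noteq> 0"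
proof (rule ccontr)
  assume "\<not> ?thesis"
  then have zero: "(\<Sum>m. of_nat (m choose p) * b m) = 0" for p by blast
  have choose: "cmod (of_nat (m choose p) * b m) \<le> cmod (b m) * 2 ^ m" for m p
  proof -
    have "real (m choose p) \<le> real (2 ^ m)" using binomial_le_pow2 of_nat_le_iff by blast
    then have "real (m choose p) * cmod (b m) \<le> 2 ^ m * cmod (b m)" by (intro mult_right_mono) auto
    then show ?thesis by (simp add: norm_mult mult.commute)
  qed
  have summ_p: "summable (\<lambda>m. of_nat (m choose p) * b m)" for p
    by (rule summable_comparison_test'[OF summ, of 0]) (rule choose)
  \<comment> \<open>The binomial expansion of \<open>(1 - 1) ^ m\<close>, truncated: exact once
    \<open>P\<close> exceeds \<open>m\<close> and at most \<open>2 ^ m\<close> in modulus always, so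
    truncation costs only a tail of the series.\<close>
  define t :: "nat \<Rightarrow> nat \<Rightarrow> complex" where "t P m = (\<Sum>p<P. (-1) ^ p * of_nat (m choose p))" for P m
  have t_small: "t P m = (if m = 0 then 1 else 0)" if "m < P" for P m
  proof -
    have "t P m = (\<Sum>p\<le>m. (-1) ^ p * of_nat (m choose p))"
      unfolding t_def using that by (intro sum.mono_neutral_right) (auto simp: binomial_eq_0)
    then show ?thesis using choose_alternating_sum[of m, where 'a = complex] by auto
  qed
  have t_le: "cmod (t P m) \<le> 2 ^ m" for P m
  proof -
    have "cmod (t P m) \<le> (\<Sum>p<P. real (m choose p))"
      unfolding t_def by (rule order_trans[OF norm_sum]) (simp add: norm_mult norm_power)
    also have "\<dots> \<le> (\<Sum>p\<in>{..<P} \<union> {..m}. real (m choose p))" by (rule sum_mono2) auto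
    also have "\<dots> = (\<Sum>p\<le>m. real (m choose p))"
      by (rule sum.mono_neutral_right) (auto simp: binomial_eq_0)
    also have "\<dots> = 2 ^ m" by (simp flip: of_nat_sum add: choose_row_sum)
    finally show ?thesis .
  qed
  obtain N where N: "\<And>n. n \<ge> N \<Longrightarrow> norm (\<Sum>i. cmod (b (i + n)) * 2 ^ (i + n)) < cmod (b 0)"
    using suminf_exist_split[OF _ summ, of "cmod (b 0)"] b0 by auto
  \<comment> \<open>The successor ensures \<open>0 < P\<close>, so that the term \<open>b 0\<close>
    lies before the tail.\<close>
  define P where "P = Suc N"
  have "0 = (\<Sum>p<P. (-1) ^ p * (\<Sum>m. of_nat (m choose p) * b m))" by (simp add: zero)
  also have "\<dots> = (\<Sum>p<P. \<Sum>m. (-1) ^ p * (of_nat (m choose p) * b m))"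
    by (intro sum.cong refl suminf_mult[symmetric] summ_p)
  also have "\<dots> = (\<Sum>m. \<Sum>p<P. (-1) ^ p * (of_nat (m choose p) * b m))"
    by (intro suminf_sum[symmetric] summable_mult summ_p)
  also have "\<dots> = (\<Sum>m. t P m * b m)" by (simp add: t_def sum_distrib_right mult.assoc)
  also have "\<dots> = (\<Sum>m. t P (m + P) * b (m + P)) + (\<Sum>m<P. t P m * b m)"
  proof (rule suminf_split_initial_segment, rule summable_comparison_test'[OF summ, of 0])
    show "norm (t P m * b m) \<le> cmod (b m) * 2 ^ m" for m
      using mult_right_mono[OF t_le[of P m], of "cmod (b m)"] by (simp add: norm_mult mult.commute)
  qed
  also have "(\<Sum>m<P. t P m * b m) = (\<Sum>m<P. if m = 0 then b 0 else 0)"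
    by (intro sum.cong refl) (auto simp: t_small)
  also have "\<dots> = b 0" by (simp add: P_def)
  finally have "cmod (b 0) = cmod (\<Sum>m. t P (m + P) * b (m + P))"
    by (metis add.commute add_eq_0_iff norm_minus_cancel)
  also have "\<dots> \<le> (\<Sum>m. cmod (b (m + P)) * 2 ^ (m + P))"
  proof (rule norm_suminf_le)
    show "norm (t P (m + P) * b (m + P)) \<le> cmod (b (m + P)) * 2 ^ (m + P)" for m
      using mult_right_mono[OF t_le[of P "m + P"], of "cmod (b (m + P))"] by (simp add: norm_mult mult.commute)
    show "summable (\<lambda>m. cmod (b (m + P)) * 2 ^ (m + P))"
      using summable_ignore_initial_segment[OF summ, of P] .
  qed
  also have "\<dots> < cmod (b 0)" using N[of P] by (simp add: P_def)
  finally show False by simp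
qed


section \<open>The Fredholm series of a dominated pencil\<close>

locale dominated_pencil =
  fixes h k :: kernel and \<alpha> \<beta> :: "real \<Rightarrow> real"
  assumes cont_h: "continuous_on UNIV (\<lambda>(s, t). h s t)" and cont_k: "continuous_on UNIV (\<lambda>(s, t). k s t)"
    and cont_weight: "continuous_on UNIV \<alpha>" "continuous_on UNIV \<beta>"
    and nonneg: "\<And>t. 0 \<le> \<alpha> t" "\<And>t. 0 \<le> \<beta> t"
    and decay: "(\<alpha> \<longlongrightarrow> 0) at_infinity" "(\<beta> \<longlongrightarrow> 0) at_infinity"
    and L2: "integrable lborel (\<lambda>t. (\<alpha> t)\<^sup>2)" "integrable lborel (\<lambda>t. (\<beta> t)\<^sup>2)"
    and h_le: "\<And>x y. cmod (h x y) \<le> \<alpha> x * \<beta> y" and k_le: "\<And>x y. cmod (k x y) \<le> \<alpha> x * \<beta> y"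
begin

abbreviation T :: "complex \<Rightarrow> kernel"
  where "T \<equiv> kernel_pencil h k"

abbreviation \<omega> :: "nat + nat \<Rightarrow> real \<Rightarrow> real"
  where "\<omega> \<equiv> case_sum (\<lambda>_. \<alpha>) (\<lambda>_. \<beta>)"

abbreviation cube :: "nat \<Rightarrow> (nat \<Rightarrow> real) measure"
  where "cube n \<equiv> PiM {..<n} (\<lambda>_. lborel)"

lemma decaying_weights: "decaying_weights (fredholm_vars p) \<omega>"
proof
  show "finite (fredholm_vars p)" by (simp add: fredholm_vars_def)
qed (use cont_weight nonneg decay L2 in \<open>auto split: sum.split\<close>)

sublocale vars: decaying_weights "fredholm_vars p" \<omega> for p
  by (rule decaying_weights)

lemma weight_eq: "vars.weight (fredholm_vars p) x = (\<Prod>i<p. \<alpha> (x (Inl i)) * \<beta> (x (Inr i)))"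
  unfolding vars.weight_def fredholm_vars_def by (simp add: prod.Plus prod.distrib)

definition \<gamma> :: real
  where "\<gamma> = (LINT t|lborel. \<alpha> t * \<beta> t)"

lemma integrable_diag: "integrable lborel (\<lambda>t. \<alpha> t * \<beta> t)"
proof (rule Bochner_Integration.integrable_bound[of _ "\<lambda>t. (\<alpha> t)\<^sup>2 + (\<beta> t)\<^sup>2"])
  show "integrable lborel (\<lambda>t. (\<alpha> t)\<^sup>2 + (\<beta> t)\<^sup>2)" using L2 by simp
  show "(\<lambda>t. \<alpha> t * \<beta> t) \<in> borel_measurable lborel"
    using borel_measurable_continuous_onI[OF cont_weight(1)] borel_measurable_continuous_onI[OF cont_weight(2)] by simp
  have "\<alpha> t * \<beta> t \<le> (\<alpha> t)\<^sup>2 + (\<beta> t)\<^sup>2" for t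
    using sum_squares_bound[of "\<alpha> t" "\<beta> t"] mult_nonneg_nonneg[OF nonneg(1)[of t] nonneg(2)[of t]] by linarith
  then show "AE t in lborel. norm (\<alpha> t * \<beta> t) \<le> norm ((\<alpha> t)\<^sup>2 + (\<beta> t)\<^sup>2)"
    using nonneg by simp
qed

lemma \<gamma>_nonneg: "0 \<le> \<gamma>"
  unfolding \<gamma>_def using nonneg by simp

lemma cube_prod:
  "integrable (cube n) (\<lambda>\<xi>. \<Prod>i<n. \<alpha> (\<xi> i) * \<beta> (\<xi> i))"
  "(LINT \<xi>|cube n. (\<Prod>i<n. \<alpha> (\<xi> i) * \<beta> (\<xi> i))) = \<gamma> ^ n"
proof -
  interpret product_sigma_finite "\<lambda>_::nat. lborel :: real measure" by standard
  show "integrable (cube n) (\<lambda>\<xi>. \<Prod>i<n. \<alpha> (\<xi> i) * \<beta> (\<xi> i))"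
    by (rule product_integrable_prod) (use integrable_diag in auto)
  show "(LINT \<xi>|cube n. (\<Prod>i<n. \<alpha> (\<xi> i) * \<beta> (\<xi> i))) = \<gamma> ^ n"
    by (subst product_integral_prod) (use integrable_diag in \<open>auto simp: \<gamma>_def\<close>)
qed

lemma cont_T: "continuous_on UNIV (\<lambda>(s, t). T z s t)"
  using cont_h cont_k unfolding kernel_pencil_def case_prod_unfold by (intro continuous_intros)

lemma T_le: "cmod z \<le> R \<Longrightarrow> cmod (T z x y) \<le> (1 + R) * \<alpha> x * \<beta> y"
proof -
  assume z: "cmod z \<le> R"
  have "cmod (T z x y) \<le> cmod (h x y) + cmod z * cmod (k x y)"
    unfolding kernel_pencil_def by (rule order_trans[OF norm_triangle_ineq4]) (simp add: norm_mult)
  also have "\<dots> \<le> \<alpha> x * \<beta> y + R * (\<alpha> x * \<beta> y)"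
    using z h_le k_le nonneg order_trans[OF norm_ge_zero z] by (intro add_mono mult_mono) auto
  finally show ?thesis by (simp add: algebra_simps)
qed

lemma T_det_le:
  assumes z: "cmod z \<le> R"
  shows "cmod (kernel_det (T z) \<nu> x y) \<le> sqrt (real \<nu> ^ \<nu>) * (1 + R) ^ \<nu> * (\<Prod>i<\<nu>. \<alpha> (x i) * \<beta> (y i))"
proof -
  have R: "0 \<le> R" using order_trans[OF norm_ge_zero z] .
  have "cmod (kernel_det (T z) \<nu> x y) \<le> sqrt (real \<nu> ^ \<nu>) * (\<Prod>i<\<nu>. (1 + R) * \<alpha> (x i) * \<beta> (y i))"
    unfolding kernel_det_def using nonneg R by (intro det_le_prod_weights T_le z) auto
  then show ?thesis by (simp add: prod.distrib mult.assoc)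
qed

text \<open>Hadamard's factor for a matrix of size \<open>p + n\<close>, the pencil's factor
  \<open>1 + R\<close> once per row, one \<open>\<gamma>\<close> per integration variable, and the
  normalization of \<open>fredholm_B\<close>.\<close>

definition B :: "nat \<Rightarrow> nat \<Rightarrow> real \<Rightarrow> real"
  where "B p n R = sqrt (real (p + n) ^ (p + n)) * (1 + R) ^ (p + n) * \<gamma> ^ n / fact n"

lemma summable_B: "0 \<le> R \<Longrightarrow> summable (\<lambda>n. B p n R)"
  unfolding B_def using \<gamma>_nonneg by (intro summable_Hadamard_bound) auto

lemma integrand_le:
  assumes z: "cmod z \<le> R"
  shows "cmod (fredholm_integrand (T z) p n x \<xi>) \<le>
    sqrt (real (p + n) ^ (p + n)) * (1 + R) ^ (p + n) * vars.weight (fredholm_vars p) x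
      * (\<Prod>i<n. \<alpha> (\<xi> i) * \<beta> (\<xi> i))"
  using T_det_le[OF z] unfolding fredholm_integrand_def weight_eq
  by (rule order_trans) (simp add: prod_lessThan_add mult.assoc)

lemma integrand_measurable: "fredholm_integrand (T z) p n x \<in> borel_measurable (cube n)"
proof -
  have "(\<lambda>\<xi>. if i < p then c else \<xi> (i - p)) \<in> borel_measurable (cube n)" if "i < p + n" for i c
  proof (cases "i < p")
    case False
    then show ?thesis
      using measurable_component_singleton[of "i - p" "{..<n}" "\<lambda>_. lborel"] that by simp
  qed simp
  then show ?thesis
    unfolding fredholm_integrand_def[abs_def] by (intro measurable_kernel_det[OF cont_T])
qed

lemma integrand_integrable: "integrable (cube n) (fredholm_integrand (T z) p n x)"
  by (rule integrable_norm_boundI[OF integrable_mult_right[OF cube_prod(1)] integrand_measurable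
        integrand_le[OF order_refl]])

lemma fredholm_B_le:
  assumes z: "cmod z \<le> R"
  shows "cmod (fredholm_B (T z) p n x) \<le> B p n R * vars.weight (fredholm_vars p) x"
proof -
  let ?c = "sqrt (real (p + n) ^ (p + n)) * (1 + R) ^ (p + n) * vars.weight (fredholm_vars p) x"
  have "cmod (LINT \<xi>|cube n. fredholm_integrand (T z) p n x \<xi>) \<le> (LINT \<xi>|cube n. cmod (fredholm_integrand (T z) p n x \<xi>))"
    by (rule integral_norm_bound)
  also have "\<dots> \<le> (LINT \<xi>|cube n. ?c * (\<Prod>i<n. \<alpha> (\<xi> i) * \<beta> (\<xi> i)))"
    by (intro integral_mono integrable_norm integrand_integrable integrable_mult_right cube_prod(1) integrand_le z)
  also have "\<dots> = ?c * \<gamma> ^ n" by (simp only: integral_mult_right_zero cube_prod(2))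
  finally have "cmod (LINT \<xi>|cube n. fredholm_integrand (T z) p n x \<xi>) / fact n \<le> ?c * \<gamma> ^ n / fact n"
    by (rule divide_right_mono) simp
  then show ?thesis by (simp add: fredholm_B_def B_def norm_divide mult_ac)
qed

lemma continuous_fredholm_B: "continuous_on UNIV (fredholm_B (T z) p n)"
proof (rule continuous_on_UNIV_sequentiallyI)
  fix u :: "nat \<Rightarrow> nat + nat \<Rightarrow> real" and x assume u: "u \<longlonglongrightarrow> x"
  have ui: "(\<lambda>m. u m v) \<longlonglongrightarrow> x v" for v
    by (rule continuous_on_tendsto_compose[OF continuous_on_product_coordinates u]) auto
  let ?c = "sqrt (real (p + n) ^ (p + n)) * (1 + cmod z) ^ (p + n)"
  have "(\<lambda>m. LINT \<xi>|cube n. fredholm_integrand (T z) p n (u m) \<xi>) \<longlonglongrightarrow>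
      (LINT \<xi>|cube n. fredholm_integrand (T z) p n x \<xi>)"
  proof (rule integral_dominated_convergence[where
        w = "\<lambda>\<xi>. ?c * vars.bound p ^ card (fredholm_vars p) * (\<Prod>i<n. \<alpha> (\<xi> i) * \<beta> (\<xi> i))"])
    show "integrable (cube n) (\<lambda>\<xi>. ?c * vars.bound p ^ card (fredholm_vars p) * (\<Prod>i<n. \<alpha> (\<xi> i) * \<beta> (\<xi> i)))"
      by (intro integrable_mult_right cube_prod(1))
    show "AE \<xi> in cube n. (\<lambda>m. fredholm_integrand (T z) p n (u m) \<xi>) \<longlonglongrightarrow> fredholm_integrand (T z) p n x \<xi>"
      unfolding fredholm_integrand_def
      by (intro AE_I2 tendsto_kernel_det[OF cont_T]) (auto intro: ui)
    show "AE \<xi> in cube n. norm (fredholm_integrand (T z) p n (u m) \<xi>)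
        \<le> ?c * vars.bound p ^ card (fredholm_vars p) * (\<Prod>i<n. \<alpha> (\<xi> i) * \<beta> (\<xi> i))" for m
    proof (intro AE_I2 order_trans[OF integrand_le[OF order_refl]] mult_right_mono mult_left_mono)
      show "vars.weight (fredholm_vars p) (u m) \<le> vars.bound p ^ card (fredholm_vars p)"
        by (rule vars.weight_le) simp
    qed (auto intro!: prod_nonneg mult_nonneg_nonneg simp: nonneg)
  qed (use integrand_measurable in auto)
  then show "(\<lambda>m. fredholm_B (T z) p n (u m)) \<longlonglongrightarrow> fredholm_B (T z) p n x"
    unfolding fredholm_B_def by (intro tendsto_intros)
qed

lemma dominated_fredholm_B:
  assumes "cmod z \<le> R"
  shows "vars.dominated p (fredholm_B (T z) p n) (B p n R)"
proof -
  have "0 \<le> R" using order_trans[OF norm_ge_zero assms] .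
  then have "0 \<le> B p n R" using \<gamma>_nonneg by (simp add: B_def)
  then show ?thesis
    unfolding vars.dominated_def using continuous_fredholm_B fredholm_B_le[OF assms] by blast
qed

lemma holomorphic_fredholm_B: "(\<lambda>z. fredholm_B (T z) p n x) holomorphic_on UNIV"
  unfolding fredholm_B_def
proof (intro holomorphic_intros holomorphic_on_LINT)
  \<comment> \<open>By the Leibniz formula the integrand is a polynomial in the parameter.\<close>
  show "(\<lambda>z. fredholm_integrand (T z) p n x \<xi>) holomorphic_on UNIV" for \<xi>
    unfolding fredholm_integrand_def kernel_det_permutes kernel_pencil_def by (intro holomorphic_intros)
  show "\<exists>g. integrable (cube n) g \<and> (\<forall>z \<xi>. cmod z \<le> R \<longrightarrow> cmod (fredholm_integrand (T z) p n x \<xi>) \<le> g \<xi>)" for R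
    using integrand_le integrable_mult_right[OF cube_prod(1)]
    by (intro exI[of _ "\<lambda>\<xi>. sqrt (real (p + n) ^ (p + n)) * (1 + R) ^ (p + n)
        * vars.weight (fredholm_vars p) x * (\<Prod>i<n. \<alpha> (\<xi> i) * \<beta> (\<xi> i))"]) blast
qed (rule integrand_measurable)

lemma entire_fredholm:
  "entire_series (powertop_real (fredholm_vars p)) (\<lambda>z. fredholm_B (T z) p) (\<lambda>z. fredholm_D (T z) p)"
  unfolding fredholm_D_def[abs_def]
  by (rule vars.entire_series_weighted[OF dominated_fredholm_B summable_B holomorphic_fredholm_B])

lemma entire_fredholm_view1:
  "v \<in> fredholm_vars p \<Longrightarrow> entire_series_L2 (powertop_real (fredholm_vars p - {v}))
    (\<lambda>z n. view1 v (fredholm_B (T z) p n)) (\<lambda>z. view1 v (fredholm_D (T z) p))"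
  unfolding fredholm_D_def[abs_def]
  by (rule vars.entire_series_view1[OF dominated_fredholm_B summable_B holomorphic_fredholm_B])

lemma entire_fredholm_view2:
  "i < p \<Longrightarrow> j < p \<Longrightarrow> entire_series_L2 (powertop_real (fredholm_vars p - {Inl i, Inr j}))
    (\<lambda>z n. view2 (Inl i) (Inr j) (fredholm_B (T z) p n)) (\<lambda>z. view2 (Inl i) (Inr j) (fredholm_D (T z) p))"
  unfolding fredholm_D_def[abs_def]
  by (rule vars.entire_series_view2[OF dominated_fredholm_B summable_B holomorphic_fredholm_B])
    (auto simp: fredholm_vars_def)

text \<open>On the diagonal the \<open>p\<close> free variables become integration variables of
  \<open>b (p + n)\<close>, so only the factorials differ. \<open>restrict\<close> keeps the
  diagonal points in the carrier, where vanishing of \<open>fredholm_D\<close> will be assumed;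
  \<open>y\<close> is arbitrary because \<open>b\<close> has no free variables.\<close>

lemma LINT_fredholm_B_diagonal:
  fixes p n :: nat and z :: complex
  defines "b \<equiv> fredholm_B (T z) 0"
    and "x \<equiv> \<lambda>s. restrict (case_sum s s) (fredholm_vars p)"
  shows "(LINT s|cube p. fredholm_B (T z) p n (x s)) = fact (p + n) / fact n * b (p + n) y"
    and "(\<lambda>s. fredholm_B (T z) p n (x s)) \<in> borel_measurable (cube p)"
proof -
  interpret sigma_finite_measure "cube n"
  proof -
    interpret product_sigma_finite "\<lambda>_::nat. lborel :: real measure" by standard
    interpret finite_product_sigma_finite "\<lambda>_::nat. lborel :: real measure" "{..<n}" by standard auto
    show "sigma_finite_measure (cube n)" by (rule sigma_finite_measure_axioms)
  qed
  let ?f = "\<lambda>\<zeta>. kernel_det (T z) (p + n) \<zeta> \<zeta>"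
  have xs: "fredholm_integrand (T z) p n (x s) \<xi> = ?f (\<lambda>i. if i < p then s i else \<xi> (i - p))" for s \<xi>
    unfolding fredholm_integrand_def x_def fredholm_vars_def by (intro kernel_det_cong) auto
  have b: "b (p + n) y = (LINT \<zeta>|cube (p + n). ?f \<zeta>) / fact (p + n)"
    by (simp add: b_def fredholm_B_def fredholm_integrand_def)
  have "integrable (cube (p + n)) ?f"
    using integrand_integrable[of "p + n" z 0 y] by (simp add: fredholm_integrand_def[abs_def])
  then have "(LINT \<zeta>|cube (p + n). ?f \<zeta>) = (LINT s|cube p. LINT \<xi>|cube n. ?f (\<lambda>i. if i < p then s i else \<xi> (i - p)))"
    by (rule LINT_PiM_split) (auto intro: kernel_det_cong)
  also have "\<dots> = fact n * (LINT s|cube p. fredholm_B (T z) p n (x s))"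
    by (simp add: fredholm_B_def xs)
  finally show "(LINT s|cube p. fredholm_B (T z) p n (x s)) = fact (p + n) / fact n * b (p + n) y"
    by (simp add: b)
  have "(\<lambda>s. LINT \<xi>|cube n. ?f (\<lambda>i. if i < p then s i else \<xi> (i - p))) \<in> borel_measurable (cube p)"
  proof (rule borel_measurable_lebesgue_integral)
    have "(\<lambda>m. if i < p then fst m i else snd m (i - p)) \<in> borel_measurable (cube p \<Otimes>\<^sub>M cube n)" if "i < p + n" for i
    proof (cases "i < p")
      case True
      then show ?thesis
        using measurable_compose[OF measurable_fst measurable_component_singleton[of i "{..<p}" "\<lambda>_. lborel"]] by simp
    next
      case False
      then show ?thesis
        using measurable_compose[OF measurable_snd measurable_component_singleton[of "i - p" "{..<n}" "\<lambda>_. lborel"]] that by simp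
    qed
    then show "(\<lambda>(s, \<xi>). ?f (\<lambda>i. if i < p then s i else \<xi> (i - p))) \<in> borel_measurable (cube p \<Otimes>\<^sub>M cube n)"
      unfolding case_prod_unfold by (intro measurable_kernel_det[OF cont_T])
  qed
  then show "(\<lambda>s. fredholm_B (T z) p n (x s)) \<in> borel_measurable (cube p)"
    by (simp add: fredholm_B_def xs)
qed

lemma fredholm_D_nonzero:
  "\<exists>p. \<exists>x\<in>topspace (powertop_real (fredholm_vars p)). fredholm_D (T z) p x \<noteq> 0"
proof (rule ccontr)
  assume "\<not> ?thesis"
  then have zero: "x \<in> topspace (powertop_real (fredholm_vars p)) \<Longrightarrow> fredholm_D (T z) p x = 0" for p x by blast
  define b where "b m = fredholm_B (T z) 0 m (\<lambda>_. 0)" for m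
  \<comment> \<open>The factor \<open>2 ^ m\<close> is absorbed by the radius, as
    \<open>2 (1 + |z|) = 1 + (1 + 2 |z|)\<close>.\<close>
  have b_le: "cmod (b m) * 2 ^ m \<le> B 0 m (1 + 2 * cmod z)" for m
  proof -
    have "cmod (b m) \<le> B 0 m (cmod z)"
      using fredholm_B_le[OF order_refl, of z 0 m "\<lambda>_. 0"] by (simp add: b_def weight_eq)
    then have "cmod (b m) * 2 ^ m \<le> B 0 m (cmod z) * 2 ^ m" by (rule mult_right_mono) simp
    also have "\<dots> = B 0 m (1 + 2 * cmod z)"
    proof -
      have "(1 + cmod z) ^ m * 2 ^ m = ((1 + cmod z) * 2) ^ m" by (rule power_mult_distrib[symmetric])
      also have "(1 + cmod z) * 2 = 1 + (1 + 2 * cmod z)" by simp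
      finally show ?thesis by (simp add: B_def)
    qed
    finally show ?thesis .
  qed
  have summ: "summable (\<lambda>m. cmod (b m) * 2 ^ m)"
    by (rule summable_comparison_test'[OF summable_B, of "1 + 2 * cmod z" 0 _ 0]) (use b_le in auto)
  \<comment> \<open>The empty determinant is 1, and the product measure over no coordinates has mass
    1.\<close>
  moreover have "b 0 \<noteq> 0"
    by (simp add: b_def fredholm_B_def fredholm_integrand_def kernel_det_0 PiM_empty
        lebesgue_integral_count_space_finite)
  moreover have "(\<Sum>m. of_nat (m choose p) * b m) = 0" for p
  proof -
    let ?x = "\<lambda>s. restrict (case_sum s s) (fredholm_vars p)"
    let ?F = "\<lambda>n s. fredholm_B (T z) p n (?x s)"
    let ?w = "\<lambda>s. \<Prod>i<p. \<alpha> (s i) * \<beta> (s i)"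
    have w: "vars.weight (fredholm_vars p) (?x s) = ?w s" for s
      unfolding weight_eq by (intro prod.cong) (auto simp: fredholm_vars_def)
    have le: "cmod (?F n s) \<le> B p n (cmod z) * ?w s" for n s
      using fredholm_B_le[OF order_refl, of z p n "?x s"] by (simp only: w)
    have meas: "?F n \<in> borel_measurable (cube p)" for n by (rule LINT_fredholm_B_diagonal)
    have int: "integrable (cube p) (?F n)" for n
      by (rule integrable_norm_boundI[OF integrable_mult_right[OF cube_prod(1)] meas le])
    have "(LINT s|cube p. (\<Sum>n. ?F n s)) = (\<Sum>n. LINT s|cube p. ?F n s)"
    proof (rule integral_suminf[OF int])
      have "summable (\<lambda>n. norm (?F n s))" for s
        by (rule summable_comparison_test'[OF summable_mult2[OF summable_B], of "cmod z" 0 _ p "?w s"])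
          (use le in auto)
      then show "AE s in cube p. summable (\<lambda>n. norm (?F n s))" by simp
      show "summable (\<lambda>n. LINT s|cube p. norm (?F n s))"
      proof (rule summable_comparison_test'[OF summable_mult2[OF summable_B], of "cmod z" 0 _ p "\<gamma> ^ p"])
        fix n
        have "(LINT s|cube p. norm (?F n s)) \<le> (LINT s|cube p. B p n (cmod z) * ?w s)"
          by (intro integral_mono integrable_norm int integrable_mult_right cube_prod(1) le)
        also have "\<dots> = B p n (cmod z) * \<gamma> ^ p" by (simp only: integral_mult_right_zero cube_prod(2))
        finally show "norm (LINT s|cube p. norm (?F n s)) \<le> B p n (cmod z) * \<gamma> ^ p" by simp
      qed simp
    qed
    moreover have "(\<Sum>n. ?F n s) = 0" for s
      using zero[of "?x s" p] by (simp add: fredholm_D_def)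
    ultimately have "0 = (\<Sum>n. fact (p + n) / fact n * b (p + n))"
      by (simp add: LINT_fredholm_B_diagonal(1)[where y = "\<lambda>_. 0"] b_def)
    also have "\<dots> = (\<Sum>n. fact p * (of_nat (n + p choose p) * b (n + p)))"
      by (intro arg_cong[where f = suminf] ext) (simp add: binomial_fact[of p] add.commute)
    finally have 0: "(\<Sum>n. fact p * (of_nat (n + p choose p) * b (n + p))) = 0" by simp
    have "summable (\<lambda>m. of_nat (m choose p) * b m)"
    proof (rule summable_comparison_test'[OF summ, of 0])
      fix m
      have "real (m choose p) \<le> real (2 ^ m)" using binomial_le_pow2 of_nat_le_iff by blast
      then have "real (m choose p) * cmod (b m) \<le> 2 ^ m * cmod (b m)" by (intro mult_right_mono) auto
      then show "norm (of_nat (m choose p) * b m) \<le> cmod (b m) * 2 ^ m" by (simp add: norm_mult mult.commute)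
    qed
    note split = suminf_split_initial_segment[OF this, of p]
      and shifted = summable_ignore_initial_segment[OF this, of p]
    \<comment> \<open>The coefficients with \<open>m < p\<close> vanish, so the series shifted by
      \<open>p\<close> already has the full sum.\<close>
    have "(\<Sum>m<p. of_nat (m choose p) * b m) = 0" by (intro sum.neutral) (simp add: binomial_eq_0)
    then show ?thesis using 0 split suminf_mult[OF shifted, of "fact p"] by simp
  qed
  ultimately show False using suminf_choose_nonzero by blast
qed

end


section \<open>The theorem\<close>

lemma K0_kernel_continuous: "K0_kernel a \<Longrightarrow> continuous_on UNIV (\<lambda>(s, t). a s t)"
  by (simp add: K0_kernel_def C0_def)

lemma K0_kernel_diagonal_decay:
  assumes "K0_kernel a"
  shows "((\<lambda>s. sqrt (Re (a s s))) \<longlongrightarrow> 0) at_infinity"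
proof -
  have "((\<lambda>s. a s s) \<longlongrightarrow> 0) at_infinity"
  proof (rule Lim_at_infinityI)
    fix e :: real assume "0 < e"
    moreover have "\<forall>e>0. \<exists>K. compact K \<and> (\<forall>x\<in>UNIV - K. cmod (case x of (s, t) \<Rightarrow> a s t) < e)"
      using assms by (simp add: K0_kernel_def C0_def)
    ultimately obtain K where K: "compact K" and small: "\<forall>x\<in>UNIV - K. cmod (case x of (s, t) \<Rightarrow> a s t) < e"
      by blast
    have less: "cmod (a s t) < e" if "(s, t) \<notin> K" for s t
      using bspec[OF small, of "(s, t)"] that by simp
    obtain r where r: "\<And>x. x \<in> K \<Longrightarrow> norm x \<le> r"
      using compact_imp_bounded[OF K] unfolding bounded_iff by blast
    have "dist (a s s) 0 \<le> e" if "r + 1 \<le> norm s" for s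
    proof -
      have "norm s \<le> norm (s, s)" using norm_fst_le[of s s] by simp
      then have "(s, s) \<notin> K" using r[of "(s, s)"] that by auto
      then show ?thesis using less by (simp add: less_imp_le)
    qed
    then show "\<exists>r. \<forall>s. r \<le> norm s \<longrightarrow> dist (a s s) 0 \<le> e" by blast
  qed
  then have "((\<lambda>s. sqrt (Re (a s s))) \<longlongrightarrow> sqrt (Re 0)) at_infinity"
    by (intro tendsto_intros)
  then show ?thesis by simp
qed

text \<open>The first conjunct rules out that an integral in \<open>fredholm_B\<close> is merely the
  default value 0 for a non-integrable function. Nonvanishing is asserted at a point of the carrier,
  since values elsewhere do not belong to an element of the space.\<close>

theorem theorem3:
  fixes H S Hadj Sadj A A' :: "real L2 \<Rightarrow> real L2"
    and h k a a' :: "real \<Rightarrow> real \<Rightarrow> complex"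
    and T :: "complex \<Rightarrow> real \<Rightarrow> real \<Rightarrow> complex"
  assumes "nuclear H" "induces h H" "h \<noteq> (\<lambda>s t. 0)"
    and "nuclear S" "induces k S"
    and "T = kernel_pencil h k"
    and "mercer_type k" "\<And>z. mercer_type (T z)"
    and "is_adjoint H Hadj" "is_adjoint S Sadj"
    and "is_sqrt_op A (\<lambda>f. Hadj (H f) + Sadj (S f))" "nuclear A"
    and "is_sqrt_op A' (\<lambda>f. H (Hadj f) + S (Sadj f))" "nuclear A'"
    and "K0_kernel a" "induces a A"
    and "K0_kernel a'" "induces a' A'"
    and "integrable lborel (\<lambda>s. a s s)" "has_trace A (LINT s|lborel. a s s)"
    and "integrable lborel (\<lambda>s. a' s s)" "has_trace A' (LINT s|lborel. a' s s)"
  shows "(\<forall>z p n x. integrable (\<Pi>\<^sub>M i\<in>{..<n}. lborel) (fredholm_integrand (T z) p n x)) \<and>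
    (\<forall>p. entire_series (powertop_real (fredholm_vars p))
        (\<lambda>z n. fredholm_B (T z) p n) (\<lambda>z. fredholm_D (T z) p)) \<and>
    (\<forall>p. \<forall>v\<in>fredholm_vars p. entire_series_L2 (powertop_real (fredholm_vars p - {v}))
        (\<lambda>z n. view1 v (fredholm_B (T z) p n)) (\<lambda>z. view1 v (fredholm_D (T z) p))) \<and>
    (\<forall>p. \<forall>i<p. \<forall>j<p. entire_series_L2 (powertop_real (fredholm_vars p - {Inl i, Inr j}))
        (\<lambda>z n. view2 (Inl i) (Inr j) (fredholm_B (T z) p n))
        (\<lambda>z. view2 (Inl i) (Inr j) (fredholm_D (T z) p))) \<and>
    (\<exists>p z. \<exists>x\<in>topspace (powertop_real (fredholm_vars p)). fredholm_D (T z) p x \<noteq> 0)"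
proof -
  \<comment> \<open>The pencil at parameter 0 is \<open>h\<close>, so the assumption on the pencil
    makes \<open>h\<close> a K0 kernel and in particular continuous.\<close>
  have T0: "T 0 = h" using \<open>T = kernel_pencil h k\<close> by (simp add: kernel_pencil_def)
  have "K0_kernel h" "K0_kernel k"
    using \<open>\<And>z. mercer_type (T z)\<close>[of 0] \<open>mercer_type k\<close> by (simp_all add: mercer_type_def T0)
  then have cont: "continuous_on UNIV (\<lambda>(s, t). h s t)" "continuous_on UNIV (\<lambda>(s, t). k s t)"
      "continuous_on UNIV (\<lambda>(s, t). a s t)" "continuous_on UNIV (\<lambda>(s, t). a' s t)"
    using \<open>K0_kernel a\<close> \<open>K0_kernel a'\<close> by (auto intro: K0_kernel_continuous)
  have pos: "positive_op A" "positive_op A'"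
    using \<open>is_sqrt_op A (\<lambda>f. Hadj (H f) + Sadj (S f))\<close> \<open>is_sqrt_op A' (\<lambda>f. H (Hadj f) + S (Sadj f))\<close>
    by (auto simp: is_sqrt_op_def)
  have adj: "cinner (H f) g = cinner f (Hadj g)" "cinner (S f) g = cinner f (Sadj g)"
      "cinner (Hadj f) g = cinner f (H g)" "cinner (Sadj f) g = cinner f (S g)" for f g
    using \<open>is_adjoint H Hadj\<close> \<open>is_adjoint S Sadj\<close> unfolding is_adjoint_def
    by (metis cinner_commute)+
  note norm_A = norm_is_sqrt_op[OF \<open>is_sqrt_op A (\<lambda>f. Hadj (H f) + Sadj (S f))\<close> adj(1,2)]
  note norm_A' = norm_is_sqrt_op[OF \<open>is_sqrt_op A' (\<lambda>f. H (Hadj f) + S (Sadj f))\<close> adj(3,4)]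
  have bounded: "bounded_op H" "bounded_op S"
    using \<open>nuclear H\<close> \<open>nuclear S\<close> by (auto simp: nuclear_def)
  have diag: "0 \<le> Re (a s s)" "0 \<le> Re (a' s s)" for s
    using kernel_diagonal_nonneg pos cont \<open>induces a A\<close> \<open>induces a' A'\<close> by blast+
  have cont_diag: "continuous_on UNIV (\<lambda>s. a s s)" "continuous_on UNIV (\<lambda>s. a' s s)"
    using continuous_on_compose2[OF cont(3), of UNIV "\<lambda>s. (s, s)"]
      continuous_on_compose2[OF cont(4), of UNIV "\<lambda>s. (s, s)"]
    by (simp_all add: continuous_on_Pair)
  interpret dominated_pencil h k "\<lambda>s. sqrt (Re (a' s s))" "\<lambda>s. sqrt (Re (a s s))"
  proof
    show "cmod (h x y) \<le> sqrt (Re (a' x x)) * sqrt (Re (a y y))" for x y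
      by (rule kernel_mixed_Schwarz[OF bounded(1) \<open>is_adjoint H Hadj\<close> pos norm_A(1) norm_A'(1)
            \<open>induces h H\<close> cont(1) \<open>induces a A\<close> cont(3) \<open>induces a' A'\<close> cont(4)])
    show "cmod (k x y) \<le> sqrt (Re (a' x x)) * sqrt (Re (a y y))" for x y
      by (rule kernel_mixed_Schwarz[OF bounded(2) \<open>is_adjoint S Sadj\<close> pos norm_A(2) norm_A'(2)
            \<open>induces k S\<close> cont(2) \<open>induces a A\<close> cont(3) \<open>induces a' A'\<close> cont(4)])
    show "integrable lborel (\<lambda>t. (sqrt (Re (a' t t)))\<^sup>2)" "integrable lborel (\<lambda>t. (sqrt (Re (a t t)))\<^sup>2)"
      using diag \<open>integrable lborel (\<lambda>s. a s s)\<close> \<open>integrable lborel (\<lambda>s. a' s s)\<close> by auto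
    show "continuous_on UNIV (\<lambda>s. sqrt (Re (a' s s)))" "continuous_on UNIV (\<lambda>s. sqrt (Re (a s s)))"
      by (intro continuous_intros cont_diag)+
  qed (use cont diag \<open>K0_kernel a\<close> \<open>K0_kernel a'\<close> in \<open>auto intro: K0_kernel_diagonal_decay\<close>)
  show ?thesis
    unfolding \<open>T = kernel_pencil h k\<close>
    using integrand_integrable entire_fredholm entire_fredholm_view1 entire_fredholm_view2
      fredholm_D_nonzero[where z = 0]
    by blast
qed

end
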